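(* Let $p\in(2,\infty)$, $L>0$, and let $\gamma:[0,L]\to\mathbb{R}^2$ be an arclength parametrized $p$-elastica with $\partial Z\ne\emptyset$, where $Z:=\{s\in[0,L]\mid k(s)=0\}$, $k$ is the signed curvature of $\gamma$, and $\partial Z$ is the relative topological boundary of $Z$ in $[0,L]$. If $\gamma$ is either linear, orbitlike, or circular, then $\gamma$ is analytic on $[0,L]$. If $\gamma$ is wavelike, then $\gamma\in W^{3,r}(0,L;\mathbb{R}^2)$ for any $r\in[1,\frac{p-1}{p-2})$, and $\gamma\notin W^{3,\frac{p-1}{p-2}}(0,L;\mathbb{R}^2)$. In addition, if $\gamma$ is flat-core, then the following statements hold. Let $M_p:=\lceil\frac2{p-2}\rceil\ge1$ and $R_p:=(M_p-\frac2{p-2})^{-1}>1$, where $\lceil\cdot\rceil$ stands for the ceiling function. (i) If $\frac2{p-2}$ is not an integer, then $\gamma\in W^{M_p+2,r}(0,L;\mathbb{R}^2)$ for any $r\in[1,R_p)$, and $\gamma\notin W^{M_p+2,R_p}(0,L;\mathbb{R}^2)$. (ii) If $\frac2{p-2}$ is an integer, then $\gamma\in W^{M_p+2,\infty}(0,L;\mathbb{R}^2)$. If in addition $Z$ is not discrete (or equivalently contains an interval), then $\gamma\notin W^{M_p+3,1}(0,L;\mathbb{R}^2)$.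
   Context: **$p$-elastica.** For an immersed curve $\gamma$ of class $W^{2,p}$ on a bounded interval $I$ ($\gamma'\ne0$ on $\overline I$), let $\mathcal{B}_p[\gamma]=\int_\gamma|k|^p\,ds$ ($s$ arclength, $k$ signed curvature) and let $\mathcal{L}[\gamma]$ be the length. The curve $\gamma\in W^{2,p}(I;\mathbb{R}^2)$ is a $p$-elastica if there is $\lambda\in\mathbb{R}$ such that $\frac{d}{d\varepsilon}\big(\mathcal{B}_p[\gamma+\varepsilon\eta]+\lambda\mathcal{L}[\gamma+\varepsilon\eta]\big)\big|_{\varepsilon=0}=0$ for all $\eta\in C^\infty_{\rm c}(I;\mathbb{R}^2)$. For an arclength parametrized $p$-elastica on $[0,L]$, $I=(0,L)$ and $|\gamma'|\equiv1$; its curvature $k$ is taken as the continuous representative. **Types ($p>2$).** A $p$-elastica is called linear, wavelike, orbitlike, circular, flat-core if, up to similarity of $\mathbb{R}^2$ (translation, rotation, reflection, dilation) and reparametrization, it is represented on its interval by $s\mapsto\gamma_*(s+s_0)$ for some $s_0\in\mathbb{R}$, where $\gamma_*$ is an arclength parametrized planar curve with signed curvature, respectively: $k_\ell\equiv0$ on $\mathbb{R}$ (linear); $k_w(s)=2q\,\mathrm{cn}_p(s,q)$ on $\mathbb{R}$ for some $q\in(0,1)$ (wavelike); $k_o(s)=2\,\mathrm{dn}_p(s,q)$ on $\mathbb{R}$ for some $q\in(0,1)$ (orbitlike); $k_c\equiv1$ on $\mathbb{R}$ (circular); and, for flat-core, $\gamma_*=\gamma_f:[0,L_f]\to\mathbb{R}^2$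 with $$k_f(s)=\sum_{j=1}^N\sigma_j\,2\,\mathrm{sech}_p(s-s_j),\qquad s_j=\Big(\sum_{i=1}^jL_i\Big)+(2j-1)\mathrm{K}_p(1),\qquad L_f=2N\mathrm{K}_p(1)+\sum_{j=1}^NL_j,$$ for some integer $N\ge1$, signs $\sigma_j\in\{1,-1\}$ and numbers $L_j\ge0$; that is, $\gamma_f=\bigoplus_{j=1}^N(\gamma_\ell^{L_j}\oplus\gamma_b^{\sigma_j})$ is the tangent-continuous concatenation of segments $\gamma_\ell^{L_j}(s)=(-s,0)$, $s\in[0,L_j]$, and loops $\gamma_b^\pm(s)=(2\tanh_ps-s,\ \mp\frac p{p-1}(\mathrm{sech}_ps)^{p-1})$, $s\in[-\mathrm{K}_p(1),\mathrm{K}_p(1)]$, each piece translated so as to start where the previous one ends, with $\tanh_p x=\int_0^x(\mathrm{sech}_pt)^pdt$. **$p$-elliptic functions.** For $q\in[0,1)$, $x\in\mathbb{R}$, let $\mathrm{F}_{1,p}(x,q)=\int_0^x\frac{|\cos\theta|^{1-2/p}}{\sqrt{1-q^2\sin^2\theta}}d\theta$ and $\mathrm{F}_{2,p}(x,q)=\int_0^x\frac{d\theta}{\sqrt[p]{1-q^2\sin^2\theta}}$; for $q=1$ and $p>2$, $\mathrm{F}_{1,p}(x,1)=\mathrm{F}_{2,p}(x,1)=\int_0^x|\cos\theta|^{-2/p}d\theta$ for $x\in\mathbb{R}$, and $\mathrm{K}_p(1)=\int_0^{\pi/2}(\cos\theta)^{-2/p}d\theta<\infty$. Let $\mathrm{am}_{i,p}(\cdot,q):\mathbb{R}\to\mathbb{R}$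 be the inverse function of $\mathrm{F}_{i,p}(\cdot,q)$. Then $\mathrm{cn}_p(x,q)=|\cos\mathrm{am}_{1,p}(x,q)|^{\frac2p-1}\cos\mathrm{am}_{1,p}(x,q)$ (read as $0$ where the cosine vanishes), $\mathrm{dn}_p(x,q)=\sqrt[p]{1-q^2\sin^2(\mathrm{am}_{2,p}(x,q))}$, and $\mathrm{sech}_px=\mathrm{cn}_p(x,1)=\mathrm{dn}_p(x,1)$ for $|x|<\mathrm{K}_p(1)$, $\mathrm{sech}_px=0$ for $|x|\ge\mathrm{K}_p(1)$. (When $\frac2{p-2}$ is an integer, $R_p$ is read as $\infty$; it is used only in (i).) *)

theory Defs
  imports "HOL-Analysis.Analysis"
begin

subsection \<open>Sobolev spaces on a bounded open interval\<close>

definition smooth :: "(real \<Rightarrow> 'a::real_normed_vector) \<Rightarrow> bool" where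
  "smooth f \<longleftrightarrow>
     (\<exists>D. D 0 = f \<and> (\<forall>n x. (D n has_vector_derivative D (Suc n) x) (at x)))"

definition test_function :: "real \<Rightarrow> real \<Rightarrow> (real \<Rightarrow> 'a::real_normed_vector) \<Rightarrow> bool" where
  "test_function a b \<eta> \<longleftrightarrow>
     smooth \<eta> \<and> (\<exists>K. compact K \<and> K \<subseteq> {a<..<b} \<and> (\<forall>x. x \<notin> K \<longrightarrow> \<eta> x = 0))"

definition locally_integrable :: "real \<Rightarrow> real \<Rightarrow> (real \<Rightarrow> 'a::euclidean_space) \<Rightarrow> bool" where
  "locally_integrable a b f \<longleftrightarrow>
     (\<forall>c d. a < c \<and> d < b \<longrightarrow> set_integrable lebesgue {c..d} f)"

definition has_weak_derivative ::
    "nat \<Rightarrow> real \<Rightarrow> real \<Rightarrow> (real \<Rightarrow> 'a::euclidean_space) \<Rightarrow> (real \<Rightarrow> 'a) \<Rightarrow> bool" where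
  "has_weak_derivative i a b f g \<longleftrightarrow>
     locally_integrable a b f \<and> locally_integrable a b g \<and>
     (\<forall>\<eta> :: real \<Rightarrow> real. test_function a b \<eta> \<longrightarrow>
        (LINT x:{a<..<b}|lebesgue. (deriv ^^ i) \<eta> x *\<^sub>R f x) =
        (- 1) ^ i *\<^sub>R (LINT x:{a<..<b}|lebesgue. \<eta> x *\<^sub>R g x))"

text \<open>Weak derivatives are unique only up to null sets; below this representative is used
  only under integrals and almost-everywhere quantifiers.\<close>

definition weak_derivative ::
    "nat \<Rightarrow> real \<Rightarrow> real \<Rightarrow> (real \<Rightarrow> 'a::euclidean_space) \<Rightarrow> real \<Rightarrow> 'a" where
  "weak_derivative i a b f = (SOME g. has_weak_derivative i a b f g)"

definition Lebesgue_space :: "ereal \<Rightarrow> real \<Rightarrow> real \<Rightarrow> (real \<Rightarrow> 'a::euclidean_space) \<Rightarrow> bool" where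
  "Lebesgue_space r a b f \<longleftrightarrow>
     set_borel_measurable lebesgue {a<..<b} f \<and>
     (if r = \<infinity> then \<exists>C. AE x in lebesgue. x \<in> {a<..<b} \<longrightarrow> norm (f x) \<le> C
      else set_integrable lebesgue {a<..<b} (\<lambda>x. norm (f x) powr real_of_ereal r))"

definition Sobolev :: "nat \<Rightarrow> ereal \<Rightarrow> real \<Rightarrow> real \<Rightarrow> (real \<Rightarrow> 'a::euclidean_space) \<Rightarrow> bool" where
  "Sobolev m r a b f \<longleftrightarrow>
     Lebesgue_space r a b f \<and>
     (\<forall>i\<in>{1..m}. \<exists>g. has_weak_derivative i a b f g \<and> Lebesgue_space r a b g)"

text \<open>On a compact interval \<open>S\<close> the power series at an endpoint is only required to
  represent \<open>f\<close> inside \<open>S\<close>; it then provides an analytic extension beyond the endpoint.\<close>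

definition real_analytic_on :: "(real \<Rightarrow> 'a::real_normed_vector) \<Rightarrow> real set \<Rightarrow> bool" where
  "real_analytic_on f S \<longleftrightarrow>
     (\<forall>x0\<in>S. \<exists>\<rho>>0. \<exists>c. \<forall>x\<in>S. \<bar>x - x0\<bar> < \<rho> \<longrightarrow> (\<lambda>n. (x - x0) ^ n *\<^sub>R c n) sums f x)"

subsection \<open>Planar curves and \<open>p\<close>-elasticae\<close>

text \<open>The signed curvature as a function of the first and second derivative of the curve.\<close>

definition curvature_of :: "real^2 \<Rightarrow> real^2 \<Rightarrow> real" where
  "curvature_of u v = (u $ 1 * v $ 2 - u $ 2 * v $ 1) / norm u ^ 3"

definition weak_curvature :: "real \<Rightarrow> real \<Rightarrow> (real \<Rightarrow> real^2) \<Rightarrow> real \<Rightarrow> real" where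
  "weak_curvature a b \<gamma> s =
     curvature_of (weak_derivative 1 a b \<gamma> s) (weak_derivative 2 a b \<gamma> s)"

definition bending_energy :: "real \<Rightarrow> real \<Rightarrow> real \<Rightarrow> (real \<Rightarrow> real^2) \<Rightarrow> real" where
  "bending_energy p a b \<gamma> =
     (LINT t:{a<..<b}|lebesgue.
        \<bar>weak_curvature a b \<gamma> t\<bar> powr p * norm (weak_derivative 1 a b \<gamma> t))"

definition curve_length :: "real \<Rightarrow> real \<Rightarrow> (real \<Rightarrow> real^2) \<Rightarrow> real" where
  "curve_length a b \<gamma> = (LINT t:{a<..<b}|lebesgue. norm (weak_derivative 1 a b \<gamma> t))"

text \<open>A curve of class \<open>W\<^sup>2\<^sup>,\<^sup>p\<close> is always identified with its
  \<open>C\<^sup>1\<close> representative on the closed interval.\<close>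

definition C1_immersed :: "real \<Rightarrow> real \<Rightarrow> (real \<Rightarrow> real^2) \<Rightarrow> bool" where
  "C1_immersed a b \<gamma> \<longleftrightarrow>
     (\<exists>T. continuous_on {a..b} T \<and>
        (\<forall>t\<in>{a..b}. (\<gamma> has_vector_derivative T t) (at t within {a..b}) \<and> T t \<noteq> 0))"

definition p_elastica :: "real \<Rightarrow> real \<Rightarrow> real \<Rightarrow> (real \<Rightarrow> real^2) \<Rightarrow> bool" where
  "p_elastica p a b \<gamma> \<longleftrightarrow>
     C1_immersed a b \<gamma> \<and> Sobolev 2 (ereal p) a b \<gamma> \<and>
     (\<exists>lam. \<forall>\<eta>. test_function a b \<eta> \<longrightarrow>
        ((\<lambda>\<epsilon>. bending_energy p a b (\<lambda>t. \<gamma> t + \<epsilon> *\<^sub>R \<eta> t)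
              + lam * curve_length a b (\<lambda>t. \<gamma> t + \<epsilon> *\<^sub>R \<eta> t))
          has_real_derivative 0) (at 0))"

definition arclength_p_elastica :: "real \<Rightarrow> real \<Rightarrow> (real \<Rightarrow> real^2) \<Rightarrow> bool" where
  "arclength_p_elastica p L \<gamma> \<longleftrightarrow>
     p_elastica p 0 L \<gamma> \<and>
     (\<forall>s\<in>{0..L}. norm (vector_derivative \<gamma> (at s within {0..L})) = 1)"

text \<open>The continuous representative is determined uniquely on \<open>{0..L}\<close>.\<close>

definition is_continuous_curvature :: "real \<Rightarrow> (real \<Rightarrow> real^2) \<Rightarrow> (real \<Rightarrow> real) \<Rightarrow> bool" where
  "is_continuous_curvature L \<gamma> k \<longleftrightarrow>
     continuous_on {0..L} k \<and>
     (AE s in lebesgue. s \<in> {0<..<L} \<longrightarrow> k s = weak_curvature 0 L \<gamma> s)"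

subsection \<open>\<open>p\<close>-elliptic functions\<close>

text \<open>Here \<open>0 powr a = 0\<close> for every exponent. In the incomplete integrals for \<open>q = 1\<close>
  this affects the integrand only on a null set, and in \<open>cn_p\<close> it is the convention that
  \<open>cn_p\<close> vanishes where the cosine does.\<close>

definition F1_p :: "real \<Rightarrow> real \<Rightarrow> real \<Rightarrow> real" where
  "F1_p p q x =
     (if q = 1 then (LBINT \<theta>=0..ereal x. \<bar>cos \<theta>\<bar> powr (- 2 / p))
      else (LBINT \<theta>=0..ereal x. \<bar>cos \<theta>\<bar> powr (1 - 2 / p) / sqrt (1 - q\<^sup>2 * (sin \<theta>)\<^sup>2)))"

definition F2_p :: "real \<Rightarrow> real \<Rightarrow> real \<Rightarrow> real" where
  "F2_p p q x =
     (if q = 1 then (LBINT \<theta>=0..ereal x. \<bar>cos \<theta>\<bar> powr (- 2 / p))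
      else (LBINT \<theta>=0..ereal x. 1 / (1 - q\<^sup>2 * (sin \<theta>)\<^sup>2) powr (1 / p)))"

definition K_p1 :: "real \<Rightarrow> real" where
  "K_p1 p = (LBINT \<theta>=0..ereal (pi / 2). cos \<theta> powr (- 2 / p))"

definition am1_p :: "real \<Rightarrow> real \<Rightarrow> real \<Rightarrow> real" where
  "am1_p p q = inv (F1_p p q)"

definition am2_p :: "real \<Rightarrow> real \<Rightarrow> real \<Rightarrow> real" where
  "am2_p p q = inv (F2_p p q)"

definition cn_p :: "real \<Rightarrow> real \<Rightarrow> real \<Rightarrow> real" where
  "cn_p p x q = \<bar>cos (am1_p p q x)\<bar> powr (2 / p - 1) * cos (am1_p p q x)"

definition dn_p :: "real \<Rightarrow> real \<Rightarrow> real \<Rightarrow> real" where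
  "dn_p p x q = (1 - q\<^sup>2 * (sin (am2_p p q x))\<^sup>2) powr (1 / p)"

definition sech_p :: "real \<Rightarrow> real \<Rightarrow> real" where
  "sech_p p x = (if \<bar>x\<bar> < K_p1 p then cn_p p x 1 else 0)"

subsection \<open>Types of \<open>p\<close>-elasticae\<close>

definition arclength_curve_with_curvature ::
    "real set \<Rightarrow> (real \<Rightarrow> real^2) \<Rightarrow> (real \<Rightarrow> real) \<Rightarrow> bool" where
  "arclength_curve_with_curvature D \<gamma> \<kappa> \<longleftrightarrow>
     (\<exists>T N. \<forall>s\<in>D.
        (\<gamma> has_vector_derivative T s) (at s within D) \<and>
        (T has_vector_derivative N s) (at s within D) \<and>
        norm (T s) = 1 \<and> curvature_of (T s) (N s) = \<kappa> s)"

definition similarity :: "(real^2 \<Rightarrow> real^2) \<Rightarrow> bool" where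
  "similarity \<Phi> \<longleftrightarrow>
     (\<exists>A c b. orthogonal_transformation A \<and> c > 0 \<and> \<Phi> = (\<lambda>x. c *\<^sub>R A x + b))"

text \<open>Regular reparametrizations; they may reverse the orientation.\<close>

definition reparametrization :: "real \<Rightarrow> real \<Rightarrow> (real \<Rightarrow> real) \<Rightarrow> bool" where
  "reparametrization L l \<phi> \<longleftrightarrow>
     \<phi> ` {0..L} = {0..l} \<and>
     (\<exists>\<phi>'. continuous_on {0..L} \<phi>' \<and>
        (\<forall>s\<in>{0..L}. (\<phi> has_real_derivative \<phi>' s) (at s within {0..L}) \<and> \<phi>' s \<noteq> 0))"

text \<open>\<open>\<gamma>\<close> on \<open>{0..L}\<close> is represented, up to similarity and reparametrization, by
  \<open>s \<mapsto> \<gamma>\<^sub>*(s + s\<^sub>0)\<close> on some \<open>{0..l}\<close>, where \<open>\<gamma>\<^sub>*\<close> is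
  defined on \<open>D\<close> and has curvature \<open>\<kappa>\<close>.\<close>

definition represented_by_curvature ::
    "real set \<Rightarrow> (real \<Rightarrow> real) \<Rightarrow> real \<Rightarrow> (real \<Rightarrow> real^2) \<Rightarrow> bool" where
  "represented_by_curvature D \<kappa> L \<gamma> \<longleftrightarrow>
     (\<exists>\<gamma>s \<Phi> \<phi> l s0.
        arclength_curve_with_curvature D \<gamma>s \<kappa> \<and> similarity \<Phi> \<and>
        reparametrization L l \<phi> \<and> {s0..s0 + l} \<subseteq> D \<and>
        (\<forall>s\<in>{0..L}. \<gamma> s = \<Phi> (\<gamma>s (\<phi> s + s0))))"

definition linear_type :: "real \<Rightarrow> (real \<Rightarrow> real^2) \<Rightarrow> bool" where
  "linear_type L \<gamma> \<longleftrightarrow> represented_by_curvature UNIV (\<lambda>s. 0) L \<gamma>"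

definition wavelike :: "real \<Rightarrow> real \<Rightarrow> (real \<Rightarrow> real^2) \<Rightarrow> bool" where
  "wavelike p L \<gamma> \<longleftrightarrow>
     (\<exists>q. 0 < q \<and> q < 1 \<and> represented_by_curvature UNIV (\<lambda>s. 2 * q * cn_p p s q) L \<gamma>)"

definition orbitlike :: "real \<Rightarrow> real \<Rightarrow> (real \<Rightarrow> real^2) \<Rightarrow> bool" where
  "orbitlike p L \<gamma> \<longleftrightarrow>
     (\<exists>q. 0 < q \<and> q < 1 \<and> represented_by_curvature UNIV (\<lambda>s. 2 * dn_p p s q) L \<gamma>)"

definition circular :: "real \<Rightarrow> (real \<Rightarrow> real^2) \<Rightarrow> bool" where
  "circular L \<gamma> \<longleftrightarrow> represented_by_curvature UNIV (\<lambda>s. 1) L \<gamma>"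

definition loop_centre :: "real \<Rightarrow> (nat \<Rightarrow> real) \<Rightarrow> nat \<Rightarrow> real" where
  "loop_centre p Ls j = (\<Sum>i=1..j. Ls i) + (2 * real j - 1) * K_p1 p"

definition flat_core_length :: "real \<Rightarrow> nat \<Rightarrow> (nat \<Rightarrow> real) \<Rightarrow> real" where
  "flat_core_length p N Ls = 2 * real N * K_p1 p + (\<Sum>j=1..N. Ls j)"

definition flat_core_curvature ::
    "real \<Rightarrow> nat \<Rightarrow> (nat \<Rightarrow> real) \<Rightarrow> (nat \<Rightarrow> real) \<Rightarrow> real \<Rightarrow> real" where
  "flat_core_curvature p N \<sigma> Ls s =
     (\<Sum>j=1..N. \<sigma> j * 2 * sech_p p (s - loop_centre p Ls j))"

definition flat_core :: "real \<Rightarrow> real \<Rightarrow> (real \<Rightarrow> real^2) \<Rightarrow> bool" where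
  "flat_core p L \<gamma> \<longleftrightarrow>
     (\<exists>N \<sigma> Ls. N \<ge> 1 \<and> (\<forall>j\<in>{1..N}. \<sigma> j \<in> {1, - 1} \<and> Ls j \<ge> 0) \<and>
        represented_by_curvature {0..flat_core_length p N Ls}
          (flat_core_curvature p N \<sigma> Ls) L \<gamma>)"

definition M_p :: "real \<Rightarrow> nat" where
  "M_p p = nat \<lceil>2 / (p - 2)\<rceil>"

definition R_p :: "real \<Rightarrow> ereal" where
  "R_p p = (if 2 / (p - 2) \<in> \<int> then \<infinity> else ereal (1 / (real (M_p p) - 2 / (p - 2))))"

end

theory Submission
  imports Defs "HOL-Computational_Algebra.Polynomial" "HOL-Library.Landau_Symbols"
begin

text \<open>The representation turns into \<open>T' = \<kappa> perp T\<close> for the unit tangent \<open>T = \<gamma>'\<close>, where \<open>\<kappa>\<close> is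
  an affine rescaling of the model curvature and agrees with \<open>k\<close>. By Leibniz' rule the derivative
  of order \<open>m + 1\<close> of \<open>T\<close> is the one of order \<open>m\<close> of \<open>\<kappa>\<close> times \<open>perp T\<close> plus a continuous remainder,
  so \<open>\<gamma>\<close> has exactly two orders of differentiability more than \<open>\<kappa>\<close>, and everything is decided at
  the zeros of the curvature. Linear, orbitlike and circular curves are excluded because
  their curvature has no zeros or vanishes identically. For wavelike curves
  \<open>Y = \<bar>cn_p\<bar> powr (p - 2) * cn_p\<close> has a continuous derivative that does not vanish at the zeros, so
  \<open>cn_p\<close> behaves there like \<open>\<bar>x\<bar> powr (1 / (p - 1))\<close>. For flat-core curves the same holds for
  \<open>g = sech_p powr ((p - 2) / 2)\<close> at the ends of the loops, hence \<open>sech_p\<close> behaves there like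
  \<open>x powr (2 / (p - 2))\<close>. If \<open>2 / (p - 2)\<close> is an integer, the last derivative is bounded and jumps
  where a loop meets a segment.\<close>

text \<open>All thresholds come from one fact: a function of exact order
  \<open>t powr (- \<beta>)\<close> with \<beta> > 0 has an integrable r-th power near t = 0
  precisely when \<beta> r < 1, and for \<beta> r = 1 the power is comparable to 1 / t. In the
  wavelike case \<beta> = (p - 2) / (p - 1) for the first derivative of the curvature. In the
  flat-core case the derivative of order j behaves like \<open>t powr (\<alpha> - j)\<close> with
  \<alpha> = 2 / (p - 2); \<open>M_p\<close> is the first order whose exponent is not positive, and
  \<open>R_p\<close> is the reciprocal of \<beta> = \<open>M_p\<close> - \<alpha>. The nonempty
  frontier supplies a zero with nonzero curvature next to it inside the interval, hence a genuine
  singularity. For the jump in the integer case one side must be flat: only then do all lower terms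
  of the Leibniz remainder vanish at the point, so that the top derivative alone jumps. Weak
  derivatives are compared with classical ones through uniqueness up to null sets, and a jump is
  refuted by testing against shrinking bumps.\<close>

section \<open>Leibniz rule for bounded bilinear products\<close>

lemma (in bounded_bilinear) Leibniz_sum:
  "(\<Sum>j\<le>n. real (n choose j) *\<^sub>R (prod (f j) (g (Suc (n - j))) + prod (f (Suc j)) (g (n - j)))) =
   (\<Sum>j\<le>Suc n. real (Suc n choose j) *\<^sub>R prod (f j) (g (Suc n - j)))"
proof -
  define h where "h j = prod (f j) (g (Suc n - j))" for j
  have "(\<Sum>j\<le>Suc n. real (Suc n choose j) *\<^sub>R h j) =
      h 0 + (\<Sum>j\<le>n. real (Suc n choose Suc j) *\<^sub>R h (Suc j))"
    by (subst sum.atMost_Suc_shift) simp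
  also have "\<dots> = (\<Sum>j\<le>n. real (n choose j) *\<^sub>R h (Suc j)) +
      (h 0 + (\<Sum>j\<le>n. real (n choose Suc j) *\<^sub>R h (Suc j)))"
    by (simp add: scaleR_left_distrib sum.distrib)
  also have "h 0 + (\<Sum>j\<le>n. real (n choose Suc j) *\<^sub>R h (Suc j)) =
      (\<Sum>j\<le>Suc n. real (n choose j) *\<^sub>R h j)"
    by (subst sum.atMost_Suc_shift) simp
  also have "\<dots> = (\<Sum>j\<le>n. real (n choose j) *\<^sub>R h j)"
    by simp
  also have "(\<Sum>j\<le>n. real (n choose j) *\<^sub>R h (Suc j)) + (\<Sum>j\<le>n. real (n choose j) *\<^sub>R h j) =
     (\<Sum>j\<le>n. real (n choose j) *\<^sub>R (prod (f j) (g (Suc (n - j))) + prod (f (Suc j)) (g (n - j))))"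
    unfolding sum.distrib[symmetric]
    by (intro sum.cong) (auto simp: h_def scaleR_right_distrib Suc_diff_le algebra_simps)
  finally show ?thesis
    by (simp add: h_def)
qed

text \<open>Kept general in the product because it is needed twice: for real multiplication in
  \<open>smooth_mult\<close> and for \<open>x *\<^sub>R perp v\<close> in
  \<open>tang_has_vector_derivative\<close>. The sequences need to be derivative chains only at the
  one point and only up to order \<open>n\<close>, since curvature derivatives exist only off a
  finite set and up to a limited order.\<close>

lemma (in bounded_bilinear) has_vector_derivative_Leibniz:
  assumes "\<And>j. j \<le> n \<Longrightarrow> (f j has_vector_derivative f (Suc j) x) (at x within S)"
    and "\<And>j. j \<le> n \<Longrightarrow> (g j has_vector_derivative g (Suc j) x) (at x within S)"
  shows "((\<lambda>x. \<Sum>j\<le>n. real (n choose j) *\<^sub>R prod (f j x) (g (n - j) x)) has_vector_derivative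
     (\<Sum>j\<le>Suc n. real (Suc n choose j) *\<^sub>R prod (f j x) (g (Suc n - j) x))) (at x within S)"
proof -
  have "((\<lambda>x. real (n choose j) *\<^sub>R prod (f j x) (g (n - j) x)) has_vector_derivative
     real (n choose j) *\<^sub>R (prod (f j x) (g (Suc (n - j)) x) + prod (f (Suc j) x) (g (n - j) x)))
     (at x within S)" if "j \<le> n" for j
    using has_vector_derivative_scaleR[OF DERIV_const has_vector_derivative[OF assms(1)[OF that] assms(2)[of "n - j"]],
       of "real (n choose j)"] by simp
  then have "((\<lambda>x. \<Sum>j\<le>n. real (n choose j) *\<^sub>R prod (f j x) (g (n - j) x)) has_vector_derivative
     (\<Sum>j\<le>n. real (n choose j) *\<^sub>R
        (prod (f j x) (g (Suc (n - j)) x) + prod (f (Suc j) x) (g (n - j) x)))) (at x within S)"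
    by (intro has_vector_derivative_sum) auto
  then show ?thesis
    by (simp only: Leibniz_sum[of n "\<lambda>j. f j x" "\<lambda>j. g j x"])
qed

subsection \<open>Test functions\<close>

lemma smooth_has_derivative:
  fixes \<eta> :: "real \<Rightarrow> real"
  assumes "smooth \<eta>"
  shows "((deriv ^^ n) \<eta> has_real_derivative (deriv ^^ Suc n) \<eta> x) (at x)"
proof -
  obtain D where D: "D 0 = \<eta>" "\<And>n x. (D n has_real_derivative D (Suc n) x) (at x)"
    using assms by (auto simp: smooth_def has_real_derivative_iff_has_vector_derivative)
  have *: "(deriv ^^ n) \<eta> = D n" for n
    by (induction n) (auto simp: D(1) intro!: DERIV_imp_deriv D(2))
  show ?thesis unfolding * by (rule D)
qed

lemma smooth_mult:
  fixes f g :: "real \<Rightarrow> real"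
  assumes "smooth f" "smooth g"
  shows "smooth (\<lambda>x. f x * g x)"
proof -
  obtain D where D: "D 0 = f" "\<And>n x. (D n has_vector_derivative D (Suc n) x) (at x)"
    using assms(1) by (auto simp: smooth_def)
  obtain E where E: "E 0 = g" "\<And>n x. (E n has_vector_derivative E (Suc n) x) (at x)"
    using assms(2) by (auto simp: smooth_def)
  show ?thesis
    unfolding smooth_def
    using bounded_bilinear.has_vector_derivative_Leibniz[OF bounded_bilinear_mult, of _ D _ UNIV E] D E
    by (intro exI[of _ "\<lambda>n x. \<Sum>j\<le>n. real (n choose j) *\<^sub>R (D j x * E (n - j) x)"]) auto
qed

lemma smooth_affine:
  fixes f :: "real \<Rightarrow> real"
  assumes "smooth f"
  shows "smooth (\<lambda>x. f (m * x + c))"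
proof -
  obtain D where D: "D 0 = f" "\<And>n x. (D n has_real_derivative D (Suc n) x) (at x)"
    using assms by (auto simp: smooth_def has_real_derivative_iff_has_vector_derivative)
  have "((\<lambda>x. m ^ n * D n (m * x + c)) has_real_derivative m ^ Suc n * D (Suc n) (m * x + c)) (at x)" for n x
    by (auto intro!: derivative_eq_intros DERIV_chain2[OF D(2)])
  then show ?thesis
    unfolding smooth_def has_real_derivative_iff_has_vector_derivative[symmetric]
    by (intro exI[of _ "\<lambda>n x. m ^ n * D n (m * x + c)"]) (auto simp: D(1))
qed

text \<open>The polynomial factor makes the family closed under differentiation, so that smoothness
  of the flat function exp (- 1 / x) needs no formula for its higher derivatives.\<close>

definition expinv :: "real poly \<Rightarrow> real \<Rightarrow> real" where
  "expinv P x = (if x > 0 then poly P (1 / x) * exp (- (1 / x)) else 0)"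

lemma poly_exp_tendsto_0:
  fixes Q :: "real poly"
  shows "((\<lambda>y. poly Q y * exp (- y)) \<longlongrightarrow> 0) at_top"
proof -
  \<comment> \<open>The extra factor \<open>y ^ k\<close> carries the induction: splitting off the
    constant coefficient leaves the remaining polynomial multiplied by one more power of
    \<open>y\<close>.\<close>
  have "((\<lambda>y. y ^ k * poly Q y * exp (- y)) \<longlongrightarrow> 0) at_top" for k
  proof (induction Q arbitrary: k)
    case (pCons a Q)
    have "((\<lambda>y. a * (y ^ k / exp y) + y ^ Suc k * poly Q y * exp (- y)) \<longlongrightarrow> a * 0 + 0) at_top"
      by (intro tendsto_intros tendsto_power_div_exp_0 pCons)
    then show ?case
      by (rule tendsto_eq_rhs[OF Lim_transform_eventually]) (auto simp: algebra_simps exp_minus divide_inverse)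
  qed simp
  from this[of 0] show ?thesis by simp
qed

text \<open>In the variable y = 1 / x one has d/dx = - y^2 d/dy, and P(y) exp (- y) has y-derivative
  (P' - P)(y) exp (- y); hence the new polynomial y^2 (P - P').\<close>

lemma expinv_has_derivative:
  "(expinv P has_real_derivative expinv ([:0, 0, 1:] * (P - pderiv P)) x) (at x)"
proof (cases x "0::real" rule: linorder_cases)
  case less
  have "((\<lambda>_. 0) has_real_derivative 0) (at x)" by simp
  moreover have "\<forall>\<^sub>F y in nhds x. expinv P y = 0"
    using less by (intro eventually_mono[OF order_tendstoD(2)[OF filterlim_ident]]) (auto simp: expinv_def)
  ultimately have "(expinv P has_real_derivative 0) (at x)"
    using DERIV_cong_ev[OF refl _ refl] by fast
  then show ?thesis using less by (simp add: expinv_def)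
next
  case greater
  have "((\<lambda>x. poly P (1 / x) * exp (- (1 / x))) has_real_derivative
     expinv ([:0, 0, 1:] * (P - pderiv P)) x) (at x)"
    using greater
    by (auto intro!: derivative_eq_intros DERIV_chain2[OF poly_DERIV] simp: expinv_def field_simps power2_eq_square)
  moreover have "\<forall>\<^sub>F y in nhds x. expinv P y = poly P (1 / y) * exp (- (1 / y))"
    using greater by (intro eventually_mono[OF order_tendstoD(1)[OF filterlim_ident]]) (auto simp: expinv_def)
  ultimately show ?thesis
    using DERIV_cong_ev[OF refl _ refl] by fast
next
  case equal
  have "((\<lambda>y. (expinv P y - expinv P 0) / (y - 0)) \<longlongrightarrow> 0) (at 0)"
  proof (rule filterlim_split_at)
    have "((\<lambda>y::real. 0::real) \<longlongrightarrow> 0) (at_left 0)" by simp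
    then show "((\<lambda>y. (expinv P y - expinv P 0) / (y - 0)) \<longlongrightarrow> 0) (at_left 0)"
      by (rule Lim_transform_eventually) (auto simp: expinv_def eventually_at_filter)
    \<comment> \<open>The difference quotient at 0 divides by \<open>y\<close>, which multiplies the
      polynomial in 1 / y by its variable; this is \<open>pCons 0 P\<close>.\<close>
    have "((\<lambda>y. poly (pCons 0 P) (inverse y) * exp (- inverse y)) \<longlongrightarrow> 0) (at_right 0)"
      by (rule filterlim_compose[OF poly_exp_tendsto_0 filterlim_inverse_at_top_right])
    then show "((\<lambda>y. (expinv P y - expinv P 0) / (y - 0)) \<longlongrightarrow> 0) (at_right 0)"
      by (rule Lim_transform_eventually) (auto simp: expinv_def eventually_at_filter divide_inverse)
  qed
  then show ?thesis
    using equal by (auto simp: has_field_derivative_iff expinv_def)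
qed

lemma smooth_expinv: "smooth (expinv P)"
  unfolding smooth_def has_real_derivative_iff_has_vector_derivative[symmetric]
  by (intro exI[of _ "\<lambda>n. expinv (((\<lambda>P. [:0, 0, 1:] * (P - pderiv P)) ^^ n) P)"])
    (auto intro!: expinv_has_derivative simp del: mult_pCons_left)

text \<open>With fixed ends the edges sharpen as \<open>n\<close> grows, approximating an indicator.
  With ends at distance \<open>1 / n\<close> from a point it is a bump shrinking to that point,
  whose value there is exp (- 2) for every positive \<open>n\<close>.\<close>

definition cutoff :: "real \<Rightarrow> real \<Rightarrow> nat \<Rightarrow> real \<Rightarrow> real" where
  "cutoff c d n x = expinv 1 (real n * (x - c)) * expinv 1 (real n * (d - x))"

lemma test_function_cutoff:
  assumes "a < c" "d < b"
  shows "test_function a b (cutoff c d n)"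
proof -
  have "smooth (\<lambda>x. expinv 1 (real n * x + (- real n * c)) * expinv 1 (- real n * x + real n * d))"
    by (intro smooth_mult smooth_affine smooth_expinv)
  then have "smooth (cutoff c d n)"
    by (simp add: cutoff_def[abs_def] algebra_simps)
  moreover have "cutoff c d n x = 0" if "x \<notin> {c..d}" for x
    using that by (auto simp: cutoff_def expinv_def zero_less_mult_iff)
  ultimately show ?thesis
    using assms by (auto simp: test_function_def intro!: exI[of _ "{c..d}"])
qed

lemma cutoff_bounds: "0 \<le> cutoff c d n x" "cutoff c d n x \<le> 1"
  by (auto simp: cutoff_def expinv_def intro!: mult_le_one)

lemma cutoff_tendsto: "(\<lambda>n. cutoff c d n x) \<longlonglongrightarrow> indicator {c<..<d} x"
proof -
  have pos: "(\<lambda>n. expinv 1 (real n * t)) \<longlonglongrightarrow> 1" if "t > 0" for t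
  proof -
    have "(\<lambda>n. exp (- (1 / (real n * t)))) \<longlonglongrightarrow> exp (- 0)"
      using lim_const_over_n[of "1 / t"] by (intro tendsto_intros) (simp add: mult.commute)
    then have "(\<lambda>n. exp (- (1 / (real n * t)))) \<longlonglongrightarrow> 1"
      by simp
    then show ?thesis
      by (rule Lim_transform_eventually)
        (use that in \<open>auto simp: expinv_def intro!: eventually_mono[OF eventually_gt_at_top[of 0]]\<close>)
  qed
  have neg: "expinv 1 (real n * t) = 0" if "t \<le> 0" for n t
    using that by (auto simp: expinv_def zero_less_mult_iff)
  consider "x \<le> c" | "d \<le> x" | "c < x" "x < d" by linarith
  then show ?thesis
  proof cases
    case 3
    then show ?thesis
      using tendsto_mult[OF pos[of "x - c"] pos[of "d - x"]] by (simp add: cutoff_def)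
  qed (auto simp: cutoff_def neg)
qed

subsection \<open>Weak derivatives\<close>

lemma smooth_continuous_on:
  fixes \<eta> :: "real \<Rightarrow> real"
  assumes "smooth \<eta>"
  shows "continuous_on S \<eta>"
  using smooth_has_derivative[OF assms, of 0]
  by (auto intro!: continuous_at_imp_continuous_on DERIV_isCont)

lemma test_function_deriv:
  fixes \<eta> :: "real \<Rightarrow> real"
  assumes "test_function a b \<eta>"
  shows "test_function a b (deriv \<eta>)"
proof -
  obtain D where D: "D 0 = \<eta>" "\<And>n x. (D n has_vector_derivative D (Suc n) x) (at x)"
    using assms by (auto simp: test_function_def smooth_def)
  obtain K where K: "compact K" "K \<subseteq> {a<..<b}" "\<And>x. x \<notin> K \<Longrightarrow> \<eta> x = 0"
    using assms by (auto simp: test_function_def)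
  have d: "deriv \<eta> = D 1"
    using D(2)[of 0] by (auto simp: D(1) has_real_derivative_iff_has_vector_derivative[symmetric]
        intro!: DERIV_imp_deriv)
  have "deriv \<eta> x = 0" if "x \<notin> K" for x
  proof -
    have "\<forall>\<^sub>F y in nhds x. y \<in> - K"
      using that K(1) by (intro eventually_nhds_in_open) (auto simp: compact_imp_closed open_Compl)
    then have "\<forall>\<^sub>F y in nhds x. \<eta> y = 0"
      by eventually_elim (auto intro: K(3))
    then have "(\<eta> has_real_derivative 0) (at x)"
      using DERIV_cong_ev[OF refl _ refl, of \<eta> "\<lambda>_. 0" x 0] by simp
    then show ?thesis
      by (rule DERIV_imp_deriv)
  qed
  moreover have "smooth (deriv \<eta>)"
    unfolding smooth_def d by (intro exI[of _ "\<lambda>n. D (Suc n)"]) (simp add: D(2))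
  ultimately show ?thesis
    using K unfolding test_function_def by blast
qed

text \<open>\<open>locally_integrable\<close> speaks of compact intervals, so the compact support is
  enclosed in one. An empty support has no least element; any admissible bounds then serve.\<close>

lemma test_function_support:
  assumes "test_function a b \<eta>"
  obtains c d where "a < c" "d < b" "\<And>x. x \<notin> {c..d} \<Longrightarrow> \<eta> x = 0"
proof -
  obtain K where K: "compact K" "K \<subseteq> {a<..<b}" "\<And>x. x \<notin> K \<Longrightarrow> \<eta> x = 0"
    using assms by (auto simp: test_function_def)
  show ?thesis
  proof (cases "K = {}")
    case True
    then show ?thesis using that[of "a + 1" "b - 1"] K by auto
  next
    case False
    obtain c where c: "c \<in> K" "\<And>x. x \<in> K \<Longrightarrow> c \<le> x"
      using compact_attains_inf[OF K(1) False] by blast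
    obtain d where d: "d \<in> K" "\<And>x. x \<in> K \<Longrightarrow> x \<le> d"
      using compact_attains_sup[OF K(1) False] by blast
    show ?thesis
      by (rule that[of c d]) (use c d K in auto)
  qed
qed

lemma set_integrable_continuous_scaleR:
  fixes f :: "real \<Rightarrow> real" and g :: "real \<Rightarrow> 'a::euclidean_space"
  assumes "continuous_on {c..d} f" "set_integrable lebesgue A g" "A \<subseteq> {c..d}" "A \<in> sets lebesgue"
  shows "set_integrable lebesgue A (\<lambda>x. f x *\<^sub>R g x)"
proof -
  have "bounded (f ` A)"
    using assms(1,3) by (meson bounded_subset compact_Icc compact_continuous_image compact_imp_bounded image_mono)
  moreover have "f \<in> borel_measurable (lebesgue_on A)"
    using assms by (meson continuous_imp_measurable_on_sets_lebesgue continuous_on_subset)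
  moreover have "bilinear (\<lambda>(x::real) (y::'a). x *\<^sub>R y)"
    by (simp add: bilinear_conv_bounded_bilinear bounded_bilinear_scaleR)
  ultimately show ?thesis
    using absolutely_integrable_bounded_measurable_product[OF _ _ assms(4) _ assms(2)] by blast
qed

lemma set_integrable_test_function:
  fixes g :: "real \<Rightarrow> 'a::euclidean_space"
  assumes "test_function a b \<eta>" "locally_integrable a b g"
  shows "set_integrable lebesgue {a<..<b} (\<lambda>x. \<eta> x *\<^sub>R g x)"
proof -
  obtain c d where cd: "a < c" "d < b" "\<And>x. x \<notin> {c..d} \<Longrightarrow> \<eta> x = 0"
    using test_function_support[OF assms(1)] by metis
  have "set_integrable lebesgue {c..d} (\<lambda>x. \<eta> x *\<^sub>R g x)"
    using assms cd
    by (intro set_integrable_continuous_scaleR[of c d])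
      (auto simp: test_function_def locally_integrable_def intro: smooth_continuous_on)
  moreover have "indicator {c..d} x *\<^sub>R \<eta> x *\<^sub>R g x = indicator {a<..<b} x *\<^sub>R \<eta> x *\<^sub>R g x" for x
    using cd by (auto simp: indicator_def)
  ultimately show ?thesis
    unfolding set_integrable_def by (rule back_subst[of "integrable lebesgue", OF _ ext])
qed

section \<open>Fundamental lemma of the calculus of variations and uniqueness of weak
  derivatives\<close>

lemma sigma_finite_lebesgue: "sigma_finite_measure (lebesgue :: 'a::euclidean_space measure)"
proof
  obtain A :: "'a set set" where A: "countable A" "A \<subseteq> sets lborel" "\<Union> A = space lborel"
      "\<forall>a\<in>A. emeasure lborel a \<noteq> \<infinity>"
    using sigma_finite_measure.sigma_finite_countable[OF sigma_finite_lborel] by metis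
  then show "\<exists>A::'a set set. countable A \<and> A \<subseteq> sets lebesgue \<and> \<Union> A = space lebesgue \<and>
      (\<forall>a\<in>A. emeasure lebesgue a \<noteq> \<infinity>)"
    by (intro exI[of _ A]) auto
qed

text \<open>Half-lines are an intersection-stable generator of the Borel sets, and the sets over
  which \<open>h\<close> integrates to zero form a Dynkin system; the vanishing total integral is
  what handles complements. A Lebesgue set differs from a Borel set by a null set, so all integrals
  of \<open>h\<close> vanish.\<close>

lemma AE_eq_0_if_integral_atMost_eq_0:
  fixes h :: "real \<Rightarrow> 'a::euclidean_space"
  assumes h: "integrable lebesgue h" and total: "(LINT x|lebesgue. h x) = 0"
    and half: "\<And>t. (LINT x:{..t}|lebesgue. h x) = 0"
  shows "AE x in lebesgue. h x = 0"
proof (rule sigma_finite_measure.density_zero[OF sigma_finite_lebesgue h])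
  have int: "set_integrable lebesgue A h" if "A \<in> sets lebesgue" for A
    unfolding set_integrable_def using that h by (rule integrable_mult_indicator)
  have borel: "(LINT x:A|lebesgue. h x) = 0" if "A \<in> sets borel" for A
  proof -
    have "Int_stable (range (\<lambda>a::real. {..a}))"
      by (force simp: Int_stable_def)
    moreover have "range (\<lambda>a::real. {..a}) \<subseteq> Pow UNIV"
      by simp
    moreover have "A \<in> sigma_sets UNIV (range (\<lambda>a::real. {..a}))"
      using that by (simp add: borel_eq_atMost)
    ultimately show ?thesis
    proof (induction rule: sigma_sets_induct_disjoint)
      case (basic A)
      then show ?case using half by auto
    next
      case empty
      then show ?case by (simp add: set_lebesgue_integral_def)
    next
      case (compl A)
      then have "A \<in> sets borel"
        by (simp add: borel_eq_atMost)
      then have A: "A \<in> sets lebesgue" by simp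
      have "(LINT x:UNIV|lebesgue. h x) = (LINT x:A|lebesgue. h x) + (LINT x:UNIV - A|lebesgue. h x)"
        using set_integral_Un[of A "UNIV - A" lebesgue h] int[of A] int[of "UNIV - A"] A by (simp add: Compl_in_sets_lebesgue flip: Compl_eq_Diff_UNIV)
      then show ?case
        using compl total by (simp add: set_lebesgue_integral_def)
    next
      case (union A)
      have A: "A i \<in> sets lebesgue" for i
        using union(2) by (intro sets_completionI_sets) (auto simp: borel_eq_atMost)
      have "(LINT x:(\<Union>i. A i)|lebesgue. h x) = (\<Sum>i. LINT x:A i|lebesgue. h x)"
        using A union(1) by (intro lebesgue_integral_countable_add int) (auto simp: disjoint_family_on_def)
      then show ?case
        using union by simp
    qed
  qed
  fix A :: "real set" assume "A \<in> sets lebesgue"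
  then obtain C N where CN: "C \<in> sets borel" "negligible N" "C \<union> N = A"
    by (metis sets_lebesgue_almost_borel)
  have "(LINT x:A|lebesgue. h x) = (LINT x:C|lebesgue. h x)"
  proof (rule set_integral_cong_set)
    have "AE x in lebesgue. x \<notin> N"
      using CN(2) by (simp add: AE_not_in negligible_iff_null_sets)
    then show "AE x in lebesgue. (x \<in> C) = (x \<in> A)"
      by eventually_elim (use CN(3) in auto)
  qed (use int[of A] int[of C] CN \<open>A \<in> sets lebesgue\<close> in \<open>auto simp: set_borel_measurable_def set_integrable_def\<close>)
  then show "(LINT x:A|lebesgue. h x) = 0"
    using borel[OF CN(1)] by simp
qed

text \<open>Cutoffs converge boundedly to indicators of intervals, so \<open>g\<close> has integral
  zero over every compact subinterval, and the half-line criterion applies to the restrictions of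
  \<open>g\<close>.\<close>

lemma AE_eq_0_if_weakly_0:
  fixes g :: "real \<Rightarrow> 'a::euclidean_space"
  assumes g: "locally_integrable a b g"
    and zero: "\<And>\<eta>. test_function a b \<eta> \<Longrightarrow> (LINT x:{a<..<b}|lebesgue. \<eta> x *\<^sub>R g x) = 0"
  shows "AE x in lebesgue. x \<in> {a<..<b} \<longrightarrow> g x = 0"
proof -
  have intv: "(LINT x:{c..d}|lebesgue. g x) = 0" if cd: "a < c" "d < b" for c d
  proof -
    have gi: "integrable lebesgue (\<lambda>x. indicator {c..d} x *\<^sub>R g x)"
      using g cd by (auto simp: locally_integrable_def set_integrable_def)
    have m: "cutoff c d n \<in> borel_measurable lebesgue" for n
      using smooth_continuous_on[of "cutoff c d n" UNIV] test_function_cutoff[of "c - 1" c d "d + 1" n]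
      by (auto simp: test_function_def intro!: borel_measurable_continuous_onI measurable_completion)
    \<comment> \<open>The cutoff vanishes off \<open>{c..d}\<close>, so the integral may be taken
      where \<open>g\<close> is integrable; this supplies the dominating function.\<close>
    have eq: "indicator {a<..<b} x *\<^sub>R cutoff c d n x *\<^sub>R g x = cutoff c d n x *\<^sub>R indicator {c..d} x *\<^sub>R g x" for n x
      using cd by (auto simp: indicator_def cutoff_def expinv_def zero_less_mult_iff)
    have "(\<lambda>n. LINT x|lebesgue. cutoff c d n x *\<^sub>R indicator {c..d} x *\<^sub>R g x)
       \<longlonglongrightarrow> (LINT x|lebesgue. indicator {c<..<d} x *\<^sub>R indicator {c..d} x *\<^sub>R g x)"
    proof (rule integral_dominated_convergence[where w = "\<lambda>x. norm (indicator {c..d} x *\<^sub>R g x)"])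
      show "AE x in lebesgue. (\<lambda>n. cutoff c d n x *\<^sub>R indicator {c..d} x *\<^sub>R g x) \<longlonglongrightarrow> indicator {c<..<d} x *\<^sub>R indicator {c..d} x *\<^sub>R g x"
        by (intro AE_I2 tendsto_scaleR cutoff_tendsto tendsto_const)
      show "AE x in lebesgue. norm (cutoff c d n x *\<^sub>R indicator {c..d} x *\<^sub>R g x) \<le> norm (indicator {c..d} x *\<^sub>R g x)" for n
        using cutoff_bounds[of c d n] by (intro AE_I2) (auto intro!: mult_left_le_one_le simp: mult.assoc)
    qed (use borel_measurable_integrable[OF gi] m integrable_norm[OF gi] in
        \<open>auto intro!: borel_measurable_scaleR borel_measurable_indicator simp del: scaleR_scaleR norm_scaleR\<close>)
    moreover have "(LINT x|lebesgue. cutoff c d n x *\<^sub>R indicator {c..d} x *\<^sub>R g x) = 0" for n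
      using zero[OF test_function_cutoff[OF cd, of n]] by (simp only: set_lebesgue_integral_def eq)
    ultimately have "(LINT x|lebesgue. indicator {c<..<d} x *\<^sub>R indicator {c..d} x *\<^sub>R g x) = 0"
      by (simp add: LIMSEQ_const_iff)
    moreover have "(LINT x|lebesgue. indicator {c<..<d} x *\<^sub>R indicator {c..d} x *\<^sub>R g x) = (LINT x|lebesgue. indicator {c..d} x *\<^sub>R g x)"
    proof (rule integral_cong_AE)
      have "AE x in lebesgue. x \<notin> {c, d}"
        by (intro AE_not_in) (simp flip: negligible_iff_null_sets)
      then show "AE x in lebesgue. indicator {c<..<d} x *\<^sub>R indicator {c..d} x *\<^sub>R g x = indicator {c..d} x *\<^sub>R g x"
        by eventually_elim (auto simp: indicator_def)
    qed (use borel_measurable_integrable[OF gi] in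
        \<open>auto intro!: borel_measurable_scaleR borel_measurable_indicator simp del: scaleR_scaleR\<close>)
    ultimately show ?thesis
      by (simp add: set_lebesgue_integral_def)
  qed
  have AE: "AE x in lebesgue. x \<in> {c..d} \<longrightarrow> g x = 0" if cd: "a < c" "d < b" for c d
  proof -
    have "AE x in lebesgue. indicator {c..d} x *\<^sub>R g x = 0"
    proof (rule AE_eq_0_if_integral_atMost_eq_0)
      show "integrable lebesgue (\<lambda>x. indicator {c..d} x *\<^sub>R g x)"
        using g cd by (auto simp: locally_integrable_def set_integrable_def)
      show "(LINT x|lebesgue. indicator {c..d} x *\<^sub>R g x) = 0"
        using intv[OF cd] by (simp add: set_lebesgue_integral_def)
      show "(LINT x:{..t}|lebesgue. indicator {c..d} x *\<^sub>R g x) = 0" for t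
      proof -
        have eq: "indicator {..t} x *\<^sub>R indicator {c..d} x *\<^sub>R g x = indicator {c..min d t} x *\<^sub>R g x" for x
          by (auto simp: indicator_def)
        show ?thesis
          unfolding set_lebesgue_integral_def eq
          using intv[of c "min d t"] cd by (simp add: set_lebesgue_integral_def)
      qed
    qed
    then show ?thesis
      by eventually_elim (auto simp: indicator_def)
  qed
  \<comment> \<open>Countably many compact intervals exhaust the open one, so the exceptional null
    sets can be united.\<close>
  have "AE x in lebesgue. \<forall>n. x \<in> {a + inverse (real (Suc n))..b - inverse (real (Suc n))} \<longrightarrow> g x = 0"
    unfolding AE_all_countable by (intro allI AE) auto
  then show ?thesis
  proof eventually_elim
    case (elim x)
    show ?case
    proof
      assume x: "x \<in> {a<..<b}"
      then obtain n where "inverse (real (Suc n)) < min (x - a) (b - x)"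
        using reals_Archimedean[of "min (x - a) (b - x)"] by auto
      then show "g x = 0"
        using elim by (intro elim[rule_format, of n]) auto
    qed
  qed
qed

text \<open>This is what makes the representative picked by \<open>SOME\<close> in
  \<open>weak_derivative\<close> comparable with an explicitly known derivative.\<close>

lemma has_weak_derivative_AE_unique:
  assumes "has_weak_derivative i a b f g" "has_weak_derivative i a b f g'"
  shows "AE x in lebesgue. x \<in> {a<..<b} \<longrightarrow> g x = g' x"
proof -
  have "locally_integrable a b (\<lambda>x. g x - g' x)"
    using assms by (auto simp: has_weak_derivative_def locally_integrable_def)
  moreover have "(LINT x:{a<..<b}|lebesgue. \<eta> x *\<^sub>R (g x - g' x)) = 0" if "test_function a b \<eta>" for \<eta>
  proof -
    have "(-1) ^ i *\<^sub>R (LINT x:{a<..<b}|lebesgue. \<eta> x *\<^sub>R g x) = (-1) ^ i *\<^sub>R (LINT x:{a<..<b}|lebesgue. \<eta> x *\<^sub>R g' x)"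
      using assms that by (simp add: has_weak_derivative_def)
    then have "(LINT x:{a<..<b}|lebesgue. \<eta> x *\<^sub>R g x) = (LINT x:{a<..<b}|lebesgue. \<eta> x *\<^sub>R g' x)"
      by simp
    then show ?thesis
      using assms that
      by (simp add: scaleR_diff_right set_integral_diff set_integrable_test_function has_weak_derivative_def)
  qed
  ultimately have "AE x in lebesgue. x \<in> {a<..<b} \<longrightarrow> g x - g' x = 0"
    by (rule AE_eq_0_if_weakly_0)
  then show ?thesis by simp
qed

lemma set_integrable_imp_locally_integrable:
  "set_integrable lebesgue {a<..<b} f \<Longrightarrow> locally_integrable a b f"
  by (auto simp: locally_integrable_def intro: set_integrable_subset)

text \<open>The boundary terms vanish because the support of \<eta> stays away from the ends. The
  finite set \<open>S\<close> is harmless as \<open>D\<close> is continuous across it; in the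
  applications it consists of points where the next derivative may blow up or jump.\<close>

lemma integral_by_parts_test_function:
  fixes D D' :: "real \<Rightarrow> 'a::euclidean_space"
  assumes "test_function a b \<eta>" "a < b" "finite S" "continuous_on {a..b} D"
    and deriv: "\<And>x. x \<in> {a<..<b} - S \<Longrightarrow> (D has_vector_derivative D' x) (at x)"
    and int: "locally_integrable a b D'"
  shows "(LINT x:{a<..<b}|lebesgue. deriv \<eta> x *\<^sub>R D x) = - (LINT x:{a<..<b}|lebesgue. \<eta> x *\<^sub>R D' x)"
proof -
  have sm: "smooth \<eta>" using assms(1) by (simp add: test_function_def)
  obtain c d where cd: "a < c" "d < b" "\<And>x. x \<notin> {c..d} \<Longrightarrow> \<eta> x = 0"
    using test_function_support[OF assms(1)] by metis
  have "((\<lambda>x. deriv \<eta> x *\<^sub>R D x + \<eta> x *\<^sub>R D' x) has_integral (\<eta> b *\<^sub>R D b - \<eta> a *\<^sub>R D a)) {a..b}"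
  proof (rule fundamental_theorem_of_calculus_interior_strong[OF \<open>finite S\<close>])
    show "((\<lambda>x. \<eta> x *\<^sub>R D x) has_vector_derivative deriv \<eta> x *\<^sub>R D x + \<eta> x *\<^sub>R D' x) (at x)"
      if "x \<in> {a<..<b} - S" for x
      using has_vector_derivative_scaleR[OF smooth_has_derivative[OF sm, of 0 x] deriv[OF that]]
      by (simp add: add.commute)
    show "continuous_on {a..b} (\<lambda>x. \<eta> x *\<^sub>R D x)"
      using assms by (intro continuous_intros smooth_continuous_on[OF sm])
  qed (use assms in auto)
  moreover have "\<eta> a = 0" "\<eta> b = 0"
    using cd by auto
  ultimately have zero: "((\<lambda>x. deriv \<eta> x *\<^sub>R D x + \<eta> x *\<^sub>R D' x) has_integral 0) {a<..<b}"
    by (simp add: has_integral_open_interval flip: box_real)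
  have "locally_integrable a b D"
    using absolutely_integrable_continuous_real[OF assms(4)]
    by (auto simp: locally_integrable_def intro: set_integrable_subset)
  then have i1: "set_integrable lebesgue {a<..<b} (\<lambda>x. deriv \<eta> x *\<^sub>R D x)"
    by (intro set_integrable_test_function test_function_deriv assms)
  have i2: "set_integrable lebesgue {a<..<b} (\<lambda>x. \<eta> x *\<^sub>R D' x)"
    by (intro set_integrable_test_function assms)
  have "(LINT x:{a<..<b}|lebesgue. deriv \<eta> x *\<^sub>R D x + \<eta> x *\<^sub>R D' x) = 0"
    using set_lebesgue_integral_eq_integral(2)[OF set_integral_add(1)[OF i1 i2]] integral_unique[OF zero] by simp
  then show ?thesis
    by (simp add: set_integral_add(2)[OF i1 i2] add_eq_0_iff2)
qed

text \<open>Continuity is demanded only below the top order \<open>m\<close>. The top function has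
  merely to be integrable, which admits both poles and jumps.\<close>

lemma has_weak_derivative_classical:
  fixes D :: "nat \<Rightarrow> real \<Rightarrow> 'a::euclidean_space"
  assumes "a < b" "finite S"
    and cont: "\<And>i. i < m \<Longrightarrow> continuous_on {a..b} (D i)"
    and deriv: "\<And>i x. i < m \<Longrightarrow> x \<in> {a<..<b} - S \<Longrightarrow> (D i has_vector_derivative D (Suc i) x) (at x)"
    and int: "set_integrable lebesgue {a<..<b} (D m)"
    and "i \<le> m"
  shows "has_weak_derivative i a b (D 0) (D i)"
proof -
  have loc: "locally_integrable a b (D i)" if "i \<le> m" for i
  proof (cases "i = m")
    case True
    then show ?thesis using int by (auto intro: set_integrable_imp_locally_integrable)
  next
    case False
    with that have "set_integrable lebesgue {a..b} (D i)"
      by (intro absolutely_integrable_continuous_real cont) auto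
    then show ?thesis
      by (auto simp: locally_integrable_def intro: set_integrable_subset)
  qed
  have "(LINT x:{a<..<b}|lebesgue. (deriv ^^ i) \<eta> x *\<^sub>R D 0 x) =
      (- 1) ^ i *\<^sub>R (LINT x:{a<..<b}|lebesgue. \<eta> x *\<^sub>R D i x)" if "test_function a b \<eta>" "i \<le> m" for \<eta> i
    using that
  proof (induction i arbitrary: \<eta>)
    case (Suc i)
    have "(LINT x:{a<..<b}|lebesgue. (deriv ^^ Suc i) \<eta> x *\<^sub>R D 0 x) =
        (- 1) ^ i *\<^sub>R (LINT x:{a<..<b}|lebesgue. deriv \<eta> x *\<^sub>R D i x)"
      using Suc.IH[OF test_function_deriv[OF Suc.prems(1)]] Suc.prems(2) by (simp add: funpow_swap1)
    also have "(LINT x:{a<..<b}|lebesgue. deriv \<eta> x *\<^sub>R D i x) = - (LINT x:{a<..<b}|lebesgue. \<eta> x *\<^sub>R D (Suc i) x)"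
      using Suc.prems by (intro integral_by_parts_test_function[where S = S] assms loc) auto
    finally show ?case by simp
  qed simp
  then show ?thesis
    using loc \<open>i \<le> m\<close> by (simp add: has_weak_derivative_def)
qed

section \<open>A jump has no locally integrable weak derivative\<close>

text \<open>Test with bumps of radius \<open>1 / n\<close> around \<open>z\<close>. On the side
  \<open>e\<close> the bump decreases away from \<open>z\<close>, and on the other side
  \<open>H\<close> is zero, so the integral of the bump's derivative against \<open>H\<close> has
  absolute value at least \<epsilon> times the peak, that is \<epsilon> exp (- 2). The integral of
  the bump against \<open>G\<close> tends to zero, a contradiction.\<close>

lemma no_jump:
  fixes H G :: "real \<Rightarrow> real"
  assumes H: "locally_integrable a b H" and G: "locally_integrable a b G"
    and weak: "\<And>\<eta>. test_function a b \<eta> \<Longrightarrow>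
      (LINT x:{a<..<b}|lebesgue. deriv \<eta> x * H x) = - (LINT x:{a<..<b}|lebesgue. \<eta> x * G x)"
    and z: "z \<in> {a<..<b}" and "\<delta> > 0" and e: "e \<in> {1, - 1}" and "\<epsilon> > 0"
    and jump: "\<And>t. t \<in> {0<..<\<delta>} \<Longrightarrow> H (z + e * t) \<ge> \<epsilon> \<and> H (z - e * t) = 0"
  shows False
proof -
  obtain r where r: "r > 0" "r < \<delta>" "a < z - r" "z + r < b"
    using dense[of 0 "min \<delta> (min (z - a) (b - z))"] z \<open>\<delta> > 0\<close>
    by (auto simp: less_diff_eq algebra_simps)
  define \<eta> where "\<eta> n = cutoff (z - 1 / real n) (z + 1 / real n) n" for n
  have supp: "\<eta> n x = 0" if "\<bar>x - z\<bar> \<ge> 1 / n" for n x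
    using that by (auto simp: \<eta>_def cutoff_def expinv_def zero_less_mult_iff abs_if split: if_splits)
  have ev: "\<forall>\<^sub>F n in sequentially. n > 0 \<and> 1 / real n < r"
    using eventually_conj[OF eventually_gt_at_top[of 0] order_tendstoD(2)[OF lim_const_over_n[of 1] r(1)]] by simp
  have test: "test_function a b (\<eta> n)" if "1 / real n < r" for n
    unfolding \<eta>_def using that r by (intro test_function_cutoff) auto
  have lower: "\<epsilon> * exp (- 2) \<le> \<bar>LINT x:{a<..<b}|lebesgue. \<eta> n x * G x\<bar>" if n: "n > 0" "1 / real n < r" for n
  proof -
    note tf = test[OF n(2)]
    have sm: "smooth (\<eta> n)" using tf by (simp add: test_function_def)
    have \<eta>0: "\<eta> n z = exp (- 2)"
      using n by (simp add: \<eta>_def cutoff_def expinv_def flip: exp_add)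
    \<comment> \<open>The half of the bump's support on the side where \<open>H\<close> does not
      vanish, written so that both values of \<open>e\<close> are covered.\<close>
    define J where "J = {min z (z + e / n)..max z (z + e / n)}"
    have J: "J \<subseteq> {a<..<b}"
      using n r e by (auto simp: J_def)
    have J_iff: "x \<in> J \<longleftrightarrow> (\<exists>t\<in>{0..1 / n}. x = z + e * t)" for x
    proof -
      have "x \<in> J \<longleftrightarrow> e * (x - z) \<in> {0..1 / n}"
        using e by (auto simp: J_def field_simps)
      then show ?thesis
        using e by (auto intro!: bexI[of _ "e * (x - z)"])
    qed
    have deriv: "deriv (\<eta> n) x = n * (expinv [:0, 0, 1:] (1 + n * (x - z)) * expinv 1 (1 - n * (x - z)) -
        expinv [:0, 0, 1:] (1 - n * (x - z)) * expinv 1 (1 + n * (x - z)))" for x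
    proof -
      have eq: "n * (y - (z - 1 / n)) = 1 + n * (y - z)" "n * (z + 1 / n - y) = 1 - n * (y - z)" for y
        using n by (auto simp: field_simps)
      have "(\<eta> n has_real_derivative
         expinv [:0, 0, 1:] (1 + n * (x - z)) * n * expinv 1 (1 - n * (x - z)) +
         expinv [:0, 0, 1:] (1 - n * (x - z)) * (- n) * expinv 1 (1 + n * (x - z))) (at x)"
        unfolding \<eta>_def cutoff_def eq
        by (rule derivative_eq_intros DERIV_chain2[OF expinv_has_derivative] refl)+ simp
      then show ?thesis
        by (simp add: DERIV_imp_deriv algebra_simps)
    qed
    have d0: "deriv (\<eta> n) x = 0" if "\<bar>x - z\<bar> \<ge> 1 / n" for x
    proof -
      have "n * \<bar>x - z\<bar> \<ge> 1" using that n by (simp add: pos_divide_le_eq mult.commute)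
      then have "1 + n * (x - z) \<le> 0 \<or> 1 - n * (x - z) \<le> 0"
        by (cases "x \<le> z") (auto simp: algebra_simps)
      then show ?thesis by (auto simp: deriv expinv_def)
    qed
    have cd: "continuous_on UNIV (deriv (\<eta> n))"
      using test_function_deriv[OF tf] by (auto simp: test_function_def intro: smooth_continuous_on)
    have sgn: "e * deriv (\<eta> n) (z + e * t) \<le> 0" if "t \<in> {0..1 / n}" for t
    proof (cases "n * t < 1")
      case False
      then show ?thesis using e n d0[of "z + e * t"] that by (auto simp: field_simps)
    next
      case True
      have t: "0 \<le> n * t" "n * t < 1" using that True by auto
      define E where "E = exp (- (1 / (1 + n * t))) * exp (- (1 / (1 - n * t)))"
      \<comment> \<open>Each factor exp (- 1 / y) contributes 1 / y^2. The factor whose argument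
        decreases has the smaller argument 1 - n t, so its negative contribution prevails.\<close>
      have "e * deriv (\<eta> n) (z + e * t) = n * (E * ((1 / (1 + n * t))\<^sup>2 - (1 / (1 - n * t))\<^sup>2))"
        unfolding deriv using e t by (auto simp: expinv_def E_def algebra_simps power2_eq_square)
      moreover have "(1 / (1 + n * t))\<^sup>2 \<le> (1 / (1 - n * t))\<^sup>2"
        using t by (intro power_mono divide_left_mono) auto
      then have "E * ((1 / (1 + n * t))\<^sup>2 - (1 / (1 - n * t))\<^sup>2) \<le> 0"
        by (intro mult_nonneg_nonpos) (auto simp: E_def)
      ultimately show ?thesis by (simp add: mult_nonneg_nonpos)
    qed
    have zd: "deriv (\<eta> n) z = 0"
      by (simp add: deriv)
    have eqJ: "indicator {a<..<b} x *\<^sub>R (deriv (\<eta> n) x * H x) = indicator J x *\<^sub>R (deriv (\<eta> n) x * H x)" for x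
    proof (cases "x \<in> J")
      case True then show ?thesis using J by (auto simp: indicator_def)
    next
      case False
      have "deriv (\<eta> n) x * H x = 0" if "x \<in> {a<..<b}"
      proof (cases "\<bar>x - z\<bar> < 1 / n")
        case True
        have "x = z - e * (- e * (x - z))" using e by auto
        moreover have "- e * (x - z) \<in> {0<..<\<delta>}"
          using True False n r e by (auto simp: J_def)
        ultimately have "H x = 0" using jump by metis
        then show ?thesis by simp
      next
        case False then show ?thesis using d0 by force
      qed
      then show ?thesis using False by (auto simp: indicator_def)
    qed
    have Hloc: "set_integrable lebesgue J H"
      using H J n r e unfolding J_def locally_integrable_def by auto
    have intJ: "set_integrable lebesgue J (\<lambda>x. deriv (\<eta> n) x * H x)"
      using set_integrable_continuous_scaleR[OF continuous_on_subset[OF cd] Hloc, of "min z (z + e / n)" "max z (z + e / n)"]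
      by (simp add: J_def)
    have intJ': "set_integrable lebesgue J (\<lambda>x. e * (deriv (\<eta> n) x * \<epsilon>))"
      unfolding J_def by (intro absolutely_integrable_continuous_real continuous_intros continuous_on_subset[OF cd]) auto
    have "((deriv (\<eta> n)) has_integral (\<eta> n (max z (z + e / n)) - \<eta> n (min z (z + e / n)))) J"
      unfolding J_def using smooth_has_derivative[OF sm, of 0]
      by (intro fundamental_theorem_of_calculus)
        (auto simp: has_real_derivative_iff_has_vector_derivative intro: has_vector_derivative_at_within)
    moreover have "\<eta> n (max z (z + e / n)) - \<eta> n (min z (z + e / n)) = - e * \<eta> n z"
      using e supp[of n "z + 1 / n"] supp[of n "z - 1 / n"] by auto
    ultimately have "((\<lambda>x. e * (deriv (\<eta> n) x * \<epsilon>)) has_integral (e * (- e * \<eta> n z * \<epsilon>))) J"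
      by (intro has_integral_mult_right has_integral_mult_left) simp
    then have hi: "((\<lambda>x. e * (deriv (\<eta> n) x * \<epsilon>)) has_integral (- \<epsilon> * exp (- 2))) J"
      using e by (auto simp: \<eta>0 mult.commute)
    have "(LINT x:{a<..<b}|lebesgue. deriv (\<eta> n) x * H x) = (LINT x:J|lebesgue. deriv (\<eta> n) x * H x)"
      by (simp only: set_lebesgue_integral_def eqJ)
    then have "e * (LINT x:{a<..<b}|lebesgue. deriv (\<eta> n) x * H x) = (LINT x:J|lebesgue. e * (deriv (\<eta> n) x * H x))"
      by simp
    also have "\<dots> \<le> (LINT x:J|lebesgue. e * (deriv (\<eta> n) x * \<epsilon>))"
    proof (rule set_integral_mono[OF _ intJ'])
      show "set_integrable lebesgue J (\<lambda>x. e * (deriv (\<eta> n) x * H x))"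
        using intJ by simp
      fix x assume "x \<in> J"
      then obtain t where t: "t \<in> {0..1 / n}" "x = z + e * t" by (auto simp: J_iff)
      show "e * (deriv (\<eta> n) x * H x) \<le> e * (deriv (\<eta> n) x * \<epsilon>)"
      \<comment> \<open>Nothing is assumed about the value \<open>H z\<close>; at the centre the
        derivative of the bump is zero, which settles that point.\<close>
      proof (cases "t = 0")
        case True then show ?thesis using t zd by simp
      next
        case False
        then have "\<epsilon> \<le> H x" using jump[of t] t n r by auto
        then show ?thesis
          using mult_left_mono_neg[OF _ sgn[OF t(1)], of \<epsilon> "H x"] t by (simp add: mult.assoc)
      qed
    qed
    also have "\<dots> = - \<epsilon> * exp (- 2)"
      unfolding set_lebesgue_integral_eq_integral(2)[OF intJ'] integral_unique[OF hi] ..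
    finally have "\<epsilon> * exp (- 2) \<le> - e * (LINT x:{a<..<b}|lebesgue. deriv (\<eta> n) x * H x)" by simp
    also have "\<dots> = e * (LINT x:{a<..<b}|lebesgue. \<eta> n x * G x)"
      by (simp add: weak[OF tf])
    also have "\<dots> \<le> \<bar>LINT x:{a<..<b}|lebesgue. \<eta> n x * G x\<bar>"
      using e by auto
    finally show ?thesis .
  qed
  \<comment> \<open>Away from \<open>z\<close> the bumps are eventually zero, and all of them are
    bounded by 1, so dominated convergence sends this side to 0.\<close>
  have "(\<lambda>n. LINT x|lebesgue. indicator {z - r..z + r} x *\<^sub>R (\<eta> n x * G x)) \<longlonglongrightarrow> (LINT x::real|lebesgue. 0)"
  proof (rule integral_dominated_convergence[where w = "\<lambda>x. norm (indicator {z - r..z + r} x *\<^sub>R G x)"])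
    have Gi: "integrable lebesgue (\<lambda>x. indicator {z - r..z + r} x *\<^sub>R G x)"
      using G r by (auto simp: locally_integrable_def set_integrable_def)
    then show "integrable lebesgue (\<lambda>x. norm (indicator {z - r..z + r} x *\<^sub>R G x))"
      by (rule integrable_norm)
    show "(\<lambda>x. indicator {z - r..z + r} x *\<^sub>R (\<eta> n x * G x)) \<in> borel_measurable lebesgue" for n
    proof -
      have "\<eta> n \<in> borel_measurable lebesgue"
        using smooth_continuous_on[of "\<eta> n" UNIV]
          test_function_cutoff[of "z - 1 / n - 1" "z - 1 / n" "z + 1 / n" "z + 1 / n + 1" n]
        by (auto simp: test_function_def \<eta>_def intro!: borel_measurable_continuous_onI measurable_completion)
      from borel_measurable_times[OF this borel_measurable_integrable[OF Gi]]
      show ?thesis by (simp add: algebra_simps)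
    qed
    show "AE x in lebesgue. norm (indicator {z - r..z + r} x *\<^sub>R (\<eta> n x * G x)) \<le> norm (indicator {z - r..z + r} x *\<^sub>R G x)" for n
      using cutoff_bounds[of "z - 1 / n" "z + 1 / n" n]
      by (intro AE_I2) (auto simp: \<eta>_def abs_mult indicator_def intro!: mult_left_le_one_le)
    have "AE x in lebesgue. x \<notin> {z}"
      by (intro AE_not_in) (simp flip: negligible_iff_null_sets)
    then show "AE x in lebesgue. (\<lambda>n. indicator {z - r..z + r} x *\<^sub>R (\<eta> n x * G x)) \<longlonglongrightarrow> 0"
    proof eventually_elim
      case (elim x)
      then have "\<forall>\<^sub>F n in sequentially. 1 / real n < \<bar>x - z\<bar>"
        by (intro order_tendstoD(2)[OF lim_const_over_n[of 1]]) auto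
      then have "\<forall>\<^sub>F n in sequentially. indicator {z - r..z + r} x *\<^sub>R (\<eta> n x * G x) = 0"
        by eventually_elim (simp add: supp)
      then show ?case by (rule tendsto_eventually)
    qed
  qed auto
  then have "(\<lambda>n. \<bar>LINT x|lebesgue. indicator {z - r..z + r} x *\<^sub>R (\<eta> n x * G x)\<bar>) \<longlonglongrightarrow> 0"
    by (simp add: tendsto_rabs_zero)
  moreover have "\<forall>\<^sub>F n in sequentially. \<epsilon> * exp (- 2) \<le> \<bar>LINT x|lebesgue. indicator {z - r..z + r} x *\<^sub>R (\<eta> n x * G x)\<bar>"
    using ev
  proof eventually_elim
    case (elim n)
    have "indicator {a<..<b} x *\<^sub>R (\<eta> n x * G x) = indicator {z - r..z + r} x *\<^sub>R (\<eta> n x * G x)" for x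
      using r elim supp[where n = n and x = x] by (auto simp: indicator_def abs_if)
    then show ?case
      using lower[of n] elim by (simp only: set_lebesgue_integral_def)
  qed
  ultimately have "\<epsilon> * exp (- 2) \<le> 0"
    by (intro tendsto_lowerbound[OF _ _ sequentially_bot]) auto
  then show False
    using \<open>\<epsilon> > 0\<close> by (simp add: mult_le_0_iff)
qed

subsection \<open>Derivatives of the tangent\<close>

lemma powr_add_le:
  fixes x y r :: real
  assumes "0 \<le> x" "0 \<le> y" "0 \<le> r"
  shows "(x + y) powr r \<le> 2 powr r * (x powr r + y powr r)"
proof -
  have "(x + y) powr r \<le> (2 * max x y) powr r"
    using assms by (intro powr_mono2) auto
  also have "\<dots> = 2 powr r * max x y powr r"
    using assms by (simp add: powr_mult)
  also have "max x y powr r \<le> x powr r + y powr r"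
    by (auto simp: max_def)
  finally show ?thesis by simp
qed

text \<open>The two functions may take values in different spaces because the comparison is used
  both ways: the top derivative of the curve is bounded by that of the curvature plus a constant,
  and conversely.\<close>

lemma Lebesgue_space_bound:
  fixes f :: "real \<Rightarrow> 'a::euclidean_space" and h :: "real \<Rightarrow> 'b::euclidean_space"
  assumes "set_borel_measurable lebesgue {a<..<b} f"
    and "set_integrable lebesgue {a<..<b} (\<lambda>x. norm (h x) powr r)"
    and "AE x in lebesgue. x \<in> {a<..<b} \<longrightarrow> norm (f x) \<le> C + norm (h x)"
    and "0 \<le> C" "0 \<le> r"
  shows "Lebesgue_space (ereal r) a b f"
proof -
  have "set_integrable lebesgue {a<..<b} (\<lambda>x. norm (f x) powr r)"
  proof (rule set_integrable_bound)
    have "set_integrable lebesgue {a<..<b} (\<lambda>x. C powr r)"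
      by (rule absolutely_integrable_on_const) simp
    then show "set_integrable lebesgue {a<..<b} (\<lambda>x. 2 powr r * (C powr r + norm (h x) powr r))"
      using assms(2) by (intro set_integrable_mult_right set_integral_add(1)) auto
    have "(\<lambda>x. norm (indicator {a<..<b} x *\<^sub>R f x) powr r) \<in> borel_measurable lebesgue"
      using assms(1) by (auto simp: set_borel_measurable_def intro!: powr_real_measurable borel_measurable_const borel_measurable_norm simp del: norm_scaleR)
    moreover have "norm (indicator {a<..<b} x *\<^sub>R f x) powr r = indicator {a<..<b} x *\<^sub>R norm (f x) powr r" for x
      by (auto simp: indicator_def)
    ultimately show "set_borel_measurable lebesgue {a<..<b} (\<lambda>x. norm (f x) powr r)"
      by (simp only: set_borel_measurable_def)
    show "AE x in lebesgue. x \<in> {a<..<b} \<longrightarrow>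
        norm (norm (f x) powr r) \<le> norm (2 powr r * (C powr r + norm (h x) powr r))"
      using assms(3)
    proof eventually_elim
      case (elim x)
      show ?case
      proof
        assume "x \<in> {a<..<b}"
        then have "norm (f x) powr r \<le> (C + norm (h x)) powr r"
          using elim assms by (intro powr_mono2) auto
        also have "\<dots> \<le> 2 powr r * (C powr r + norm (h x) powr r)"
          using assms by (intro powr_add_le) auto
        finally show "norm (norm (f x) powr r) \<le> norm (2 powr r * (C powr r + norm (h x) powr r))"
          by simp
      qed
    qed
  qed
  then show ?thesis
    using assms(1) by (simp add: Lebesgue_space_def)
qed

lemma has_weak_derivativeD:
  assumes "has_weak_derivative i a b f g"
  shows "locally_integrable a b f" "locally_integrable a b g"
    and "test_function a b \<eta> \<Longrightarrow> (LINT x:{a<..<b}|lebesgue. (deriv ^^ i) \<eta> x *\<^sub>R f x) =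
        (- 1) ^ i *\<^sub>R (LINT x:{a<..<b}|lebesgue. \<eta> x *\<^sub>R g x)"
  using assms unfolding has_weak_derivative_def by blast+

definition perp :: "real^2 \<Rightarrow> real^2" where
  "perp v = vector [- v $ 2, v $ 1]"

lemma perp_nth [simp]: "perp v $ 1 = - v $ 2" "perp v $ 2 = v $ 1"
  by (simp_all add: perp_def)

lemma norm_perp [simp]: "norm (perp v) = norm v"
  by (simp add: norm_eq_sqrt_inner inner_vec_def sum_2 add.commute)

lemma bounded_linear_perp: "bounded_linear perp"
  by (auto simp: linear_conv_bounded_linear[symmetric] linear_iff vec_eq_iff forall_2)

lemma bounded_bilinear_scaleR_perp: "bounded_bilinear (\<lambda>x v. x *\<^sub>R perp v)"
  using bounded_bilinear.comp[OF bounded_bilinear_scaleR bounded_linear_ident bounded_linear_perp] .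

lemma curvature_of_perp: "norm u = 1 \<Longrightarrow> curvature_of u (x *\<^sub>R perp u) = x"
proof -
  assume u: "norm u = 1"
  then have "u $ 1 * u $ 1 + u $ 2 * u $ 2 = 1"
    by (simp add: norm_eq_1 inner_vec_def sum_2)
  then have "x * (u $ 1 * u $ 1 + u $ 2 * u $ 2) = x" by simp
  then show ?thesis
    using u by (simp add: curvature_of_def distrib_left mult.left_commute)
qed

text \<open>With \<open>\<kappa> j\<close> the \<open>j\<close>-th derivative of the curvature, \<open>tang \<kappa> T n\<close> is the
  \<open>n\<close>-th derivative of the tangent \<open>T\<close>: apply Leibniz' rule to \<open>T' = \<kappa> perp T\<close>.\<close>

fun tang :: "(nat \<Rightarrow> real \<Rightarrow> real) \<Rightarrow> (real \<Rightarrow> real^2) \<Rightarrow> nat \<Rightarrow> real \<Rightarrow> real^2" where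
  "tang \<kappa> T 0 = T"
| "tang \<kappa> T (Suc n) = (\<lambda>s. \<Sum>j\<le>n. real (n choose j) *\<^sub>R (\<kappa> j s *\<^sub>R perp (tang \<kappa> T (n - j) s)))"

text \<open>Strong induction: the Leibniz sum for one order contains all lower derivatives of
  \<open>T\<close>. Differentiating order \<open>n\<close> involves the curvature derivatives only
  up to order \<open>n\<close>.\<close>

lemma tang_has_vector_derivative:
  assumes T: "(T has_vector_derivative \<kappa> 0 s *\<^sub>R perp (T s)) (at s within A)"
    and \<kappa>: "\<And>j. j < n \<Longrightarrow> (\<kappa> j has_real_derivative \<kappa> (Suc j) s) (at s within A)"
  shows "(tang \<kappa> T n has_vector_derivative tang \<kappa> T (Suc n) s) (at s within A)"
  using \<kappa>
proof (induction n rule: less_induct)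
  case (less n)
  show ?case
  proof (cases n)
    case 0
    then show ?thesis using T by simp
  next
    case (Suc k)
    show ?thesis
      unfolding Suc tang.simps(2)[of \<kappa> T k] tang.simps(2)[of \<kappa> T "Suc k"]
    proof (rule bounded_bilinear.has_vector_derivative_Leibniz[OF bounded_bilinear_scaleR_perp])
      fix j assume "j \<le> k"
      then show "(\<kappa> j has_vector_derivative \<kappa> (Suc j) s) (at s within A)"
        using less.prems Suc by (simp add: has_real_derivative_iff_has_vector_derivative)
      show "(tang \<kappa> T j has_vector_derivative tang \<kappa> T (Suc j) s) (at s within A)"
        using \<open>j \<le> k\<close> less.prems Suc by (intro less.IH) auto
    qed
  qed
qed

lemma continuous_on_tang:
  assumes "continuous_on A T" "\<And>j. j < n \<Longrightarrow> continuous_on A (\<kappa> j)"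
  shows "continuous_on A (tang \<kappa> T n)"
  using assms(2)
proof (induction n rule: less_induct)
  case (less n)
  show ?case
  proof (cases n)
    case 0
    then show ?thesis using assms(1) by simp
  next
    case (Suc k)
    show ?thesis
      unfolding Suc tang.simps
      using less.prems Suc
      by (intro continuous_on_sum continuous_on_scaleR continuous_on_const
          bounded_linear.continuous_on[OF bounded_linear_perp] less.IH) auto
  qed
qed

section \<open>Curves whose curvature is regular up to a critical order\<close>

text \<open>The number \<open>m\<close> is the critical order: below it the derivatives of the
  curvature are continuous up to the ends, while \<open>\<kappa> m\<close> is merely integrable and
  is the derivative only off \<open>S\<close>. The corresponding order of the curve is
  \<open>m + 2\<close>.\<close>

locale regular_curvature =
  fixes L :: real and \<gamma> T :: "real \<Rightarrow> real^2" and \<kappa> :: "nat \<Rightarrow> real \<Rightarrow> real"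
    and m :: nat and S :: "real set"
  assumes L_pos: "L > 0" and finite_S: "finite S"
    and deriv_curve: "\<And>s. s \<in> {0..L} \<Longrightarrow> (\<gamma> has_vector_derivative T s) (at s within {0..L})"
    and deriv_T: "\<And>s. s \<in> {0..L} \<Longrightarrow> (T has_vector_derivative \<kappa> 0 s *\<^sub>R perp (T s)) (at s within {0..L})"
    and norm_T: "\<And>s. s \<in> {0..L} \<Longrightarrow> norm (T s) = 1"
    and cont_\<kappa>: "\<And>j. j < m \<Longrightarrow> continuous_on {0..L} (\<kappa> j)"
    and deriv_\<kappa>: "\<And>j s. j < m \<Longrightarrow> s \<in> {0<..<L} - S \<Longrightarrow> (\<kappa> j has_real_derivative \<kappa> (Suc j) s) (at s)"
    and int_\<kappa>: "set_integrable lebesgue {0<..<L} (\<kappa> m)"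
begin

definition D :: "nat \<Rightarrow> real \<Rightarrow> real^2" where
  "D i = (case i of 0 \<Rightarrow> \<gamma> | Suc n \<Rightarrow> tang \<kappa> T n)"

text \<open>The part of the derivative of order \<open>m + 2\<close> that does not contain
  \<open>\<kappa> m\<close>. It is continuous, so the integrability of that derivative is decided by
  \<open>\<kappa> m\<close> alone.\<close>

definition rest :: "real \<Rightarrow> real^2" where
  "rest s = (\<Sum>j<m. real (m choose j) *\<^sub>R (\<kappa> j s *\<^sub>R perp (tang \<kappa> T (m - j) s)))"

lemma cont_T: "continuous_on {0..L} T"
  using continuous_on_vector_derivative[OF deriv_T] by blast

lemma tang_top: "tang \<kappa> T (Suc m) s = rest s + \<kappa> m s *\<^sub>R perp (T s)"
  by (simp add: rest_def lessThan_Suc_atMost[symmetric])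

lemma cont_rest: "continuous_on {0..L} rest"
  unfolding rest_def
  by (intro continuous_on_sum continuous_on_scaleR continuous_on_const
      bounded_linear.continuous_on[OF bounded_linear_perp] continuous_on_tang cont_T cont_\<kappa>) auto

lemma D_Suc: "D (Suc n) = tang \<kappa> T n"
  by (simp add: D_def)

lemma cont_D: "i < m + 2 \<Longrightarrow> continuous_on {0..L} (D i)"
proof (cases i)
  case 0
  then show ?thesis
    using continuous_on_vector_derivative[OF deriv_curve] by (auto simp: D_def)
next
  case (Suc n)
  then show "i < m + 2 \<Longrightarrow> continuous_on {0..L} (D i)"
    by (auto simp: D_def intro!: continuous_on_tang cont_T cont_\<kappa>)
qed

lemma deriv_D:
  assumes "i < m + 2" "s \<in> {0<..<L} - S"
  shows "(D i has_vector_derivative D (Suc i) s) (at s)"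
proof -
  have at: "at s within {0..L} = at s"
    using assms by (intro at_within_interior) auto
  show ?thesis
  proof (cases i)
    case 0
    then show ?thesis using deriv_curve[of s] assms at by (auto simp: D_def)
  next
    case (Suc n)
    have "(T has_vector_derivative \<kappa> 0 s *\<^sub>R perp (T s)) (at s)"
      using deriv_T[of s] assms at by auto
    then show ?thesis
      using assms Suc unfolding Suc D_Suc by (intro tang_has_vector_derivative deriv_\<kappa>) auto
  qed
qed

lemma int_perp: "set_integrable lebesgue {0<..<L} (\<lambda>s. \<kappa> m s *\<^sub>R perp (T s))"
proof (rule set_integrable_bound)
  show "set_integrable lebesgue {0<..<L} (\<kappa> m)" by (rule int_\<kappa>)
  have "(\<lambda>s. perp (T s)) \<in> borel_measurable (lebesgue_on {0<..<L})"
    by (intro continuous_imp_measurable_on_sets_lebesgue bounded_linear.continuous_on[OF bounded_linear_perp]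
       continuous_on_subset[OF cont_T]) auto
  then have "set_borel_measurable lebesgue {0<..<L} (\<lambda>s. perp (T s))"
    by (simp add: set_borel_measurable_def borel_measurable_restrict_space_iff)
  then have "(\<lambda>s. (indicator {0<..<L} s *\<^sub>R \<kappa> m s) *\<^sub>R (indicator {0<..<L} s *\<^sub>R perp (T s))) \<in> borel_measurable lebesgue"
    using borel_measurable_scaleR[OF borel_measurable_integrable[OF int_\<kappa>[unfolded set_integrable_def]]]
    by (simp only: set_borel_measurable_def)
  moreover have "(indicator {0<..<L} s *\<^sub>R \<kappa> m s) *\<^sub>R (indicator {0<..<L} s *\<^sub>R perp (T s)) = indicator {0<..<L} s *\<^sub>R (\<kappa> m s *\<^sub>R perp (T s))" for s
    by (auto simp: indicator_def)
  ultimately show "set_borel_measurable lebesgue {0<..<L} (\<lambda>s. \<kappa> m s *\<^sub>R perp (T s))"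
    by (simp only: set_borel_measurable_def)
  show "AE s in lebesgue. s \<in> {0<..<L} \<longrightarrow> norm (\<kappa> m s *\<^sub>R perp (T s)) \<le> norm (\<kappa> m s)"
    using norm_T by (intro AE_I2) auto
qed

lemma set_integrable_continuous_open:
  "continuous_on {0..L} f \<Longrightarrow> set_integrable lebesgue {0<..<L} (f :: real \<Rightarrow> real^2)"
  by (rule set_integrable_subset[OF absolutely_integrable_continuous_real]) auto

lemma int_D: "i \<le> m + 2 \<Longrightarrow> set_integrable lebesgue {0<..<L} (D i)"
proof (cases "i = m + 2")
  case True
  then have "D i = (\<lambda>s. rest s + \<kappa> m s *\<^sub>R perp (T s))"
    using tang_top by (auto simp: D_Suc fun_eq_iff simp del: tang.simps)
  then show ?thesis
    by (simp add: set_integral_add(1) set_integrable_continuous_open cont_rest int_perp)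
next
  case False
  then show "i \<le> m + 2 \<Longrightarrow> set_integrable lebesgue {0<..<L} (D i)"
    by (intro set_integrable_continuous_open cont_D) simp
qed

lemma weak_D: "i \<le> m + 2 \<Longrightarrow> has_weak_derivative i 0 L \<gamma> (D i)"
  using has_weak_derivative_classical[OF L_pos finite_S, of "m + 2" D i]
  by (simp add: cont_D deriv_D int_D) (simp add: D_def)

text \<open>\<open>weak_curvature\<close> is built from arbitrary representatives, so only an almost
  everywhere identity can hold. Orders 1 and 2 are available for every \<open>m\<close>, including
  \<open>m = 0\<close>.\<close>

lemma weak_curvature_AE: "AE s in lebesgue. s \<in> {0<..<L} \<longrightarrow> weak_curvature 0 L \<gamma> s = \<kappa> 0 s"
proof -
  have "has_weak_derivative i 0 L \<gamma> (weak_derivative i 0 L \<gamma>)" if "i \<le> 2" for i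
    unfolding weak_derivative_def
    by (rule someI_ex[of "has_weak_derivative i 0 L \<gamma>"]) (use weak_D[of i] that in auto)
  then have "AE s in lebesgue. s \<in> {0<..<L} \<longrightarrow> weak_derivative i 0 L \<gamma> s = D i s" if "i \<le> 2" for i
    using has_weak_derivative_AE_unique[OF _ weak_D[of i]] that by simp
  from this[of 1] this[of 2]
  have "AE s in lebesgue. s \<in> {0<..<L} \<longrightarrow> weak_derivative 1 0 L \<gamma> s = D 1 s"
    "AE s in lebesgue. s \<in> {0<..<L} \<longrightarrow> weak_derivative 2 0 L \<gamma> s = D 2 s"
    by simp_all
  then show ?thesis
  proof eventually_elim
    case (elim s)
    then show ?case
      by (simp add: weak_curvature_def D_Suc numeral_2_eq_2 curvature_of_perp norm_T)
  qed
qed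

lemma bounded_on_interval:
  assumes "continuous_on {0..L} (f :: real \<Rightarrow> real^2)"
  obtains C where "0 \<le> C" "\<And>s. s \<in> {0..L} \<Longrightarrow> norm (f s) \<le> C"
proof -
  have "bounded (f ` {0..L})"
    by (intro compact_imp_bounded compact_continuous_image assms) simp
  then obtain C where "\<forall>x\<in>f ` {0..L}. norm x \<le> C"
    by (auto simp only: bounded_iff)
  then have C: "\<And>s. s \<in> {0..L} \<Longrightarrow> norm (f s) \<le> C"
    by blast
  moreover have "0 \<le> C"
    using order_trans[OF norm_ge_zero C[of 0]] L_pos by simp
  ultimately show ?thesis using that by blast
qed

lemma measurable_D: "i \<le> m + 2 \<Longrightarrow> set_borel_measurable lebesgue {0<..<L} (D i)"
  using int_D by (auto simp: set_integrable_def set_borel_measurable_def)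

lemma norm_D_bound:
  assumes "i \<le> m + 2"
  obtains C where "0 \<le> C" "\<And>s. s \<in> {0<..<L} \<Longrightarrow> norm (D i s) \<le> C + norm (if i = m + 2 then \<kappa> m s else 0)"
proof (cases "i = m + 2")
  case True
  obtain C where C: "0 \<le> C" "\<And>s. s \<in> {0..L} \<Longrightarrow> norm (rest s) \<le> C"
    using bounded_on_interval[OF cont_rest] by blast
  have "norm (D i s) \<le> C + norm (\<kappa> m s)" if "s \<in> {0<..<L}" for s
  proof -
    have "D i s = rest s + \<kappa> m s *\<^sub>R perp (T s)"
      using True tang_top[of s] by (simp add: D_Suc del: tang.simps)
    then have "norm (D i s) \<le> norm (rest s) + \<bar>\<kappa> m s\<bar> * norm (T s)"
      using norm_triangle_ineq[of "rest s" "\<kappa> m s *\<^sub>R perp (T s)"] by simp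
    then show ?thesis
      using C(2)[of s] norm_T[of s] that by simp
  qed
  then show ?thesis using that C True by simp
next
  case False
  then obtain C where "0 \<le> C" "\<And>s. s \<in> {0..L} \<Longrightarrow> norm (D i s) \<le> C"
    using bounded_on_interval[OF cont_D[of i]] assms by auto
  then show ?thesis using that False by auto
qed

lemma Sobolev_finite:
  assumes "r \<ge> 1" "set_integrable lebesgue {0<..<L} (\<lambda>s. \<bar>\<kappa> m s\<bar> powr r)"
  shows "Sobolev (m + 2) (ereal r) 0 L \<gamma>"
proof -
  have "Lebesgue_space (ereal r) 0 L (D i)" if i: "i \<le> m + 2" for i
  proof -
    obtain C where C: "0 \<le> C" "\<And>s. s \<in> {0<..<L} \<Longrightarrow> norm (D i s) \<le> C + norm (if i = m + 2 then \<kappa> m s else 0)"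
      using norm_D_bound[OF i] by blast
    show ?thesis
    proof (rule Lebesgue_space_bound)
      show "set_integrable lebesgue {0<..<L} (\<lambda>s. norm (if i = m + 2 then \<kappa> m s else 0) powr r)"
        using assms by (cases "i = m + 2") (auto simp: set_integrable_def)
      show "AE s in lebesgue. s \<in> {0<..<L} \<longrightarrow> norm (D i s) \<le> C + norm (if i = m + 2 then \<kappa> m s else 0)"
        using C(2) by (intro AE_I2 impI)
    qed (use i C assms in \<open>auto intro: measurable_D\<close>)
  qed
  moreover have "D 0 = \<gamma>" by (simp add: D_def)
  ultimately show ?thesis
    unfolding Sobolev_def using weak_D by (metis atLeastAtMost_iff zero_le)
qed

lemma Sobolev_infinity:
  assumes "\<And>s. s \<in> {0<..<L} \<Longrightarrow> \<bar>\<kappa> m s\<bar> \<le> B"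
  shows "Sobolev (m + 2) \<infinity> 0 L \<gamma>"
proof -
  have "Lebesgue_space \<infinity> 0 L (D i)" if i: "i \<le> m + 2" for i
  proof -
    obtain C where C: "0 \<le> C" "\<And>s. s \<in> {0<..<L} \<Longrightarrow> norm (D i s) \<le> C + norm (if i = m + 2 then \<kappa> m s else 0)"
      using norm_D_bound[OF i] by blast
    have "norm (D i s) \<le> C + \<bar>B\<bar>" if "s \<in> {0<..<L}" for s
      using C(2)[OF that] assms[OF that] by (auto split: if_splits)
    then show ?thesis
      using measurable_D[OF i] unfolding Lebesgue_space_def
      by (auto intro!: exI[of _ "C + \<bar>B\<bar>"] AE_I2)
  qed
  moreover have "D 0 = \<gamma>" by (simp add: D_def)
  ultimately show ?thesis
    unfolding Sobolev_def using weak_D by (metis atLeastAtMost_iff zero_le)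
qed

text \<open>Since \<open>perp (T s)\<close> is a unit vector,
  \<open>\<bar>\<kappa> m s\<bar>\<close> is at most the norm of any weak derivative of order
  \<open>m + 2\<close> plus the bound of \<open>rest\<close>, for almost every
  \<open>s\<close>.\<close>

lemma Sobolev_finite_imp_integrable:
  assumes "r \<ge> 1" "Sobolev (m + 2) (ereal r) 0 L \<gamma>"
  shows "set_integrable lebesgue {0<..<L} (\<lambda>s. \<bar>\<kappa> m s\<bar> powr r)"
proof -
  obtain g where g: "has_weak_derivative (m + 2) 0 L \<gamma> g" "Lebesgue_space (ereal r) 0 L g"
    using assms(2) by (force simp: Sobolev_def)
  obtain C where C: "0 \<le> C" "\<And>s. s \<in> {0..L} \<Longrightarrow> norm (rest s) \<le> C"
    using bounded_on_interval[OF cont_rest] by blast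
  have "Lebesgue_space (ereal r) 0 L (\<kappa> m)"
  proof (rule Lebesgue_space_bound)
    show "set_borel_measurable lebesgue {0<..<L} (\<kappa> m)"
      using int_\<kappa> by (auto simp: set_integrable_def set_borel_measurable_def)
    show "set_integrable lebesgue {0<..<L} (\<lambda>s. norm (g s) powr r)"
      using g(2) by (simp add: Lebesgue_space_def)
    have "AE s in lebesgue. s \<in> {0<..<L} \<longrightarrow> g s = D (m + 2) s"
      using has_weak_derivative_AE_unique[OF g(1) weak_D] by simp
    then show "AE s in lebesgue. s \<in> {0<..<L} \<longrightarrow> norm (\<kappa> m s) \<le> C + norm (g s)"
    proof eventually_elim
      case (elim s)
      show ?case
      proof
        assume s: "s \<in> {0<..<L}"
        then have "g s = rest s + \<kappa> m s *\<^sub>R perp (T s)"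
          using elim tang_top[of s] by (simp add: D_Suc del: tang.simps)
        then have "\<kappa> m s *\<^sub>R perp (T s) = g s - rest s" by simp
        then have "norm (\<kappa> m s *\<^sub>R perp (T s)) \<le> norm (g s) + norm (rest s)"
          by (metis norm_triangle_ineq4)
        then show "norm (\<kappa> m s) \<le> C + norm (g s)"
          using C(2)[of s] norm_T[of s] s by simp
      qed
    qed
  qed (use C assms in auto)
  then show ?thesis by (simp add: Lebesgue_space_def)
qed

text \<open>On the flat side \<open>rest\<close> vanishes, hence by continuity
  \<open>rest z = 0\<close>, and the derivative of order \<open>m + 2\<close> jumps by exactly
  \<open>w = v *\<^sub>R perp (T z)\<close>. Its inner product with \<open>w\<close> is zero on one
  side and exceeds \<open>v\<^sup>2 / 2\<close> near \<open>z\<close> on the other, which is the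
  scalar situation of \<open>no_jump\<close>.\<close>

lemma not_Sobolev_jump:
  assumes z: "z \<in> {0<..<L}" and e: "e \<in> {1, - 1}" and "\<delta> > 0"
    and flat: "\<And>j t. j \<le> m \<Longrightarrow> t \<in> {0<..<\<delta>} \<Longrightarrow> \<kappa> j (z - e * t) = 0"
    and lim: "((\<lambda>t. \<kappa> m (z + e * t)) \<longlongrightarrow> v) (at_right 0)" and "v \<noteq> 0"
  shows "\<not> Sobolev (m + 3) 1 0 L \<gamma>"
proof
  assume "Sobolev (m + 3) 1 0 L \<gamma>"
  then obtain g where g: "has_weak_derivative (m + 3) 0 L \<gamma> g"
    by (force simp: Sobolev_def)
  define w where "w = v *\<^sub>R perp (T z)"
  have z': "z \<in> {0..L}" using z by auto
  have side: "((\<lambda>t. f (z + c * t)) \<longlongrightarrow> f z) (at_right 0)"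
    if "continuous_on {0..L} f" for f :: "real \<Rightarrow> real^2" and c
  proof -
    have "isCont f z"
      using that z by (intro continuous_on_interior) auto
    then show ?thesis
      by (intro isCont_tendsto_compose[where g = f]) (auto intro!: tendsto_eq_intros)
  qed
  have "\<forall>\<^sub>F t in at_right 0. t \<in> {0<..<\<delta>}"
    using \<open>\<delta> > 0\<close> by (rule eventually_at_right_real)
  then have "\<forall>\<^sub>F t in at_right 0. rest (z + (- e) * t) = 0"
    by eventually_elim (auto simp: rest_def flat intro!: sum.neutral)
  then have rest0: "rest z = 0"
    using tendsto_unique[OF _ side[OF cont_rest, of "- e"] tendsto_eventually] by force
  have "((\<lambda>t. rest (z + e * t) + \<kappa> m (z + e * t) *\<^sub>R perp (T (z + e * t))) \<longlongrightarrow> rest z + w) (at_right 0)"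
    unfolding w_def
    by (intro tendsto_intros side[OF cont_rest] lim bounded_linear.tendsto[OF bounded_linear_perp] side[OF cont_T])
  then have "((\<lambda>t. tang \<kappa> T (Suc m) (z + e * t) \<bullet> w) \<longlongrightarrow> w \<bullet> w) (at_right 0)"
    unfolding tang_top rest0 by (intro tendsto_intros) simp
  moreover have "w \<bullet> w = v\<^sup>2"
    using norm_T[OF z'] by (simp add: w_def power2_norm_eq_inner[symmetric] power_mult_distrib)
  ultimately have "\<forall>\<^sub>F t in at_right 0. tang \<kappa> T (Suc m) (z + e * t) \<bullet> w > v\<^sup>2 / 2"
    using \<open>v \<noteq> 0\<close> by (intro order_tendstoD(1)) auto
  then obtain \<delta>' where \<delta>': "\<delta>' > 0" "\<And>t. t \<in> {0<..<\<delta>'} \<Longrightarrow> tang \<kappa> T (Suc m) (z + e * t) \<bullet> w > v\<^sup>2 / 2"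
    by (auto simp: eventually_at_right_field simp del: tang.simps)
  have D: "has_weak_derivative (m + 2) 0 L \<gamma> (D (m + 2))"
    by (rule weak_D) simp
  have inner: "locally_integrable 0 L (\<lambda>x. f x \<bullet> w)" if "locally_integrable 0 L f" for f :: "real \<Rightarrow> real^2"
    unfolding locally_integrable_def set_integrable_def
  proof (intro allI impI)
    fix c d :: real assume "0 < c \<and> d < L"
    then have "integrable lebesgue (\<lambda>x. indicator {c..d} x *\<^sub>R f x)"
      using that by (auto simp: locally_integrable_def set_integrable_def)
    then have "integrable lebesgue (\<lambda>x. (indicator {c..d} x *\<^sub>R f x) \<bullet> w)"
      by (intro integrable_inner_left) auto
    then show "integrable lebesgue (\<lambda>x. indicator {c..d} x *\<^sub>R (f x \<bullet> w))"
      by simp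
  qed
  show False
  proof (rule no_jump[where a = 0 and b = L and z = z and e = e and \<delta> = "min \<delta> \<delta>'" and \<epsilon> = "v\<^sup>2 / 2"
      and H = "\<lambda>x. D (m + 2) x \<bullet> w" and G = "\<lambda>x. g x \<bullet> w"])
    show "locally_integrable 0 L (\<lambda>x. D (m + 2) x \<bullet> w)" "locally_integrable 0 L (\<lambda>x. g x \<bullet> w)"
      by (rule inner has_weak_derivativeD(2)[OF D] has_weak_derivativeD(2)[OF g])+
    show "(LINT x:{0<..<L}|lebesgue. deriv \<eta> x * (D (m + 2) x \<bullet> w)) = - (LINT x:{0<..<L}|lebesgue. \<eta> x * (g x \<bullet> w))"
      if \<eta>: "test_function 0 L \<eta>" for \<eta>
    proof -
      have loc: "locally_integrable 0 L (D (m + 2))" "locally_integrable 0 L g"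
        by (rule has_weak_derivativeD[OF D] has_weak_derivativeD[OF g])+
      have i1: "integrable lebesgue (\<lambda>x. indicator {0<..<L} x *\<^sub>R deriv \<eta> x *\<^sub>R D (m + 2) x)"
        using set_integrable_test_function[OF test_function_deriv[OF \<eta>] loc(1)]
        unfolding set_integrable_def .
      have i2: "integrable lebesgue (\<lambda>x. indicator {0<..<L} x *\<^sub>R \<eta> x *\<^sub>R g x)"
        using set_integrable_test_function[OF \<eta> loc(2)] unfolding set_integrable_def .
      have m3: "m + 3 = Suc (m + 2)" by simp
      \<comment> \<open>Testing order \<open>m + 2\<close> with \<open>deriv \<eta>\<close> and
        order \<open>m + 3\<close> with \<eta> gives the same integral of \<gamma>; hence
        \<open>g\<close> is a first-order weak derivative of \<open>D (m + 2)\<close>.\<close>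
      have "(- 1) ^ (m + 2) *\<^sub>R (LINT x:{0<..<L}|lebesgue. deriv \<eta> x *\<^sub>R D (m + 2) x) =
          (LINT x:{0<..<L}|lebesgue. (deriv ^^ (m + 2)) (deriv \<eta>) x *\<^sub>R \<gamma> x)"
        by (rule has_weak_derivativeD(3)[OF D test_function_deriv[OF \<eta>], symmetric])
      also have "(deriv ^^ (m + 2)) (deriv \<eta>) = (deriv ^^ (m + 3)) \<eta>"
        unfolding m3 by (simp only: funpow_Suc_right o_apply)
      also have "(LINT x:{0<..<L}|lebesgue. (deriv ^^ (m + 3)) \<eta> x *\<^sub>R \<gamma> x) =
          (- 1) ^ (m + 3) *\<^sub>R (LINT x:{0<..<L}|lebesgue. \<eta> x *\<^sub>R g x)"
        by (rule has_weak_derivativeD(3)[OF g \<eta>])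
      also have "(- 1 :: real) ^ (m + 3) = (- 1) ^ (m + 2) * (- 1)"
        unfolding m3 by (rule power_Suc2)
      finally have "(- 1) ^ (m + 2) *\<^sub>R (LINT x:{0<..<L}|lebesgue. deriv \<eta> x *\<^sub>R D (m + 2) x) =
         (- 1) ^ (m + 2) *\<^sub>R (- (LINT x:{0<..<L}|lebesgue. \<eta> x *\<^sub>R g x))"
        by simp
      then have "(LINT x:{0<..<L}|lebesgue. deriv \<eta> x *\<^sub>R D (m + 2) x) = - (LINT x:{0<..<L}|lebesgue. \<eta> x *\<^sub>R g x)"
        by (subst (asm) scaleR_cancel_left) simp
      then have "(LINT x:{0<..<L}|lebesgue. deriv \<eta> x *\<^sub>R D (m + 2) x) \<bullet> w = - ((LINT x:{0<..<L}|lebesgue. \<eta> x *\<^sub>R g x) \<bullet> w)"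
        by simp
      then show ?thesis
        unfolding set_lebesgue_integral_def using i1 i2
        by (simp add: mult.assoc flip: integral_inner_left)
    qed
    show "v\<^sup>2 / 2 \<le> D (m + 2) (z + e * t) \<bullet> w \<and> D (m + 2) (z - e * t) \<bullet> w = 0"
      if "t \<in> {0<..<min \<delta> \<delta>'}" for t
    proof -
      have "tang \<kappa> T (Suc m) (z - e * t) = 0"
        using that flat[of _ t] by (auto intro!: sum.neutral)
      then show ?thesis
        using \<delta>'(2)[of t] that by (auto simp: D_Suc simp del: tang.simps)
    qed
    show "0 < min \<delta> \<delta>'" "0 < v\<^sup>2 / 2" "z \<in> {0<..<L}" "e \<in> {1, - 1}"
      using assms \<delta>' by auto
  qed
qed

end

section \<open>Integrability at algebraic poles\<close>

lemma set_integrable_if_locally: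
  fixes f :: "real \<Rightarrow> real"
  assumes A: "A \<in> sets lebesgue" "A \<subseteq> {a..b}"
    and loc: "\<And>x. x \<in> {a..b} \<Longrightarrow> \<exists>\<delta>>0. set_integrable lebesgue (A \<inter> ball x \<delta>) f"
  shows "set_integrable lebesgue A f"
proof -
  obtain \<delta> where \<delta>: "\<And>x. x \<in> {a..b} \<Longrightarrow> \<delta> x > 0"
      "\<And>x. x \<in> {a..b} \<Longrightarrow> set_integrable lebesgue (A \<inter> ball x (\<delta> x)) f"
    using loc by metis
  have "{a..b} \<subseteq> (\<Union>x\<in>{a..b}. ball x (\<delta> x))"
    using \<delta>(1) by auto
  then obtain C where C: "C \<subseteq> {a..b}" "finite C" "{a..b} \<subseteq> (\<Union>x\<in>C. ball x (\<delta> x))"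
    by (rule compactE_image[OF compact_Icc, rotated]) auto
  have "set_integrable lebesgue (\<Union>x\<in>C. A \<inter> ball x (\<delta> x)) f"
    using C \<delta>(2) A by (intro set_integrable_UN) auto
  moreover have "(\<Union>x\<in>C. A \<inter> ball x (\<delta> x)) = A"
    using C A by blast
  ultimately show ?thesis by simp
qed

lemma absolutely_integrable_powr_pole:
  fixes c :: real
  assumes "\<beta> < 1"
  shows "set_integrable lebesgue {a..b} (\<lambda>x. \<bar>x - c\<bar> powr (- \<beta>))"
proof (cases "a \<le> b")
  case True
  define G where "G x = sgn (x - c) * \<bar>x - c\<bar> powr (1 - \<beta>) / (1 - \<beta>)" for x
  have "((\<lambda>x. \<bar>x - c\<bar> powr (- \<beta>)) has_integral (G b - G a)) {a..b}"
  proof (rule fundamental_theorem_of_calculus_interior_strong[of "{c}"])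
    fix x assume "x \<in> {a<..<b} - {c}"
    then consider "x < c" | "x > c" by fastforce
    then have "(G has_real_derivative \<bar>x - c\<bar> powr (- \<beta>)) (at x)"
    proof cases
      case 1
      have "((\<lambda>z. z powr (1 - \<beta>)) has_real_derivative (1 - \<beta>) * (c - x) powr (- \<beta>)) (at (c - x))"
        using has_real_derivative_powr[of "c - x" "1 - \<beta>"] 1 by simp
      then have "((\<lambda>x. (c - x) powr (1 - \<beta>)) has_real_derivative (1 - \<beta>) * (c - x) powr (- \<beta>) * (- 1)) (at x)"
        by (rule DERIV_chain2) (auto intro!: derivative_eq_intros)
      from DERIV_minus[OF DERIV_cdivide[OF this, of "1 - \<beta>"]]
      have "((\<lambda>x. - ((c - x) powr (1 - \<beta>) / (1 - \<beta>))) has_real_derivative \<bar>x - c\<bar> powr (- \<beta>)) (at x)"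
        using 1 assms by simp
      moreover have "\<forall>\<^sub>F y in nhds x. G y = - ((c - y) powr (1 - \<beta>) / (1 - \<beta>))"
        using eventually_nhds_in_open[of "{..<c}" x] 1
        by (auto elim!: eventually_mono simp: G_def)
      ultimately show ?thesis
        using DERIV_cong_ev[OF refl _ refl] by fast
    next
      case 2
      have "((\<lambda>z. z powr (1 - \<beta>)) has_real_derivative (1 - \<beta>) * (x - c) powr (- \<beta>)) (at (x - c))"
        using has_real_derivative_powr[of "x - c" "1 - \<beta>"] 2 by simp
      then have "((\<lambda>x. (x - c) powr (1 - \<beta>)) has_real_derivative (1 - \<beta>) * (x - c) powr (- \<beta>) * 1) (at x)"
        by (rule DERIV_chain2) (auto intro!: derivative_eq_intros)
      from DERIV_cdivide[OF this, of "1 - \<beta>"]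
      have "((\<lambda>x. (x - c) powr (1 - \<beta>) / (1 - \<beta>)) has_real_derivative \<bar>x - c\<bar> powr (- \<beta>)) (at x)"
        using 2 assms by simp
      moreover have "\<forall>\<^sub>F y in nhds x. G y = (y - c) powr (1 - \<beta>) / (1 - \<beta>)"
        using order_tendstoD(1)[OF filterlim_ident 2] by eventually_elim (simp add: G_def)
      ultimately show ?thesis
        using DERIV_cong_ev[OF refl _ refl] by fast
    qed
    then show "(G has_vector_derivative \<bar>x - c\<bar> powr (- \<beta>)) (at x)"
      by (simp add: has_real_derivative_iff_has_vector_derivative)
  next
    \<comment> \<open>Written with \<open>max\<close>, both bases are nonnegative and the exponent
      is positive, which yields continuity across \<open>c\<close>.\<close>
    have G: "G = (\<lambda>x. (max 0 (x - c) powr (1 - \<beta>) - max 0 (c - x) powr (1 - \<beta>)) / (1 - \<beta>))"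
      by (auto simp: G_def fun_eq_iff sgn_if max_def)
    show "continuous_on {a..b} G"
      unfolding G using assms by (intro continuous_intros continuous_on_powr') auto
  qed (use True in auto)
  then have "(\<lambda>x. \<bar>x - c\<bar> powr (- \<beta>)) integrable_on {a..b}"
    by (auto simp: integrable_on_def)
  then show ?thesis
    by (rule nonnegative_absolutely_integrable_1) simp
qed (simp add: set_integrable_def)

text \<open>The integral of c / t over [\<epsilon>, d] is c (ln d - ln \<epsilon>), which exceeds
  any supposed value of the integral of \<open>f\<close> once \<epsilon> is small. The sign
  \<open>e\<close> selects the side of \<open>z\<close>.\<close>

lemma not_integrable_pole:
  fixes f :: "real \<Rightarrow> real"
  assumes int: "set_integrable lebesgue A f" and pos: "\<And>x. f x \<ge> 0" and "c > 0" "\<delta> > 0"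
    and e: "e \<in> {1, - 1}"
    and bound: "\<And>t. t \<in> {0<..<\<delta>} \<Longrightarrow> z + e * t \<in> A \<and> f (z + e * t) \<ge> c / t"
  shows False
proof -
  define I where "I = (LINT x:A|lebesgue. f x)"
  have I: "I \<ge> 0"
    using pos by (auto simp: I_def set_lebesgue_integral_def intro!: integral_nonneg_AE)
  define d where "d = \<delta> / 2"
  \<comment> \<open>Chosen so that \<open>c * (ln d - ln \<epsilon>)\<close> equals
    \<open>I + 1\<close>, one more than the integral of \<open>f\<close> over
    \<open>A\<close>.\<close>
  define \<epsilon> where "\<epsilon> = d * exp (- (I + 1) / c)"
  have d: "0 < d" "d < \<delta>" using \<open>\<delta> > 0\<close> by (auto simp: d_def)
  have \<epsilon>: "0 < \<epsilon>" "\<epsilon> < d"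
    using d I \<open>c > 0\<close> by (auto simp: \<epsilon>_def intro: divide_neg_pos)
  define J where "J = {min (z + e * \<epsilon>) (z + e * d)..max (z + e * \<epsilon>) (z + e * d)}"
  have J: "x \<in> J \<longleftrightarrow> e * (x - z) \<in> {\<epsilon>..d}" for x
    using e \<epsilon> by (auto simp: J_def min_def max_def)
  have inJ: "x \<in> A \<and> f x \<ge> c / (e * (x - z))" if "x \<in> J" for x
  proof -
    have "z + e * (e * (x - z)) = x" using e by auto
    then show ?thesis
      using bound[of "e * (x - z)"] that d \<epsilon> by (auto simp: J)
  qed
  have "((\<lambda>x. c / (e * (x - z))) has_integral (e * c * ln (e * (max (z + e * \<epsilon>) (z + e * d) - z)) -
      e * c * ln (e * (min (z + e * \<epsilon>) (z + e * d) - z)))) J"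
    unfolding J_def
  proof (rule fundamental_theorem_of_calculus)
    show "min (z + e * \<epsilon>) (z + e * d) \<le> max (z + e * \<epsilon>) (z + e * d)" by simp
    fix x assume "x \<in> {min (z + e * \<epsilon>) (z + e * d)..max (z + e * \<epsilon>) (z + e * d)}"
    then have "e * (x - z) > 0"
      using J[of x] \<epsilon> by (simp add: J_def)
    then have "((\<lambda>x. e * c * ln (e * (x - z))) has_real_derivative c / (e * (x - z))) (at x)"
      using e by (auto intro!: derivative_eq_intros)
    then show "((\<lambda>x. e * c * ln (e * (x - z))) has_vector_derivative c / (e * (x - z)))
        (at x within {min (z + e * \<epsilon>) (z + e * d)..max (z + e * \<epsilon>) (z + e * d)})"
      by (simp add: has_real_derivative_iff_has_vector_derivative has_vector_derivative_at_within)
  qed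
  moreover have "e * c * ln (e * (max (z + e * \<epsilon>) (z + e * d) - z)) -
      e * c * ln (e * (min (z + e * \<epsilon>) (z + e * d) - z)) = c * (ln d - ln \<epsilon>)"
    using e \<epsilon> by (auto simp: max_def min_def algebra_simps)
  moreover have "c * (ln d - ln \<epsilon>) = I + 1"
    using d \<open>c > 0\<close> by (simp add: \<epsilon>_def ln_mult field_simps)
  ultimately have hi: "((\<lambda>x. c / (e * (x - z))) has_integral (I + 1)) J"
    by simp
  have ai: "set_integrable lebesgue J (\<lambda>x. c / (e * (x - z)))"
    using hi \<epsilon> \<open>c > 0\<close> J by (intro nonnegative_absolutely_integrable_1) (auto simp: integrable_on_def)
  have fJ: "set_integrable lebesgue J f"
    by (rule set_integrable_subset[OF int]) (use inJ in \<open>auto simp: J_def\<close>)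
  have "I + 1 = (LINT x:J|lebesgue. c / (e * (x - z)))"
    using set_lebesgue_integral_eq_integral(2)[OF ai] integral_unique[OF hi] by simp
  also have "\<dots> \<le> (LINT x:J|lebesgue. f x)"
    by (rule set_integral_mono[OF ai fJ]) (use inJ in auto)
  also have "\<dots> \<le> I"
    unfolding I_def set_lebesgue_integral_def
    using int fJ pos inJ by (intro integral_mono) (auto simp: set_integrable_def indicator_def)
  finally show False by simp
qed

text \<open>For \<beta> \<ge> 0 the comparison function is at least 1 near \<open>s\<close>, so a
  locally bounded function qualifies. Regular points thus satisfy the same order bound as
  poles.\<close>

lemma isCont_bigo_powr:
  fixes h :: "real \<Rightarrow> real"
  assumes "isCont h s" "\<beta> \<ge> 0"
  shows "h \<in> O[at s](\<lambda>x. \<bar>x - s\<bar> powr (- \<beta>))"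
proof (rule bigoI[where c = "\<bar>h s\<bar> + 1"])
  have "\<forall>\<^sub>F x in at s. \<bar>h x\<bar> < \<bar>h s\<bar> + 1"
    using assms(1) by (intro order_tendstoD(2)[where y = "\<bar>h s\<bar>"] tendsto_rabs) (auto simp: isCont_def)
  moreover have "\<forall>\<^sub>F x in at s. dist x s < 1"
    by (auto simp: eventually_at intro!: exI[of _ 1])
  moreover have "\<forall>\<^sub>F x in at s. x \<noteq> s"
    by (auto simp: eventually_at_filter)
  ultimately show "\<forall>\<^sub>F x in at s. norm (h x) \<le> (\<bar>h s\<bar> + 1) * norm (\<bar>x - s\<bar> powr - \<beta>)"
  proof eventually_elim
    case (elim x)
    have "\<bar>x - s\<bar> powr \<beta> \<le> 1"
      using powr_mono2[of \<beta> "\<bar>x - s\<bar>" 1] assms(2) elim by (simp add: dist_real_def)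
    then have "1 \<le> \<bar>x - s\<bar> powr (- \<beta>)"
      using elim by (simp add: powr_minus one_le_inverse_iff)
    then have "(\<bar>h s\<bar> + 1) * 1 \<le> (\<bar>h s\<bar> + 1) * \<bar>x - s\<bar> powr (- \<beta>)"
      by (intro mult_left_mono) auto
    then show ?case using elim by simp
  qed
qed

text \<open>The order bound at every point gives integrability nearby, and compactness makes it
  global. The finite set \<open>S\<close> is removed so that continuity provides measurability;
  being null, it does not affect the integral.\<close>

lemma set_integrable_powr_of_bigo:
  fixes h :: "real \<Rightarrow> real"
  assumes "finite S" "continuous_on ({a..b} - S) h" "\<beta> * r < 1" "r \<ge> 0"
    and O: "\<And>s. s \<in> {a..b} \<Longrightarrow> h \<in> O[at s](\<lambda>x. \<bar>x - s\<bar> powr (- \<beta>))"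
  shows "set_integrable lebesgue {a..b} (\<lambda>x. \<bar>h x\<bar> powr r)"
proof -
  define A where "A = {a..b} - S"
  have A: "A \<in> sets lebesgue"
    using negligible_imp_sets[OF negligible_finite[OF \<open>finite S\<close>]] by (auto simp: A_def)
  have "h \<in> borel_measurable (lebesgue_on A)"
    using assms(2) A by (auto simp: A_def intro!: continuous_imp_measurable_on_sets_lebesgue)
  then have hm: "(\<lambda>x. indicator A x *\<^sub>R h x) \<in> borel_measurable lebesgue"
    using A by (simp add: borel_measurable_restrict_space_iff)
  have "set_integrable lebesgue A (\<lambda>x. \<bar>h x\<bar> powr r)"
  proof (rule set_integrable_if_locally[OF A])
    show "A \<subseteq> {a..b}" by (auto simp: A_def)
    fix s assume s: "s \<in> {a..b}"
    obtain C where C: "C > 0" "\<forall>\<^sub>F x in at s. norm (h x) \<le> C * norm (\<bar>x - s\<bar> powr (- \<beta>))"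
      using O[OF s] by (rule landau_o.bigE)
    then obtain \<delta> where \<delta>: "\<delta> > 0" "\<And>x. x \<noteq> s \<Longrightarrow> dist x s < \<delta> \<Longrightarrow> \<bar>h x\<bar> \<le> C * \<bar>x - s\<bar> powr (- \<beta>)"
      unfolding eventually_at by auto
    define B where "B = A \<inter> ball s \<delta>"
    have B: "B \<in> sets lebesgue" unfolding B_def using A by auto
    have "set_integrable lebesgue B (\<lambda>x. \<bar>h x\<bar> powr r)"
    proof (rule set_integrable_bound)
      have "set_integrable lebesgue B (\<lambda>x. \<bar>x - s\<bar> powr (- (\<beta> * r)))"
        by (rule set_integrable_subset[OF absolutely_integrable_powr_pole[OF assms(3), of a b]])
          (use B in \<open>auto simp: B_def A_def\<close>)
      then show "set_integrable lebesgue B (\<lambda>x. C powr r * \<bar>x - s\<bar> powr (- (\<beta> * r)))"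
        by simp
      have "(\<lambda>x. \<bar>indicator B x *\<^sub>R (indicator A x *\<^sub>R h x)\<bar> powr r) \<in> borel_measurable lebesgue"
        by (intro powr_real_measurable borel_measurable_abs borel_measurable_scaleR hm
            borel_measurable_indicator B borel_measurable_const)
      moreover have "\<bar>indicator B x *\<^sub>R (indicator A x *\<^sub>R h x)\<bar> powr r = indicator B x *\<^sub>R \<bar>h x\<bar> powr r" for x
        by (auto simp: indicator_def B_def)
      ultimately show "set_borel_measurable lebesgue B (\<lambda>x. \<bar>h x\<bar> powr r)"
        by (simp only: set_borel_measurable_def)
      have "AE x in lebesgue. x \<notin> {s}"
        by (intro AE_not_in) (simp flip: negligible_iff_null_sets)
      then show "AE x in lebesgue. x \<in> B \<longrightarrow> norm (\<bar>h x\<bar> powr r) \<le> norm (C powr r * \<bar>x - s\<bar> powr (- (\<beta> * r)))"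
      proof eventually_elim
        case (elim x)
        show ?case
        proof
          assume "x \<in> B"
          then have "\<bar>h x\<bar> powr r \<le> (C * \<bar>x - s\<bar> powr (- \<beta>)) powr r"
            using elim \<delta>(2)[of x] \<open>r \<ge> 0\<close> by (intro powr_mono2) (auto simp: B_def dist_commute)
          also have "\<dots> = C powr r * \<bar>x - s\<bar> powr (- (\<beta> * r))"
            using C by (simp add: powr_mult powr_powr)
          finally show "norm (\<bar>h x\<bar> powr r) \<le> norm (C powr r * \<bar>x - s\<bar> powr (- (\<beta> * r)))"
            by simp
        qed
      qed
    qed
    then show "\<exists>\<delta>>0. set_integrable lebesgue (A \<inter> ball s \<delta>) (\<lambda>x. \<bar>h x\<bar> powr r)"
      using \<delta>(1) by (auto simp: B_def)
  qed
  then show ?thesis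
    using \<open>finite S\<close>
    by (subst set_integrable_discrete_difference[where X = S and B = A])
      (auto simp: A_def countable_finite)
qed

subsection \<open>Inverting incomplete integrals\<close>

text \<open>A common frame for \<open>F1_p p q\<close>, \<open>F1_p p 1\<close> and
  \<open>F2_p p q\<close>. The integrand may vanish or be unbounded near the zeros of the cosine, so
  only local integrability is required. The lower bound by the squared cosine is shared by all three
  and suffices for \<open>F\<close> to be strictly increasing and onto.\<close>

locale amplitude =
  fixes f F :: "real \<Rightarrow> real"
  assumes borel: "f \<in> borel_measurable borel"
    and int: "\<And>a b. set_integrable lebesgue {a..b} f"
    and ge_cos: "\<And>\<theta>. (cos \<theta>)\<^sup>2 \<le> f \<theta>"
    and F_eq: "\<And>x. F x = (LBINT \<theta>=0..ereal x. f \<theta>)"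
begin

definition am :: "real \<Rightarrow> real" where "am = inv F"

lemma int_lborel: "set_integrable lborel {a..b} f"
proof -
  have "(\<lambda>x. indicator {a..b} x *\<^sub>R f x) \<in> borel_measurable lborel"
    using borel by simp
  then show ?thesis
    using int[of a b] by (simp add: set_integrable_def integrable_completion)
qed

lemma F_has_integral:
  assumes "x \<le> y"
  shows "(f has_integral (F y - F x)) {x..y}"
proof -
  have "interval_lebesgue_integrable lborel (ereal a) (ereal b) f" if "a \<le> b" for a b
  proof -
    have "set_integrable lborel {a<..<b} f"
      by (rule set_integrable_subset[OF int_lborel[of a b]]) auto
    then show ?thesis using that by (simp add: interval_lebesgue_integrable_def)
  qed
  then have "interval_lebesgue_integrable lborel (ereal (min 0 (min x y))) (ereal (max 0 (max x y))) f"
    by (simp add: min_def max_def)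
  then have "interval_lebesgue_integrable lborel (min 0 (min (ereal x) (ereal y))) (max 0 (max (ereal x) (ereal y))) f"
    by (simp add: zero_ereal_def ereal_min ereal_max del: ereal_eq_0)
  then have "F x + (LBINT \<theta>=ereal x..ereal y. f \<theta>) = F y"
    unfolding F_eq by (rule interval_integral_sum)
  then have "F y - F x = integral {x..y} f"
    using interval_integral_eq_integral[OF assms int_lborel] by simp
  moreover have "f integrable_on {x..y}"
    using int[of x y] by (rule set_lebesgue_integral_eq_integral(1))
  ultimately show ?thesis
    by (simp add: integrable_integral)
qed

lemma F_0: "F 0 = 0"
  by (simp add: F_eq zero_ereal_def[symmetric])

lemma F_cos: "x \<le> y \<Longrightarrow> integral {x..y} (\<lambda>\<theta>. (cos \<theta>)\<^sup>2) \<le> F y - F x"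
  using F_has_integral[of x y] ge_cos
  by (intro has_integral_le[OF integrable_integral]) (auto intro!: integrable_continuous_real continuous_intros)

lemma F_strict_mono: "strict_mono F"
proof (rule strict_monoI)
  fix x y :: real assume "x < y"
  have "integral {x..y} (\<lambda>\<theta>. (cos \<theta>)\<^sup>2) \<noteq> 0"
  proof
    assume "integral {x..y} (\<lambda>\<theta>. (cos \<theta>)\<^sup>2) = 0"
    then have zero: "\<forall>\<theta>\<in>{x..y}. (cos \<theta>)\<^sup>2 = 0"
      using \<open>x < y\<close> by (subst (asm) integral_eq_0_iff) (auto intro!: continuous_intros)
    \<comment> \<open>Two zeros of the cosine cannot lie at a positive distance of at most 1, which
      is less than pi; so the integral of the squared cosine is not zero.\<close>
    define z where "z = min y (x + 1)"
    have z: "x < z" "z \<le> y" "z - x \<le> 1" using \<open>x < y\<close> by (auto simp: z_def)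
    have "cos x = 0" "cos z = 0" using zero z by auto
    then have "sin (z - x) = 0" by (simp add: sin_diff)
    moreover have "sin (z - x) > 0" using z pi_gt3 by (intro sin_gt_zero) auto
    ultimately show False by simp
  qed
  moreover have "integral {x..y} (\<lambda>\<theta>. (cos \<theta>)\<^sup>2) \<ge> 0"
    by (rule integral_nonneg) (auto intro!: integrable_continuous_real continuous_intros)
  ultimately show "F x < F y"
    using F_cos[of x y] \<open>x < y\<close> by simp
qed

lemma isCont_F: "isCont F x"
proof -
  have "continuous_on {x - 1..x + 1} (\<lambda>u. F (x - 1) + integral {x - 1..u} f)"
    using F_has_integral[of "x - 1" "x + 1"]
    by (intro continuous_intros indefinite_integral_continuous_1) (auto simp: integrable_on_def)
  then have "continuous_on {x - 1..x + 1} F"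
    by (rule continuous_on_eq) (use F_has_integral[THEN integral_unique] in force)
  then show ?thesis
    by (rule continuous_on_interior) simp
qed

text \<open>The squared cosine has the antiderivative \<theta> / 2 + sin (2 \<theta>) / 4, so
  \<open>F\<close> grows at least at half the unit rate up to a bounded oscillation.\<close>

lemma F_growth: "x \<le> y \<Longrightarrow> y - x - 1 \<le> 2 * (F y - F x)"
proof -
  assume "x \<le> y"
  have "((\<lambda>\<theta>. (cos \<theta>)\<^sup>2) has_integral (y / 2 + sin (2 * y) / 4) - (x / 2 + sin (2 * x) / 4)) {x..y}"
  proof (rule fundamental_theorem_of_calculus[OF \<open>x \<le> y\<close>])
    fix \<theta>
    have "((\<lambda>\<theta>. \<theta> / 2 + sin (2 * \<theta>) / 4) has_real_derivative 1 / 2 + cos (2 * \<theta>) * 2 / 4) (at \<theta>)"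
      by (auto intro!: derivative_eq_intros)
    also have "1 / 2 + cos (2 * \<theta>) * 2 / 4 = (cos \<theta>)\<^sup>2"
      unfolding cos_double_cos by (simp add: field_simps)
    finally have "((\<lambda>\<theta>. \<theta> / 2 + sin (2 * \<theta>) / 4) has_real_derivative (cos \<theta>)\<^sup>2) (at \<theta>)" .
    then show "((\<lambda>\<theta>. \<theta> / 2 + sin (2 * \<theta>) / 4) has_vector_derivative (cos \<theta>)\<^sup>2) (at \<theta> within {x..y})"
      by (simp add: has_real_derivative_iff_has_vector_derivative has_vector_derivative_at_within)
  qed
  then have "integral {x..y} (\<lambda>\<theta>. (cos \<theta>)\<^sup>2) = (y / 2 + sin (2 * y) / 4) - (x / 2 + sin (2 * x) / 4)"
    by (rule integral_unique)
  then have "4 * integral {x..y} (\<lambda>\<theta>. (cos \<theta>)\<^sup>2) = 2 * (y - x) + (sin (2 * y) - sin (2 * x))"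
    by simp
  moreover have "- 2 \<le> sin (2 * y) - sin (2 * x)"
    using add_mono[OF sin_ge_minus_one[of "2 * y"] sin_ge_minus_one[of "- (2 * x)"]] by simp
  moreover have "4 * integral {x..y} (\<lambda>\<theta>. (cos \<theta>)\<^sup>2) \<le> 4 * (F y - F x)"
    using F_cos[OF \<open>x \<le> y\<close>] by simp
  ultimately show ?thesis by simp
qed

lemma F_surj: "surj F"
proof -
  have "\<exists>x. F x = c" for c
  proof -
    \<comment> \<open>The subtracted 1 and the factor 2 in \<open>F_growth\<close> make
      \<open>F d \<ge> \<bar>c\<bar>\<close> for this choice.\<close>
    define d where "d = 2 * \<bar>c\<bar> + 1"
    have d: "- d \<le> 0" "0 \<le> d" "- d \<le> d" by (auto simp: d_def)
    have "F (- d) \<le> - \<bar>c\<bar>" "\<bar>c\<bar> \<le> F d"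
      using F_growth[OF d(1)] F_growth[OF d(2)] by (auto simp: F_0 d_def)
    then have "F (- d) \<le> c" "c \<le> F d" by auto
    moreover have "continuous_on {- d..d} F"
      using isCont_F by (auto intro!: continuous_at_imp_continuous_on)
    ultimately show ?thesis
      using IVT'[of F "- d" c d] d by blast
  qed
  then show ?thesis by (auto simp: surj_def eq_commute)
qed

lemma F_am [simp]: "F (am x) = x"
  unfolding am_def by (rule surj_f_inv_f[OF F_surj])

lemma am_F [simp]: "am (F \<theta>) = \<theta>"
  unfolding am_def by (rule inv_f_f[OF strict_mono_imp_inj_on[OF F_strict_mono]])

lemma am_less_iff: "am x < am y \<longleftrightarrow> x < y"
  using strict_mono_less[OF F_strict_mono, of "am x" "am y"] by simp

lemma am_eq_iff: "am x = am y \<longleftrightarrow> x = y"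
  by (metis F_am)

lemma isCont_am: "isCont am x"
  using isCont_inverse_function[of 1 "am x" am F] isCont_F by simp

lemma continuous_on_am: "continuous_on A am"
  by (simp add: continuous_at_imp_continuous_on isCont_am)

lemma F_has_derivative:
  assumes "isCont f \<theta>"
  shows "(F has_real_derivative f \<theta>) (at \<theta>)"
proof -
  have "((\<lambda>u. integral {\<theta> - 1..u} f) has_vector_derivative f \<theta>) (at \<theta> within {\<theta> - 1..\<theta> + 1} - {})"
    using assms F_has_integral[of "\<theta> - 1" "\<theta> + 1"]
    by (intro integral_has_vector_derivative_continuous_at)
      (auto simp: integrable_on_def continuous_at_imp_continuous_at_within)
  moreover have "at \<theta> within {\<theta> - 1..\<theta> + 1} = at \<theta>"
    by (rule at_within_interior) simp
  ultimately have d: "((\<lambda>u. F (\<theta> - 1) + integral {\<theta> - 1..u} f) has_real_derivative 0 + f \<theta>) (at \<theta>)"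
    by (intro DERIV_add) (auto simp: has_real_derivative_iff_has_vector_derivative)
  have ev: "\<forall>\<^sub>F u in nhds \<theta>. F (\<theta> - 1) + integral {\<theta> - 1..u} f = F u"
    using eventually_nhds_in_open[of "{\<theta> - 1<..}" \<theta>]
    by (auto elim!: eventually_mono simp: integral_unique[OF F_has_integral])
  show ?thesis
    by (rule DERIV_cong_ev[OF refl ev add_0_left, THEN iffD1, OF d])
qed

lemma am_has_derivative:
  assumes "isCont f (am x)" "f (am x) \<noteq> 0"
  shows "(am has_real_derivative inverse (f (am x))) (at x)"
  by (rule DERIV_inverse_function[where f = F and g = am and a = "x - 1" and b = "x + 1",
        OF F_has_derivative[OF assms(1)] assms(2)])
    (auto simp: isCont_am)

end

lemma finite_cos_zeros: "finite {\<theta>. cos \<theta> = 0 \<and> a \<le> \<theta> \<and> \<theta> \<le> (b::real)}"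
proof -
  have "{\<theta>. cos \<theta> = 0 \<and> a \<le> \<theta> \<and> \<theta> \<le> b} \<subseteq> (\<lambda>i. of_int i * (pi / 2)) ` {\<lfloor>a / (pi / 2)\<rfloor>..\<lceil>b / (pi / 2)\<rceil>}"
  proof
    fix \<theta> assume \<theta>: "\<theta> \<in> {\<theta>. cos \<theta> = 0 \<and> a \<le> \<theta> \<and> \<theta> \<le> b}"
    then obtain i where i: "\<theta> = of_int i * (pi / 2)"
      by (auto simp: cos_zero_iff_int)
    then have "a / (pi / 2) \<le> of_int i" "of_int i \<le> b / (pi / 2)"
      using \<theta> pi_gt_zero by (auto simp: field_simps)
    then have "i \<in> {\<lfloor>a / (pi / 2)\<rfloor>..\<lceil>b / (pi / 2)\<rceil>}"
      by (auto simp: floor_le_iff le_ceiling_iff)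
    then show "\<theta> \<in> (\<lambda>i. of_int i * (pi / 2)) ` {\<lfloor>a / (pi / 2)\<rfloor>..\<lceil>b / (pi / 2)\<rceil>}"
      using i by blast
  qed
  then show ?thesis by (rule finite_subset) simp
qed

lemma (in amplitude) finite_cos_am_zeros: "finite {x. cos (am x) = 0 \<and> a \<le> x \<and> x \<le> b}"
proof -
  have "am ` {x. cos (am x) = 0 \<and> a \<le> x \<and> x \<le> b} \<subseteq> {\<theta>. cos \<theta> = 0 \<and> am a \<le> \<theta> \<and> \<theta> \<le> am b}"
    using am_less_iff by (auto simp: not_less[symmetric])
  then have "finite (am ` {x. cos (am x) = 0 \<and> a \<le> x \<and> x \<le> b})"
    by (rule finite_subset[OF _ finite_cos_zeros])
  then show ?thesis
    by (rule finite_imageD) (simp add: inj_on_def am_eq_iff)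
qed

lemma has_derivative_abs_powr_times:
  fixes u :: real
  assumes "u \<noteq> 0"
  shows "((\<lambda>u. \<bar>u\<bar> powr e * u) has_real_derivative (e + 1) * \<bar>u\<bar> powr e) (at u)"
proof (cases "u > 0")
  case True
  have "((\<lambda>u. u powr (e + 1)) has_real_derivative (e + 1) * \<bar>u\<bar> powr e) (at u)"
    using has_real_derivative_powr[OF True, of "e + 1"] True by simp
  moreover have "\<forall>\<^sub>F v in nhds u. v powr (e + 1) = \<bar>v\<bar> powr e * v"
    using order_tendstoD(1)[OF filterlim_ident True] by eventually_elim (simp add: powr_add)
  ultimately show ?thesis
    using DERIV_cong_ev[OF refl _ refl] by fast
next
  case False
  then have neg: "u < 0" using assms by simp
  have "((\<lambda>v. v powr (e + 1)) has_real_derivative (e + 1) * \<bar>u\<bar> powr e) (at (- u))"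
    using has_real_derivative_powr[of "- u" "e + 1"] neg by simp
  then have "((\<lambda>u. (- u) powr (e + 1)) has_real_derivative (e + 1) * \<bar>u\<bar> powr e * (- 1)) (at u)"
    by (rule DERIV_chain2) (auto intro!: derivative_eq_intros)
  from DERIV_minus[OF this]
  have "((\<lambda>u. - ((- u) powr (e + 1))) has_real_derivative (e + 1) * \<bar>u\<bar> powr e) (at u)"
    by simp
  moreover have "\<forall>\<^sub>F v in nhds u. - ((- v) powr (e + 1)) = \<bar>v\<bar> powr e * v"
    using order_tendstoD(2)[OF filterlim_ident neg] by eventually_elim (simp add: powr_add)
  ultimately show ?thesis
    using DERIV_cong_ev[OF refl _ refl] by fast
qed

lemma continuous_on_abs_powr_times:
  assumes "e > - 1"
  shows "continuous_on A (\<lambda>u::real. \<bar>u\<bar> powr e * u)"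
proof -
  have eq: "(\<lambda>u::real. \<bar>u\<bar> powr e * u) = (\<lambda>u. max 0 u powr (e + 1) - max 0 (- u) powr (e + 1))"
    by (auto simp: fun_eq_iff max_def powr_add)
  show ?thesis
    unfolding eq using assms by (intro continuous_intros continuous_on_powr') auto
qed

text \<open>A simple zero of \<open>u\<close> at \<open>s\<close> makes its powers, of either sign,
  of exact order \<open>\<bar>x - s\<bar> powr e\<close>. Every asymptotic expansion below rests on
  this.\<close>

lemma tendsto_powr_quotient:
  fixes u :: "real \<Rightarrow> real"
  assumes "((\<lambda>x. u x / (x - s)) \<longlongrightarrow> l) (at s within A)" "l \<noteq> 0"
  shows "((\<lambda>x. \<bar>u x\<bar> powr e * \<bar>x - s\<bar> powr (- e)) \<longlongrightarrow> \<bar>l\<bar> powr e) (at s within A)"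
proof -
  have "((\<lambda>x. \<bar>u x / (x - s)\<bar> powr e) \<longlongrightarrow> \<bar>l\<bar> powr e) (at s within A)"
    using assms by (intro tendsto_powr tendsto_rabs tendsto_const) auto
  moreover have "\<bar>u x / (x - s)\<bar> powr e = \<bar>u x\<bar> powr e * \<bar>x - s\<bar> powr (- e)" for x
    by (simp only: abs_divide powr_divide powr_minus_divide times_divide_eq_right mult_1_right)
  ultimately show ?thesis by simp
qed

lemma continuous_on_UNIV_tendsto:
  "continuous_on UNIV h \<Longrightarrow> (h \<longlongrightarrow> h a) (at a within S)"
  unfolding continuous_on_def by (metis UNIV_I subset_UNIV tendsto_within_subset)

lemma cos_sq_le_powr:
  fixes \<theta> e :: real
  assumes "e \<le> 2"
  shows "(cos \<theta>)\<^sup>2 \<le> \<bar>cos \<theta>\<bar> powr e"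
proof (cases "cos \<theta> = 0")
  case False
  have "(cos \<theta>)\<^sup>2 = \<bar>cos \<theta>\<bar> powr 2"
    using False by (simp add: powr_numeral)
  also have "\<dots> \<le> \<bar>cos \<theta>\<bar> powr e"
    using assms by (intro powr_mono') auto
  finally show ?thesis .
next
  case True
  then show ?thesis by simp
qed

lemma cos_quotient_tendsto:
  assumes "cos s = 0"
  shows "((\<lambda>x. cos x / (x - s)) \<longlongrightarrow> - sin s) (at (s::real))"
  using DERIV_cos[of s] assms by (simp add: has_field_derivative_iff)

subsection \<open>The wavelike case\<close>

locale wave =
  fixes p q :: real
  assumes p: "p > 2" and q: "0 < q" "q < 1"
begin

definition w :: "real \<Rightarrow> real" where "w \<theta> = sqrt (1 - q\<^sup>2 * (sin \<theta>)\<^sup>2)"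

lemma radicand_pos: "1 - q\<^sup>2 * (sin \<theta>)\<^sup>2 > 0"
proof -
  have "q\<^sup>2 * (sin \<theta>)\<^sup>2 \<le> q\<^sup>2 * 1"
    by (intro mult_left_mono) (auto simp: abs_square_le_1)
  moreover have "q\<^sup>2 < 1"
    using q by (simp add: power_less_one_iff)
  ultimately show ?thesis by simp
qed

lemma w_pos: "w \<theta> > 0"
  using radicand_pos by (simp add: w_def)

lemma w_le_1: "w \<theta> \<le> 1"
  by (simp add: w_def)

lemma continuous_on_w: "continuous_on A w"
  unfolding w_def by (intro continuous_intros)

definition integrand :: "real \<Rightarrow> real" where
  "integrand \<theta> = \<bar>cos \<theta>\<bar> powr (1 - 2 / p) / w \<theta>"

lemma isCont_integrand: "isCont integrand \<theta>"
proof -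
  have "continuous_on UNIV integrand"
    unfolding integrand_def using w_pos p
    by (intro continuous_intros continuous_on_powr' continuous_on_w) (auto simp: less_imp_neq[symmetric])
  then show ?thesis by (simp add: continuous_on_eq_continuous_at)
qed

sublocale amplitude integrand "F1_p p q"
proof
  show "integrand \<in> borel_measurable borel"
    by (intro borel_measurable_continuous_onI) (simp add: continuous_at_imp_continuous_on isCont_integrand)
  show "set_integrable lebesgue {a..b} integrand" for a b
    by (intro absolutely_integrable_continuous_real) (simp add: continuous_at_imp_continuous_on isCont_integrand)
  show "(cos \<theta>)\<^sup>2 \<le> integrand \<theta>" for \<theta>
  proof -
    have "(cos \<theta>)\<^sup>2 \<le> \<bar>cos \<theta>\<bar> powr (1 - 2 / p)"
      using p by (intro cos_sq_le_powr) (auto simp: field_simps)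
    also have "\<dots> \<le> integrand \<theta>"
      using w_pos[of \<theta>] w_le_1[of \<theta>] mult_left_mono[of "w \<theta>" 1 "\<bar>cos \<theta>\<bar> powr (1 - 2 / p)"]
      by (simp add: integrand_def pos_le_divide_eq)
    finally show ?thesis .
  qed
  show "F1_p p q x = (LBINT \<theta>=0..ereal x. integrand \<theta>)" for x
    using q by (simp add: F1_p_def integrand_def w_def)
qed

lemma am_eq: "am1_p p q = am"
  by (simp add: am1_p_def am_def)

text \<open>The derivative of \<open>cn_p\<close> off its zeros. The exponent 4 / p - 2 is negative,
  which is the source of the pole; at the zeros themselves the value is 0 by the convention on
  \<open>powr\<close>.\<close>

definition cn' :: "real \<Rightarrow> real" where
  "cn' x = - (2 / p) * sin (am x) * w (am x) * \<bar>cos (am x)\<bar> powr (4 / p - 2)"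

lemma cn_eq: "cn_p p x q = \<bar>cos (am x)\<bar> powr (2 / p - 1) * cos (am x)"
  by (simp add: cn_p_def am_eq)

lemma continuous_on_cn: "continuous_on A (\<lambda>x. cn_p p x q)"
  unfolding cn_eq using p
  by (intro continuous_on_compose2[OF continuous_on_abs_powr_times[of "2 / p - 1" UNIV]]
      continuous_intros continuous_on_am) auto

lemma cn_eq_0_iff: "cn_p p x q = 0 \<longleftrightarrow> cos (am x) = 0"
  by (simp add: cn_eq)

text \<open>The derivative of \<open>am\<close> is \<open>w\<close> divided by \<bar>cos\<bar> to
  the power 1 - 2 / p, which lowers the exponent by that amount. For e = 2 / p - 1 the function is
  \<open>cn_p\<close>; for e = 1 - 2 / p the powers of the cosine cancel in the derivative.\<close>

lemma abs_powr_cos_has_derivative: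
  assumes "cos (am x) \<noteq> 0"
  shows "((\<lambda>x. \<bar>cos (am x)\<bar> powr e * cos (am x)) has_real_derivative
    - (e + 1) * sin (am x) * w (am x) * \<bar>cos (am x)\<bar> powr (e - (1 - 2 / p))) (at x)"
proof -
  have "integrand (am x) \<noteq> 0"
    using assms w_pos[of "am x"] by (simp add: integrand_def)
  from am_has_derivative[OF isCont_integrand this]
  have "((\<lambda>x. cos (am x)) has_real_derivative - sin (am x) * inverse (integrand (am x))) (at x)"
    by (rule DERIV_chain2[OF DERIV_cos])
  from DERIV_chain2[OF has_derivative_abs_powr_times[OF assms] this]
  show ?thesis
    by (rule DERIV_cong) (simp only: integrand_def powr_diff[of _ e "1 - 2 / p"] inverse_divide, simp add: divide_inverse algebra_simps)
qed

lemma cn_has_derivative: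
  "cos (am x) \<noteq> 0 \<Longrightarrow> ((\<lambda>x. cn_p p x q) has_real_derivative cn' x) (at x)"
  using abs_powr_cos_has_derivative[of x "2 / p - 1"] by (simp add: cn_eq cn'_def)

lemma isCont_cn': "cos (am x) \<noteq> 0 \<Longrightarrow> isCont cn' x"
  unfolding cn'_def
  by (intro continuous_intros isCont_am isCont_o2[OF isCont_am] continuous_on_interior[OF continuous_on_w, of _ UNIV])
    auto

text \<open>The exponent in \<open>Y\<close> is the one for which \<open>Y'\<close> contains no
  power of the cosine, so \<open>Y\<close> has a simple zero at \<open>z\<close>. Since (2 - 2 / p)
  \<beta> = 2 - 4 / p, the singular factor of \<open>cn'\<close> is
  \<open>\<bar>Y x\<bar> powr (- \<beta>)\<close>, and the order of the pole can be read
  off.\<close>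

lemma cn'_tendsto:
  assumes zero: "cos (am z) = 0"
  obtains l where "l \<noteq> 0" "((\<lambda>x. cn' x * \<bar>x - z\<bar> powr ((p - 2) / (p - 1))) \<longlongrightarrow> l) (at z)"
proof -
  define \<beta> where "\<beta> = (p - 2) / (p - 1)"
  define Y where "Y x = \<bar>cos (am x)\<bar> powr (1 - 2 / p) * cos (am x)" for x
  define Y' where "Y' x = - (2 - 2 / p) * sin (am x) * w (am x)" for x
  have cont: "continuous_on A Y'" for A
    unfolding Y'_def
    by (intro continuous_intros continuous_on_am continuous_on_compose2[OF continuous_on_w[of UNIV]]) auto
  have sin: "sin (am z) \<noteq> 0"
    using sin_cos_squared_add[of "am z"] zero by auto
  have Y'z: "Y' z \<noteq> 0"
    using sin w_pos[of "am z"] p by (auto simp: Y'_def field_simps)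
  have ev: "\<forall>\<^sub>F x in at z. cos (am x) \<noteq> 0"
  proof -
    obtain d where d: "d > 0" "\<forall>x\<in>{x. cos (am x) = 0 \<and> z - 1 \<le> x \<and> x \<le> z + 1}. x \<noteq> z \<longrightarrow> d \<le> dist z x"
      using finite_set_avoid[OF finite_cos_am_zeros[of "z - 1" "z + 1"], of z] by blast
    show ?thesis
      unfolding eventually_at
    proof (intro exI[of _ "min d 1"] conjI ballI impI)
      fix x assume x: "x \<noteq> z \<and> dist x z < min d 1"
      show "cos (am x) \<noteq> 0"
      proof
        assume "cos (am x) = 0"
        moreover have "z - 1 \<le> x" "x \<le> z + 1" using x by (auto simp: dist_real_def)
        ultimately show False using d(2) x by (auto simp: dist_commute)
      qed
    qed (use d in auto)
  qed
  \<comment> \<open>At \<open>z\<close> the integrand is zero, so the derivative rule for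
    \<open>am\<close> does not apply there; the slope of \<open>Y\<close> is obtained as the limit
    of \<open>Y'\<close> by L'Hospital's rule.\<close>
  have "((\<lambda>x. Y x / (x - z)) \<longlongrightarrow> Y' z) (at z)"
  proof (rule lhopital[where f' = Y' and g' = "\<lambda>_. 1"])
    have "continuous_on UNIV Y"
      unfolding Y_def using p
      by (intro continuous_on_compose2[OF continuous_on_abs_powr_times[of "1 - 2 / p" UNIV]]
          continuous_intros continuous_on_am) (auto simp: field_simps)
    then have "(Y \<longlongrightarrow> Y z) (at z)"
      by (simp add: continuous_on_eq_continuous_at isCont_def)
    then show "(Y \<longlongrightarrow> 0) (at z)" using zero by (simp add: Y_def)
    show "((\<lambda>x. x - z) \<longlongrightarrow> 0) (at z)" by (auto intro!: tendsto_eq_intros)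
    show "\<forall>\<^sub>F x in at z. x - z \<noteq> 0" by (simp add: eventually_at_filter)
    show "\<forall>\<^sub>F x in at z. DERIV Y x :> Y' x"
      using ev
    proof eventually_elim
      case (elim x)
      show ?case
        using abs_powr_cos_has_derivative[OF elim, of "1 - 2 / p"] elim by (simp add: Y_def[abs_def] Y'_def)
    qed
    show "\<forall>\<^sub>F x in at z. DERIV (\<lambda>x. x - z) x :> 1"
      by (auto intro!: always_eventually derivative_eq_intros)
    have "isCont Y' z"
      using cont[of UNIV] by (simp add: continuous_on_eq_continuous_at)
    then show "((\<lambda>x. Y' x / 1) \<longlongrightarrow> Y' z) (at z)" by (simp add: isCont_def)
  qed simp
  from tendsto_powr_quotient[OF this Y'z, of "- \<beta>"]
  have lim: "((\<lambda>x. \<bar>Y x\<bar> powr (- \<beta>) * \<bar>x - z\<bar> powr \<beta>) \<longlongrightarrow> \<bar>Y' z\<bar> powr (- \<beta>)) (at z)"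
    by simp
  have "isCont (\<lambda>x. - (2 / p) * sin (am x) * w (am x)) z"
    by (intro continuous_intros isCont_am isCont_o2[OF isCont_am] continuous_on_interior[OF continuous_on_w, of _ UNIV]) auto
  then have "((\<lambda>x. - (2 / p) * sin (am x) * w (am x)) \<longlongrightarrow> - (2 / p) * sin (am z) * w (am z)) (at z)"
    by (simp add: isCont_def)
  from tendsto_mult[OF this lim]
  have "((\<lambda>x. - (2 / p) * sin (am x) * w (am x) * (\<bar>Y x\<bar> powr (- \<beta>) * \<bar>x - z\<bar> powr \<beta>))
      \<longlongrightarrow> - (2 / p) * sin (am z) * w (am z) * \<bar>Y' z\<bar> powr (- \<beta>)) (at z)" .
  moreover have eq: "- (2 / p) * sin (am x) * w (am x) * (\<bar>Y x\<bar> powr (- \<beta>) * \<bar>x - z\<bar> powr \<beta>) = cn' x * \<bar>x - z\<bar> powr \<beta>" for x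
  proof -
    have "\<bar>Y x\<bar> = \<bar>cos (am x)\<bar> powr (2 - 2 / p)"
    proof -
      have "\<bar>Y x\<bar> = \<bar>cos (am x)\<bar> powr (1 - 2 / p) * \<bar>cos (am x)\<bar> powr 1"
        by (simp add: Y_def abs_mult)
      also have "\<dots> = \<bar>cos (am x)\<bar> powr (1 - 2 / p + 1)"
        by (rule powr_add[symmetric])
      finally show ?thesis by (simp add: algebra_simps)
    qed
    then have "\<bar>Y x\<bar> powr (- \<beta>) = \<bar>cos (am x)\<bar> powr ((2 - 2 / p) * (- \<beta>))"
      by (simp add: powr_powr)
    also have "(2 - 2 / p) * (- \<beta>) = 4 / p - 2"
      using p by (simp add: \<beta>_def field_simps)
    finally show ?thesis by (simp add: cn'_def)
  qed
  ultimately have "((\<lambda>x. cn' x * \<bar>x - z\<bar> powr \<beta>) \<longlongrightarrow>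
      - (2 / p) * sin (am z) * w (am z) * \<bar>Y' z\<bar> powr (- \<beta>)) (at z)"
    by (simp only: eq)
  moreover have "- (2 / p) * sin (am z) * w (am z) * \<bar>Y' z\<bar> powr (- \<beta>) \<noteq> 0"
    using p sin w_pos[of "am z"] Y'z by simp
  ultimately show ?thesis
    using that unfolding \<beta>_def by blast
qed

end

subsection \<open>The flat-core case\<close>

locale flat =
  fixes p :: real
  assumes p: "p > 2"
begin

definition integrand :: "real \<Rightarrow> real" where
  "integrand \<theta> = \<bar>cos \<theta>\<bar> powr (- 2 / p)"

lemma isCont_integrand: "cos \<theta> \<noteq> 0 \<Longrightarrow> isCont integrand \<theta>"
  unfolding integrand_def by (intro continuous_intros) auto

text \<open>The zeros of the cosine are simple and hence become poles of order 2 / p, which is below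
  1 because p > 2. This is why \<open>F1_p p 1\<close> is finite across them and
  \<open>K_p1 p\<close> is the half-length of a loop.\<close>

lemma int_integrand: "set_integrable lebesgue {a..b} integrand"
proof -
  have "set_integrable lebesgue {a..b} (\<lambda>x. \<bar>integrand x\<bar> powr 1)"
  proof (rule set_integrable_powr_of_bigo[where \<beta> = "2 / p"])
    show "finite {\<theta>. cos \<theta> = 0 \<and> a \<le> \<theta> \<and> \<theta> \<le> b}" by (rule finite_cos_zeros)
    show "continuous_on ({a..b} - {\<theta>. cos \<theta> = 0 \<and> a \<le> \<theta> \<and> \<theta> \<le> b}) integrand"
      by (intro continuous_at_imp_continuous_on) (auto intro: isCont_integrand)
    show "2 / p * 1 < 1" using p by simp
    show "integrand \<in> O[at s](\<lambda>x. \<bar>x - s\<bar> powr - (2 / p))" for s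
    proof (cases "cos s = 0")
      case True
      have "sin s \<noteq> 0"
        using sin_cos_squared_add[of s] True by auto
      then have "((\<lambda>x. \<bar>cos x\<bar> powr (- 2 / p) * \<bar>x - s\<bar> powr - (- 2 / p)) \<longlongrightarrow> \<bar>- sin s\<bar> powr (- 2 / p)) (at s)"
        by (intro tendsto_powr_quotient cos_quotient_tendsto True) auto
      moreover have "\<bar>cos x\<bar> powr (- 2 / p) * \<bar>x - s\<bar> powr - (- 2 / p) = integrand x / \<bar>x - s\<bar> powr - (2 / p)" for x
        by (simp add: integrand_def powr_minus divide_inverse)
      ultimately have "((\<lambda>x. integrand x / \<bar>x - s\<bar> powr - (2 / p)) \<longlongrightarrow> \<bar>- sin s\<bar> powr (- 2 / p)) (at s)"
        by simp
      then show ?thesis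
        by (rule bigoI_tendsto) (auto simp: eventually_at_filter)
    next
      case False
      then show ?thesis
        using p by (intro isCont_bigo_powr isCont_integrand) auto
    qed
  qed simp
  moreover have "(\<lambda>x. \<bar>integrand x\<bar> powr 1) = integrand"
    by (simp add: integrand_def fun_eq_iff)
  ultimately show ?thesis by simp
qed

sublocale amplitude integrand "F1_p p 1"
proof
  show "integrand \<in> borel_measurable borel"
    unfolding integrand_def
    by (intro powr_real_measurable borel_measurable_abs borel_measurable_const borel_measurable_continuous_onI)
      (intro continuous_intros)
  show "(cos \<theta>)\<^sup>2 \<le> integrand \<theta>" for \<theta>
    unfolding integrand_def using p by (intro cos_sq_le_powr) (auto simp: field_simps)
qed (simp_all add: int_integrand F1_p_def integrand_def)

abbreviation "K \<equiv> K_p1 p"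

lemma F_pi_half: "F1_p p 1 (pi / 2) = K"
  unfolding F_eq K_p1_def integrand_def
  by (rule interval_integral_cong) (auto simp: cos_ge_zero einterval_iff min_def max_def zero_ereal_def split: if_splits)

lemma F_minus: "F1_p p 1 (- x) = - F1_p p 1 x"
proof -
  have "(LBINT \<theta>=0..ereal (- x). integrand \<theta>) = (LBINT \<theta>=- ereal (- x)..- 0. integrand (- \<theta>))"
    by (rule interval_integral_reflect)
  also have "\<dots> = (LBINT \<theta>=ereal x..0. integrand \<theta>)"
    by (simp add: integrand_def)
  also have "\<dots> = - (LBINT \<theta>=0..ereal x. integrand \<theta>)"
    by (rule interval_integral_endpoints_reverse)
  finally show ?thesis by (simp add: F_eq)
qed

lemma am_K: "am K = pi / 2" "am (- K) = - (pi / 2)"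
  using am_F[of "pi / 2"] am_F[of "- (pi / 2)"] by (simp_all only: F_minus F_pi_half)

lemma K_pos: "K > 0"
  using strict_mono_less[OF F_strict_mono, of 0 "pi / 2"] by (simp add: F_0 F_pi_half)

text \<open>The amplitude frozen at its values pi / 2 and - pi / 2 beyond the ends of the loop. The
  cosine is then 0 outside, so the loop and its extension by zero are given by one formula.\<close>

definition A :: "real \<Rightarrow> real" where "A x = am (max (- K) (min K x))"

lemma continuous_on_A: "continuous_on S A"
  unfolding A_def by (intro continuous_on_compose2[OF continuous_on_am[of UNIV]] continuous_intros) auto

lemma A_eq: "\<bar>x\<bar> \<le> K \<Longrightarrow> A x = am x"
  by (auto simp: A_def max_def min_def)

lemma A_inside: "\<bar>x\<bar> < K \<Longrightarrow> \<bar>A x\<bar> < pi / 2"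
  using am_less_iff[of x K] am_less_iff[of "- K" x] by (auto simp: A_eq am_K)

lemma cos_A_pos: "\<bar>x\<bar> < K \<Longrightarrow> cos (A x) > 0"
  using A_inside[of x] by (intro cos_gt_zero_pi) auto

lemma cos_A_outside: "K \<le> \<bar>x\<bar> \<Longrightarrow> cos (A x) = 0"
proof -
  assume "K \<le> \<bar>x\<bar>"
  then have "max (- K) (min K x) = K \<or> max (- K) (min K x) = - K"
    using K_pos by auto
  then show ?thesis by (auto simp: A_def am_K)
qed

text \<open>The derivative of a power of \<open>cos (A x)\<close> with exponent \<open>b\<close>
  contains the cosine to the power b - 1 + 2 / p; this exponent is 0 for the present
  \<open>b\<close>. Then \<alpha> is determined by b \<alpha> = 2 / p, the exponent of the cosine in
  \<open>sech_p\<close>.\<close>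

definition b :: real where "b = 1 - 2 / p"
definition \<alpha> :: real where "\<alpha> = 2 / (p - 2)"

lemma b_pos: "b > 0" and \<alpha>_pos: "\<alpha> > 0" and b_\<alpha>: "b * \<alpha> = 2 / p"
  using p by (auto simp: b_def \<alpha>_def field_simps)

definition g :: "real \<Rightarrow> real" where "g x = cos (A x) powr b"

lemma g_pos: "\<bar>x\<bar> < K \<Longrightarrow> g x > 0"
  using cos_A_pos[of x] by (simp add: g_def)

lemma g_outside: "K \<le> \<bar>x\<bar> \<Longrightarrow> g x = 0"
  by (simp add: g_def cos_A_outside)

lemma g_nonneg: "g x \<ge> 0"
  by (simp add: g_def)

lemma continuous_on_g: "continuous_on S g"
proof -
  have "0 \<le> cos (A x)" for x
    using cos_A_pos[of x] cos_A_outside[of x] by (cases "\<bar>x\<bar> < K") auto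
  then show ?thesis
    unfolding g_def using b_pos by (intro continuous_on_powr' continuous_intros continuous_on_A) auto
qed

lemma eventually_inside: "\<bar>x\<bar> < K \<Longrightarrow> \<forall>\<^sub>F y in nhds x. \<bar>y\<bar> < K"
  using order_tendstoD(2)[OF tendsto_rabs[OF filterlim_ident]] by blast

lemma A_has_derivative:
  assumes "\<bar>x\<bar> < K"
  shows "(A has_real_derivative cos (A x) powr (2 / p)) (at x)"
proof -
  have "cos (am x) > 0" using cos_A_pos[OF assms] assms by (simp add: A_eq)
  then have "(am has_real_derivative inverse (integrand (am x))) (at x)"
    by (intro am_has_derivative isCont_integrand) (auto simp: integrand_def)
  also have "inverse (integrand (am x)) = cos (A x) powr (2 / p)"
    using assms \<open>cos (am x) > 0\<close> by (simp add: A_eq integrand_def powr_minus)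
  finally have d: "(am has_real_derivative cos (A x) powr (2 / p)) (at x)" .
  have ev: "\<forall>\<^sub>F y in nhds x. am y = A y"
    using eventually_inside[OF assms] by eventually_elim (simp add: A_eq)
  show ?thesis
    by (rule DERIV_cong_ev[OF refl ev refl, THEN iffD1, OF d])
qed

lemma g_has_derivative:
  assumes "\<bar>x\<bar> < K"
  shows "(g has_real_derivative - b * sin (A x)) (at x)"
proof -
  note pos = cos_A_pos[OF assms]
  have "((\<lambda>x. cos (A x)) has_real_derivative - sin (A x) * cos (A x) powr (2 / p)) (at x)"
    by (rule DERIV_chain2[OF DERIV_cos A_has_derivative[OF assms]])
  from DERIV_chain2[OF has_real_derivative_powr[OF pos, of b] this]
  have "(g has_real_derivative b * cos (A x) powr (b - 1) * (- sin (A x) * cos (A x) powr (2 / p))) (at x)"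
    by (simp add: g_def[abs_def])
  also have "b * cos (A x) powr (b - 1) * (- sin (A x) * cos (A x) powr (2 / p)) =
      - b * sin (A x) * (cos (A x) powr (b - 1) * cos (A x) powr (2 / p))"
    by simp
  also have "cos (A x) powr (b - 1) * cos (A x) powr (2 / p) = 1"
    using pos by (simp add: b_def flip: powr_add)
  finally show ?thesis by simp
qed

text \<open>\<open>sech_p = g powr \<alpha>\<close> on the loop, \<open>g' = - b sin A\<close> and \<open>(sin A)' = (1 - sin\<^sup>2 A) / g\<close>;
  so the derivatives of \<open>sech_p\<close> are \<open>g powr (\<alpha> - j)\<close> times polynomials in \<open>sin A\<close>.\<close>

primrec P :: "nat \<Rightarrow> real poly" where
  "P 0 = 1"
| "P (Suc j) = smult (- (b * (\<alpha> - real j))) ([:0, 1:] * P j) + [:1, 0, - 1:] * pderiv (P j)"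

text \<open>Since \<open>0 powr a = 0\<close> for every \<open>a\<close>, this is 0 outside the open
  loop even when \<alpha> - j is zero or negative, in agreement with the derivatives of the
  extension by zero.\<close>

definition f :: "nat \<Rightarrow> real \<Rightarrow> real" where
  "f j x = g x powr (\<alpha> - real j) * poly (P j) (sin (A x))"

lemma f_outside: "K \<le> \<bar>x\<bar> \<Longrightarrow> f j x = 0"
  by (simp add: f_def g_outside)

lemma f_0: "f 0 x = sech_p p x"
proof (cases "\<bar>x\<bar> < K")
  case True
  then have "cos (am x) > 0" using cos_A_pos[of x] by (simp add: A_eq)
  moreover have "cn_p p x 1 = \<bar>cos (am x)\<bar> powr (2 / p - 1) * cos (am x)"
    by (simp add: cn_p_def am1_p_def am_def)
  moreover have "cos (am x) powr (2 / p) = cos (am x) powr (2 / p - 1) * cos (am x)"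
    using powr_add[of "cos (am x)" "2 / p - 1" 1] \<open>cos (am x) > 0\<close> by simp
  ultimately show ?thesis
    using True by (simp add: f_def g_def sech_p_def A_eq powr_powr b_\<alpha>)
qed (simp add: f_outside sech_p_def)

lemma f_0_pos: "\<bar>x\<bar> < K \<Longrightarrow> f 0 x > 0"
  using g_pos[of x] by (simp add: f_def)

lemma f_has_derivative_inside:
  assumes "\<bar>x\<bar> < K"
  shows "(f j has_real_derivative f (Suc j) x) (at x)"
proof -
  note pos = cos_A_pos[OF assms] and gpos = g_pos[OF assms]
  define c s where "c = cos (A x)" and "s = sin (A x)"
  have "((\<lambda>x. sin (A x)) has_real_derivative c * c powr (2 / p)) (at x)"
    unfolding c_def by (rule DERIV_chain2[OF DERIV_sin A_has_derivative[OF assms]])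
  then have 1: "((\<lambda>x. poly (P j) (sin (A x))) has_real_derivative poly (pderiv (P j)) s * (c * c powr (2 / p))) (at x)"
    unfolding s_def by (rule DERIV_chain2[OF poly_DERIV])
  have 2: "((\<lambda>x. g x powr (\<alpha> - real j)) has_real_derivative (\<alpha> - real j) * g x powr (\<alpha> - real j - 1) * (- b * s)) (at x)"
    unfolding s_def by (rule DERIV_chain2[OF has_real_derivative_powr[OF gpos] g_has_derivative[OF assms]])
  \<comment> \<open>The identity (sin A)' = (1 - sin^2 A) / g with the denominator cleared; it holds
    because b + 1 + 2 / p = 2.\<close>
  have gc: "g x * (c * c powr (2 / p)) = 1 - s\<^sup>2"
  proof -
    have "c > 0" using pos by (simp add: c_def)
    have "b + 1 + 2 / p = 2" by (simp add: b_def)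
    then have "c powr b * c powr 1 * c powr (2 / p) = c powr 2"
      by (simp only: powr_add[symmetric])
    then have "g x * (c * c powr (2 / p)) = c powr 2"
      using \<open>c > 0\<close> by (simp add: g_def c_def[symmetric] mult.assoc)
    also have "\<dots> = 1 - s\<^sup>2"
      using pos by (simp add: c_def s_def cos_squared_eq powr_numeral)
    finally show ?thesis .
  qed
  have "g x powr (\<alpha> - real j) = g x powr (\<alpha> - real j - 1 + 1)" by simp
  also have "\<dots> = g x powr (\<alpha> - real j - 1) * g x"
    using gpos by (simp only: powr_add) simp
  finally have gg: "g x powr (\<alpha> - real j) = g x powr (\<alpha> - real j - 1) * g x" .
  have "g x powr (\<alpha> - real j) * (poly (pderiv (P j)) s * (c * c powr (2 / p))) =
     g x powr (\<alpha> - real j - 1) * poly (pderiv (P j)) s * (g x * (c * c powr (2 / p)))"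
    by (simp add: gg)
  also have "\<dots> = g x powr (\<alpha> - real j - 1) * (poly (pderiv (P j)) s * (1 - s\<^sup>2))"
    unfolding gc by simp
  finally have eq: "(\<alpha> - real j) * g x powr (\<alpha> - real j - 1) * (- b * s) * poly (P j) s +
      poly (pderiv (P j)) s * (c * c powr (2 / p)) * g x powr (\<alpha> - real j) = f (Suc j) x"
    by (simp add: f_def s_def algebra_simps power2_eq_square diff_diff_eq)
  have f: "f j = (\<lambda>x. g x powr (\<alpha> - real j) * poly (P j) (sin (A x)))"
    by (simp add: f_def fun_eq_iff)
  show ?thesis
    unfolding f by (rule DERIV_cong[OF DERIV_mult[OF 2 1]]) (use eq in \<open>simp only: s_def\<close>)
qed

lemma f_has_derivative:
  assumes "\<bar>x\<bar> \<noteq> K"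
  shows "(f j has_real_derivative f (Suc j) x) (at x)"
proof (cases "\<bar>x\<bar> < K")
  case False
  then have x: "K < \<bar>x\<bar>" using assms by simp
  have ev: "\<forall>\<^sub>F y in nhds x. 0 = f j y"
    using order_tendstoD(1)[OF tendsto_rabs[OF filterlim_ident] x]
    by eventually_elim (simp add: f_outside)
  have "((\<lambda>_. 0) has_real_derivative 0) (at x)" by simp
  then have "(f j has_real_derivative 0) (at x)"
    by (rule DERIV_cong_ev[OF refl ev refl, THEN iffD1])
  then show ?thesis using x by (simp add: f_outside)
qed (rule f_has_derivative_inside)

lemma isCont_f: "\<bar>x\<bar> \<noteq> K \<Longrightarrow> isCont (f j) x"
  using f_has_derivative by (blast intro: DERIV_isCont)

lemma continuous_on_f:
  assumes "real j < \<alpha>"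
  shows "continuous_on S (f j)"
  unfolding f_def using assms g_nonneg
  by (intro continuous_intros continuous_on_powr' continuous_on_g continuous_on_A continuous_on_poly) auto

text \<open>The factor 1 - x^2 in front of the derivative in the recursion vanishes at both
  endpoints, so only the first summand survives and the values form a product. No factor is zero as
  long as the indices stay below \<alpha>.\<close>

lemma poly_P_endpoint:
  assumes "e \<in> {1, - 1}"
  shows "poly (P j) e = (\<Prod>i<j. - (b * (\<alpha> - real i)) * e)"
  using assms by (induction j) (auto simp: algebra_simps)

lemma poly_P_endpoint_neq_0:
  assumes "e \<in> {1, - 1}" "\<And>i. i < j \<Longrightarrow> real i < \<alpha>"
  shows "poly (P j) e \<noteq> 0"
  using assms(2) b_pos poly_P_endpoint[OF assms(1), of j] assms(1) by fastforce

text \<open>Here \<open>t\<close> is the distance to the end \<open>e * K\<close> of the loop. There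
  \<open>sin (A x)\<close> tends to \<open>e\<close>, so \<open>g\<close> leaves the end with slope
  \<open>b\<close>, and \<open>f j\<close> behaves like (b t) to the power \<alpha> - j times the
  endpoint value of the polynomial.\<close>

lemma f_endpoint_tendsto:
  assumes e: "e \<in> {1, - 1}"
  shows "((\<lambda>t. f j (e * (K - t)) * t powr (real j - \<alpha>)) \<longlongrightarrow> b powr (\<alpha> - real j) * poly (P j) e) (at_right 0)"
proof -
  have inside: "\<forall>\<^sub>F t in at_right 0. \<bar>e * (K - t)\<bar> < K \<and> 0 < t"
    using eventually_at_right_real[OF K_pos] by eventually_elim (use e in auto)
  have lin: "continuous_on UNIV (\<lambda>t. e * (K - t))"
    by (intro continuous_intros)
  have "continuous_on UNIV (\<lambda>t. sin (A (e * (K - t))))"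
    by (intro continuous_on_sin continuous_on_compose2[OF continuous_on_A[of UNIV] lin]) simp
  then have "((\<lambda>t. sin (A (e * (K - t)))) \<longlongrightarrow> sin (A (e * (K - 0)))) (at_right 0)"
    by (rule continuous_on_UNIV_tendsto)
  moreover have "sin (A (e * (K - 0))) = e"
    using e K_pos by (auto simp: A_eq am_K)
  ultimately have sin: "((\<lambda>t. sin (A (e * (K - t)))) \<longlongrightarrow> e) (at_right 0)" by simp
  have "((\<lambda>t. g (e * (K - t)) / (t - 0)) \<longlongrightarrow> b) (at_right 0)"
  proof (rule lhopital_right[where f' = "\<lambda>t. b * e * sin (A (e * (K - t)))" and g' = "\<lambda>_. 1"])
    have "continuous_on UNIV (\<lambda>t. g (e * (K - t)))"
      by (intro continuous_on_compose2[OF continuous_on_g[of UNIV] lin]) simp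
    then have "((\<lambda>t. g (e * (K - t))) \<longlongrightarrow> g (e * (K - 0))) (at_right 0)"
      by (rule continuous_on_UNIV_tendsto)
    then show "((\<lambda>t. g (e * (K - t))) \<longlongrightarrow> 0) (at_right 0)"
      using e K_pos by (auto simp: g_outside)
    show "((\<lambda>t. t - 0) \<longlongrightarrow> 0) (at_right (0::real))" by (auto intro!: tendsto_eq_intros)
    show "\<forall>\<^sub>F t in at_right (0::real). t - 0 \<noteq> 0" by (simp add: eventually_at_filter)
    show "\<forall>\<^sub>F t in at_right 0. ((\<lambda>t. g (e * (K - t))) has_real_derivative b * e * sin (A (e * (K - t)))) (at t)"
      using inside
    proof eventually_elim
      case (elim t)
      have "((\<lambda>t. e * (K - t)) has_real_derivative - e) (at t)"
        by (auto intro!: derivative_eq_intros)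
      from DERIV_chain2[OF g_has_derivative this] elim
      show ?case by (simp add: mult_ac)
    qed
    show "\<forall>\<^sub>F t in at_right 0. ((\<lambda>t. t - 0) has_real_derivative 1) (at t)"
      by (auto intro!: always_eventually derivative_eq_intros)
    have "((\<lambda>t. b * e * sin (A (e * (K - t)))) \<longlongrightarrow> b * e * e) (at_right 0)"
      by (intro tendsto_intros sin)
    then show "((\<lambda>t. b * e * sin (A (e * (K - t))) / 1) \<longlongrightarrow> b) (at_right 0)"
      using e by auto
  qed simp
  from tendsto_powr_quotient[OF this, of "\<alpha> - real j"] b_pos
  have "((\<lambda>t. g (e * (K - t)) powr (\<alpha> - real j) * \<bar>t\<bar> powr (real j - \<alpha>)) \<longlongrightarrow> b powr (\<alpha> - real j)) (at_right 0)"
    using g_nonneg by simp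
  then have "((\<lambda>t. g (e * (K - t)) powr (\<alpha> - real j) * \<bar>t\<bar> powr (real j - \<alpha>) * poly (P j) (sin (A (e * (K - t)))))
      \<longlongrightarrow> b powr (\<alpha> - real j) * poly (P j) e) (at_right 0)"
    by (intro tendsto_mult tendsto_poly sin)
  then show ?thesis
    by (rule Lim_transform_eventually)
      (use inside in \<open>auto elim!: eventually_mono simp: f_def\<close>)
qed

text \<open>At an end of the loop the inner side is controlled by the endpoint limit and the outer
  side is zero. The assumption on \<open>j\<close> makes the comparison exponent nonpositive, so all
  other points qualify by continuity.\<close>

lemma f_bigo:
  assumes "real j \<ge> \<alpha>"
  shows "f j \<in> O[at x](\<lambda>y. \<bar>y - x\<bar> powr (- (real j - \<alpha>)))"
proof (cases "\<bar>x\<bar> = K")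
  case False
  then show ?thesis using assms by (intro isCont_bigo_powr isCont_f) auto
next
  case True
  define e :: real where "e = sgn x"
  have e: "e \<in> {1, - 1}" "x = e * K" using True K_pos by (auto simp: e_def sgn_if abs_if split: if_splits)
  define l where "l = \<bar>b powr (\<alpha> - real j) * poly (P j) e\<bar>"
  have "\<forall>\<^sub>F t in at_right 0. \<bar>f j (e * (K - t)) * t powr (real j - \<alpha>)\<bar> < l + 1"
    unfolding l_def by (intro order_tendstoD(2)[OF tendsto_rabs[OF f_endpoint_tendsto[OF e(1)]]]) simp
  then obtain \<delta> where \<delta>: "\<delta> > 0" "\<And>t. 0 < t \<Longrightarrow> t < \<delta> \<Longrightarrow> \<bar>f j (e * (K - t)) * t powr (real j - \<alpha>)\<bar> < l + 1"
    by (auto simp: eventually_at_right_field)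
  show ?thesis
  proof (rule bigoI[where c = "l + 1"])
    have "norm (f j y) \<le> (l + 1) * norm (\<bar>y - x\<bar> powr (- (real j - \<alpha>)))" if "y \<noteq> x" "dist y x < min \<delta> K" for y
    proof -
      \<comment> \<open>The signed distance to the end of the loop: positive inside, negative
        outside.\<close>
      define t where "t = K - e * y"
      have y: "y = e * (K - t)" "\<bar>y - x\<bar> = \<bar>t\<bar>" "t \<noteq> 0" "\<bar>t\<bar> < \<delta>" "\<bar>t\<bar> < K"
        using e that by (auto simp: t_def dist_real_def abs_if split: if_splits)
      show ?thesis
      proof (cases "t > 0")
        case True
        then have "\<bar>f j y\<bar> * t powr (real j - \<alpha>) < l + 1"
          using \<delta>(2)[of t] y by (simp add: abs_mult)
        then have "\<bar>f j y\<bar> \<le> (l + 1) / t powr (real j - \<alpha>)"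
          using True by (simp add: pos_le_divide_eq)
        moreover have "norm (\<bar>y - x\<bar> powr (- (real j - \<alpha>))) = 1 / t powr (real j - \<alpha>)"
          using True by (simp add: y(2) powr_minus_divide[symmetric])
        ultimately show ?thesis
          by (simp only: real_norm_def) simp
      next
        case False
        then have "K \<le> \<bar>y\<bar>" using y e by auto
        then show ?thesis by (simp add: f_outside l_def)
      qed
    qed
    then show "\<forall>\<^sub>F y in at x. norm (f j y) \<le> (l + 1) * norm (\<bar>y - x\<bar> powr (- (real j - \<alpha>)))"
      using \<delta>(1) K_pos unfolding eventually_at by (intro exI[of _ "min \<delta> K"]) auto
  qed
qed

end

subsection \<open>Reduction to a curvature function\<close>

lemma perp_perp: "perp (perp v) = - v"
  by (simp add: vec_eq_iff forall_2)

lemma perp_scaleR: "perp (r *\<^sub>R v) = r *\<^sub>R perp v" and perp_add: "perp (v + w) = perp v + perp w"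
  by (simp_all add: vec_eq_iff forall_2)

lemma orthogonal_eq_curvature_perp:
  assumes "norm u = 1" "u \<bullet> v = 0"
  shows "v = curvature_of u v *\<^sub>R perp u"
proof -
  have 1: "u $ 1 * u $ 1 + u $ 2 * u $ 2 = 1"
    using assms(1) by (simp add: norm_eq_1 inner_vec_def sum_2)
  have 2: "u $ 1 * v $ 1 + u $ 2 * v $ 2 = 0"
    using assms(2) by (simp add: inner_vec_def sum_2)
  have "v $ 1 = - ((u $ 1 * v $ 2 - u $ 2 * v $ 1) * u $ 2)"
    using 1 2 by algebra
  moreover have "v $ 2 = (u $ 1 * v $ 2 - u $ 2 * v $ 1) * u $ 1"
    using 1 2 by algebra
  ultimately show ?thesis
    using assms(1) by (simp add: vec_eq_iff forall_2 curvature_of_def)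
qed

text \<open>\<delta> is the determinant of \<open>A\<close>: rotations commute with the quarter turn
  and reflections anticommute. It is found from the first basis vector, whose quarter turn is mapped
  to a unit vector orthogonal to the image, and extended by linearity.\<close>

lemma orthogonal_transformation_perp:
  fixes A :: "real^2 \<Rightarrow> real^2"
  assumes A: "orthogonal_transformation A"
  obtains \<delta> :: real where "\<delta> \<in> {1, - 1}" "\<And>v. A (perp v) = \<delta> *\<^sub>R perp (A v)"
proof -
  define i :: "real^2" where "i = axis 1 1"
  have lin: "linear A" using A by (rule orthogonal_transformation_linear)
  have ni: "norm (A i) = 1"
    using A by (simp add: orthogonal_transformation_norm i_def)
  have "A i \<bullet> A (perp i) = i \<bullet> perp i"
    using A by (simp add: orthogonal_transformation_def)
  also have "\<dots> = 0"
    by (simp add: inner_vec_def sum_2)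
  finally have eq: "A (perp i) = curvature_of (A i) (A (perp i)) *\<^sub>R perp (A i)"
    by (rule orthogonal_eq_curvature_perp[OF ni])
  define \<delta> where "\<delta> = curvature_of (A i) (A (perp i))"
  have "norm (A (perp i)) = 1"
    using A by (simp add: orthogonal_transformation_norm i_def)
  then have "\<bar>\<delta>\<bar> = 1"
    by (subst (asm) eq) (simp add: ni \<delta>_def)
  then have \<delta>: "\<delta> \<in> {1, - 1}" "\<delta> * \<delta> = 1"
    by (auto simp: abs_if split: if_splits)
  have "A (perp v) = \<delta> *\<^sub>R perp (A v)" for v
  proof -
    have v: "v = v $ 1 *\<^sub>R i + v $ 2 *\<^sub>R perp i"
      by (simp add: vec_eq_iff forall_2 i_def axis_def)
    have Av: "A v = v $ 1 *\<^sub>R A i + (v $ 2 * \<delta>) *\<^sub>R perp (A i)"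
      by (subst v) (simp add: linear_add[OF lin] linear_scale[OF lin] eq[folded \<delta>_def])
    have "perp v = v $ 1 *\<^sub>R perp i + (- v $ 2) *\<^sub>R i"
      by (simp add: vec_eq_iff forall_2 i_def axis_def)
    then have "A (perp v) = v $ 1 *\<^sub>R A (perp i) + (- v $ 2) *\<^sub>R A i"
      by (simp only: linear_add[OF lin] linear_scale[OF lin])
    also have "\<dots> = (\<delta> * v $ 1) *\<^sub>R perp (A i) - v $ 2 *\<^sub>R A i"
      by (simp add: eq[folded \<delta>_def] mult.commute)
    also have "\<dots> = \<delta> *\<^sub>R perp (A v)"
      using \<delta>(1) by (auto simp: Av perp_add perp_scaleR perp_perp algebra_simps)
    finally show ?thesis .
  qed
  with \<delta>(1) show ?thesis by (rule that)
qed

text \<open>Both curves have unit speed, so the similarity factor forces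
  \<open>\<bar>\<phi>' s\<bar>\<close> to be its reciprocal \<open>c\<close>. A continuous
  derivative without zeros keeps its sign \<open>e\<close>, hence \<phi> is affine. The dilation
  multiplies the curvature by \<open>c\<close>; a reflection and a reversal of orientation each
  change its sign, and \<sigma> is the product of the two.\<close>

lemma represented_normal_form:
  assumes rep: "represented_by_curvature D \<kappa> L \<gamma>" and L: "L > 0"
    and unit: "\<And>s. s \<in> {0..L} \<Longrightarrow> norm (vector_derivative \<gamma> (at s within {0..L})) = 1"
  obtains T c e \<sigma> d where "c > 0" "e \<in> {1, - 1}" "\<sigma> \<in> {1, - 1}"
    and "\<And>s. s \<in> {0..L} \<Longrightarrow> (\<gamma> has_vector_derivative T s) (at s within {0..L})"
    and "\<And>s. s \<in> {0..L} \<Longrightarrow>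
      (T has_vector_derivative (\<sigma> * c * \<kappa> (e * c * s + d)) *\<^sub>R perp (T s)) (at s within {0..L})"
    and "\<And>s. s \<in> {0..L} \<Longrightarrow> norm (T s) = 1"
proof -
  obtain \<gamma>s \<Phi> \<phi> l s0 where arc: "arclength_curve_with_curvature D \<gamma>s \<kappa>" and "similarity \<Phi>"
    and rp: "reparametrization L l \<phi>" and sub: "{s0..s0 + l} \<subseteq> D"
    and \<gamma>: "\<And>s. s \<in> {0..L} \<Longrightarrow> \<gamma> s = \<Phi> (\<gamma>s (\<phi> s + s0))"
    using rep unfolding represented_by_curvature_def by blast
  obtain Ts Ns where Ts: "\<And>s. s \<in> D \<Longrightarrow> (\<gamma>s has_vector_derivative Ts s) (at s within D)"
    and Ns: "\<And>s. s \<in> D \<Longrightarrow> (Ts has_vector_derivative Ns s) (at s within D)"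
    and nTs: "\<And>s. s \<in> D \<Longrightarrow> norm (Ts s) = 1" and curv: "\<And>s. s \<in> D \<Longrightarrow> curvature_of (Ts s) (Ns s) = \<kappa> s"
    using arc unfolding arclength_curve_with_curvature_def by blast
  obtain A c0 b0 where A: "orthogonal_transformation A" and c0: "c0 > 0" and \<Phi>: "\<Phi> = (\<lambda>x. c0 *\<^sub>R A x + b0)"
    using \<open>similarity \<Phi>\<close> unfolding similarity_def by blast
  obtain \<phi>' where im: "\<phi> ` {0..L} = {0..l}" and cont: "continuous_on {0..L} \<phi>'"
    and d\<phi>: "\<And>s. s \<in> {0..L} \<Longrightarrow> (\<phi> has_real_derivative \<phi>' s) (at s within {0..L})"
    and ne: "\<And>s. s \<in> {0..L} \<Longrightarrow> \<phi>' s \<noteq> 0"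
    using rp unfolding reparametrization_def by blast
  define u where "u s = \<phi> s + s0" for s
  have blA: "bounded_linear A"
    using orthogonal_transformation_linear[OF A] by (simp add: linear_conv_bounded_linear)
  have uD: "u ` {0..L} \<subseteq> D"
  proof -
    have "u s \<in> {s0..s0 + l}" if "s \<in> {0..L}" for s
      using im that unfolding u_def by fastforce
    then show ?thesis using sub by blast
  qed
  have du: "(u has_vector_derivative \<phi>' s) (at s within {0..L})" if "s \<in> {0..L}" for s
    unfolding u_def[abs_def] has_real_derivative_iff_has_vector_derivative[symmetric]
    using d\<phi>[OF that] by (auto intro!: derivative_eq_intros)
  have chain: "((\<lambda>s. A (f (u s))) has_vector_derivative \<phi>' s *\<^sub>R A (f' (u s))) (at s within {0..L})"
    if s: "s \<in> {0..L}" and f: "\<And>s. s \<in> D \<Longrightarrow> (f has_vector_derivative f' s) (at s within D)" for s f f'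
  proof -
    have "(f has_vector_derivative f' (u s)) (at (u s) within u ` {0..L})"
      using uD s by (intro has_vector_derivative_within_subset[OF f]) auto
    from vector_diff_chain_within[OF du[OF s] this]
    have "((\<lambda>s. f (u s)) has_vector_derivative \<phi>' s *\<^sub>R f' (u s)) (at s within {0..L})"
      by (simp add: o_def)
    from bounded_linear.has_vector_derivative[OF blA this]
    show ?thesis by (simp add: linear_scale[OF orthogonal_transformation_linear[OF A]])
  qed
  have d\<gamma>: "(\<gamma> has_vector_derivative (c0 * \<phi>' s) *\<^sub>R A (Ts (u s))) (at s within {0..L})" if s: "s \<in> {0..L}" for s
  proof -
    have "((\<lambda>s. c0 *\<^sub>R A (\<gamma>s (u s)) + b0) has_vector_derivative c0 *\<^sub>R \<phi>' s *\<^sub>R A (Ts (u s)) + 0) (at s within {0..L})"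
      using chain[OF s Ts] by (intro has_vector_derivative_add has_vector_derivative_const
          bounded_linear.has_vector_derivative[OF bounded_linear_scaleR_right])
    then have "((\<lambda>s. c0 *\<^sub>R A (\<gamma>s (u s)) + b0) has_vector_derivative (c0 * \<phi>' s) *\<^sub>R A (Ts (u s))) (at s within {0..L})"
      by simp
    then show ?thesis
      by (rule has_vector_derivative_transform[OF s, rotated]) (simp add: \<gamma> \<Phi> u_def)
  qed
  have nA: "norm (A (Ts (u s))) = 1" if "s \<in> {0..L}" for s
    using nTs[of "u s"] uD that by (simp add: orthogonal_transformation_norm[OF A] image_subset_iff)
  define c where "c = 1 / c0"
  have c: "c > 0" "c0 * c = 1" using c0 by (simp_all add: c_def)
  have abs: "\<bar>\<phi>' s\<bar> = c" if s: "s \<in> {0..L}" for s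
  proof -
    have "vector_derivative \<gamma> (at s within {0..L}) = (c0 * \<phi>' s) *\<^sub>R A (Ts (u s))"
      using L s by (intro vector_derivative_within_closed_interval d\<gamma>) auto
    then have "c0 * \<bar>\<phi>' s\<bar> = 1"
      using unit[OF s] c0 by (simp add: nA[OF s] abs_mult)
    then show ?thesis using c0 by (simp add: c_def field_simps)
  qed
  define e where "e = sgn (\<phi>' 0)"
  have "\<phi>' 0 \<noteq> 0" using ne[of 0] L by simp
  then have e: "e \<in> {1, - 1}" "e * e = 1" by (auto simp: e_def sgn_if)
  have \<phi>': "\<phi>' s = e * c" if s: "s \<in> {0..L}" for s
  proof -
    have c0s: "continuous_on {0..s} \<phi>'"
      using s by (intro continuous_on_subset[OF cont]) auto
    have "sgn (\<phi>' s) = e"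
    proof (rule ccontr)
      assume "sgn (\<phi>' s) \<noteq> e"
      then have "\<phi>' 0 \<le> 0 \<and> 0 \<le> \<phi>' s \<or> \<phi>' s \<le> 0 \<and> 0 \<le> \<phi>' 0"
        by (auto simp: e_def sgn_if split: if_splits)
      then obtain x where "0 \<le> x" "x \<le> s" "\<phi>' x = 0"
        using IVT'[of \<phi>' 0 0 s] IVT2'[of \<phi>' s 0 0] c0s s by auto
      then show False using ne[of x] s by auto
    qed
    then show ?thesis using abs[OF s] by (metis mult.commute mult_sgn_abs)
  qed
  obtain d1 where d1: "\<And>s. s \<in> {0..L} \<Longrightarrow> \<phi> s - e * c * s = d1"
  proof -
    have "\<exists>d. \<forall>s\<in>{0..L}. \<phi> s - e * c * s = d"
    proof (rule has_field_derivative_zero_constant)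
      show "((\<lambda>s. \<phi> s - e * c * s) has_real_derivative 0) (at s within {0..L})" if "s \<in> {0..L}" for s
        using d\<phi>[OF that] \<phi>'[OF that] by (auto intro!: derivative_eq_intros)
    qed simp
    then show ?thesis using that by blast
  qed
  define d where "d = d1 + s0"
  have u: "u s = e * c * s + d" if "s \<in> {0..L}" for s
    using d1[OF that] by (simp add: u_def d_def)
  obtain \<delta> :: real where \<delta>: "\<delta> \<in> {1, - 1}" and perpA: "\<And>v. A (perp v) = \<delta> *\<^sub>R perp (A v)"
    using orthogonal_transformation_perp[OF A] by blast
  define T where "T s = e *\<^sub>R A (Ts (u s))" for s
  have dT: "(T has_vector_derivative c *\<^sub>R A (Ns (u s))) (at s within {0..L})" if s: "s \<in> {0..L}" for s
  proof -
    have "((\<lambda>s. e *\<^sub>R A (Ts (u s))) has_vector_derivative e *\<^sub>R (e * c) *\<^sub>R A (Ns (u s))) (at s within {0..L})"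
      using chain[OF s Ns] \<phi>'[OF s]
      by (intro bounded_linear.has_vector_derivative[OF bounded_linear_scaleR_right]) simp
    moreover have "e * (e * c) = c" using e by (simp flip: mult.assoc)
    ultimately show ?thesis by (simp add: T_def[abs_def])
  qed
  have nT: "norm (T s) = 1" if "s \<in> {0..L}" for s
    using nA[OF that] e by (auto simp: T_def)
  have Ns_eq: "Ns (u s) = \<kappa> (u s) *\<^sub>R perp (Ts (u s))" if s: "s \<in> {0..L}" for s
  proof -
    have us: "u s \<in> D" using uD s by blast
    \<comment> \<open>Orthogonality comes from differentiating the constant speed. This is done for
      \<open>T\<close>, since derivatives within \<open>{0..L}\<close> are unique whereas the domain
      \<open>D\<close> is arbitrary, and then pulled back through \<open>A\<close>.\<close>
    have "((\<lambda>s. T s \<bullet> T s) has_vector_derivative T s \<bullet> (c *\<^sub>R A (Ns (u s))) + (c *\<^sub>R A (Ns (u s))) \<bullet> T s) (at s within {0..L})"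
      by (rule bounded_bilinear.has_vector_derivative[OF bounded_bilinear_inner dT[OF s] dT[OF s]])
    moreover have "((\<lambda>s. T s \<bullet> T s) has_vector_derivative 0) (at s within {0..L})"
      by (rule has_vector_derivative_transform[OF s _ has_vector_derivative_const[of 1]])
        (use nT in \<open>auto simp: norm_eq_1\<close>)
    ultimately have "T s \<bullet> (c *\<^sub>R A (Ns (u s))) + (c *\<^sub>R A (Ns (u s))) \<bullet> T s = 0"
      using L s vector_derivative_unique_within_closed_interval[of 0 L s] by auto
    then have "2 * (c * e * (A (Ts (u s)) \<bullet> A (Ns (u s)))) = 0"
      by (simp add: T_def inner_commute)
    then have "A (Ts (u s)) \<bullet> A (Ns (u s)) = 0"
      using c e by auto
    then have "Ts (u s) \<bullet> Ns (u s) = 0"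
      using A by (simp add: orthogonal_transformation_def)
    then show ?thesis
      using orthogonal_eq_curvature_perp[OF nTs[OF us]] curv[OF us] by metis
  qed
  show ?thesis
  proof (rule that[of c e "\<delta> * e" T d])
    show "\<delta> * e \<in> {1, - 1}" using \<delta> e by auto
    show "(\<gamma> has_vector_derivative T s) (at s within {0..L})" if s: "s \<in> {0..L}" for s
    proof -
      have eq: "c0 * (e * c) = e" using c by (simp add: mult.left_commute)
      show ?thesis using d\<gamma>[OF s] by (simp only: \<phi>'[OF s] eq T_def)
    qed
    show "(T has_vector_derivative (\<delta> * e * c * \<kappa> (e * c * s + d)) *\<^sub>R perp (T s)) (at s within {0..L})"
      if s: "s \<in> {0..L}" for s
    proof -
      have "c *\<^sub>R A (Ns (u s)) = (c * \<kappa> (u s) * \<delta>) *\<^sub>R perp (A (Ts (u s)))"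
        by (simp add: Ns_eq[OF s] linear_scale[OF orthogonal_transformation_linear[OF A]] perpA)
      also have "\<dots> = (\<delta> * e * c * \<kappa> (u s)) *\<^sub>R perp (T s)"
        using e by (auto simp: T_def perp_scaleR mult_ac)
      finally show ?thesis using dT[OF s] u[OF s] by simp
    qed
  qed (use c e nT in auto)
qed

text \<open>Clamping the argument to \<open>{0..L}\<close> extends \<open>h\<close> to the line, so
  the preimage of \<open>C\<close> is closed. A closed set containing almost all of an open interval
  contains all of it, hence also its endpoints.\<close>

lemma continuous_on_AE_closed:
  fixes h :: "real \<Rightarrow> real"
  assumes h: "continuous_on {0..L} h" and "closed C" "L > 0"
    and AE: "AE s in lebesgue. s \<in> {0<..<L} \<longrightarrow> h s \<in> C" and s: "s \<in> {0..L}"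
  shows "h s \<in> C"
proof -
  define B where "B = (\<lambda>x. h (max 0 (min L x))) -` C"
  have "continuous_on UNIV (\<lambda>x. h (max 0 (min L x)))"
    using \<open>L > 0\<close> by (intro continuous_on_compose2[OF h] continuous_intros) auto
  then have B: "closed B"
    using \<open>closed C\<close> by (auto simp: B_def intro: closed_vimage)
  have clamp: "x \<in> B \<longleftrightarrow> h x \<in> C" if "x \<in> {0..L}" for x
    using that by (auto simp: B_def max_def min_def)
  have "AE x \<in> {0<..<L} in lebesgue. x \<in> B"
    using AE by eventually_elim (use clamp in auto)
  then have "{0<..<L} \<subseteq> B"
    using mem_closed_if_AE_lebesgue_open[OF open_greaterThanLessThan B] by blast
  then have "closure {0<..<L} \<subseteq> B"
    using B by (rule closure_minimal)
  then show ?thesis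
    using s clamp \<open>L > 0\<close> by (auto simp: closure_greaterThanLessThan)
qed

lemma (in regular_curvature) continuous_curvature_eq:
  assumes k: "is_continuous_curvature L \<gamma> k" and \<kappa>: "continuous_on {0..L} (\<kappa> 0)" and s: "s \<in> {0..L}"
  shows "k s = \<kappa> 0 s"
proof -
  have "continuous_on {0..L} (\<lambda>s. k s - \<kappa> 0 s)"
    using k \<kappa> by (auto simp: is_continuous_curvature_def intro: continuous_intros)
  moreover have "AE s in lebesgue. s \<in> {0<..<L} \<longrightarrow> k s - \<kappa> 0 s \<in> {0}"
    using k[unfolded is_continuous_curvature_def, THEN conjunct2] weak_curvature_AE
    by eventually_elim auto
  ultimately have "k s - \<kappa> 0 s \<in> {0}"
    using continuous_on_AE_closed[OF _ closed_singleton L_pos _ s] by blast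
  then show ?thesis by simp
qed

subsection \<open>Zeros of the curvature\<close>

lemma set_integrable_of_bigo:
  fixes h :: "real \<Rightarrow> real"
  assumes "finite S" "continuous_on ({a..b} - S) h" "\<beta> < 1"
    and O: "\<And>s. s \<in> {a..b} \<Longrightarrow> h \<in> O[at s](\<lambda>x. \<bar>x - s\<bar> powr (- \<beta>))"
  shows "set_integrable lebesgue {a..b} h"
proof -
  define A where "A = {a..b} - S"
  have A: "A \<in> sets lebesgue"
    using negligible_imp_sets[OF negligible_finite[OF \<open>finite S\<close>]] by (auto simp: A_def)
  have "h \<in> borel_measurable (lebesgue_on A)"
    using assms(2) A by (auto simp: A_def intro!: continuous_imp_measurable_on_sets_lebesgue)
  then have hm: "set_borel_measurable lebesgue A h"
    using A by (simp add: borel_measurable_restrict_space_iff set_borel_measurable_def)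
  have "set_integrable lebesgue {a..b} (\<lambda>x. \<bar>h x\<bar> powr 1)"
    using assms by (intro set_integrable_powr_of_bigo[where \<beta> = \<beta> and S = S]) auto
  moreover have "(\<lambda>x. \<bar>h x\<bar> powr 1) = (\<lambda>x. \<bar>h x\<bar>)"
    by (simp add: fun_eq_iff)
  ultimately have "set_integrable lebesgue {a..b} (\<lambda>x. \<bar>h x\<bar>)"
    by simp
  then have "set_integrable lebesgue A (\<lambda>x. \<bar>h x\<bar>)"
    by (rule set_integrable_subset) (use A in \<open>auto simp: A_def\<close>)
  then have "set_integrable lebesgue A h"
    using hm by (rule set_integrable_bound) auto
  then show ?thesis
    using \<open>finite S\<close>
    by (subst set_integrable_discrete_difference[where X = S and B = A])
      (auto simp: A_def countable_finite)
qed

text \<open>With \<beta> r = 1 the r-th power of a pole of order \<beta> is bounded below by a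
  multiple of 1 / t, the borderline of integrability.\<close>

lemma not_integrable_powr_pole:
  fixes h :: "real \<Rightarrow> real"
  assumes lim: "((\<lambda>t. h (z + e * t) * t powr \<beta>) \<longlongrightarrow> v) (at_right 0)" and "v \<noteq> 0"
    and e: "e \<in> {1, - 1}" and \<beta>: "\<beta> * r = 1" "r > 0"
    and A: "\<forall>\<^sub>F t in at_right 0. z + e * t \<in> A"
  shows "\<not> set_integrable lebesgue A (\<lambda>x. \<bar>h x\<bar> powr r)"
proof
  assume int: "set_integrable lebesgue A (\<lambda>x. \<bar>h x\<bar> powr r)"
  have "\<forall>\<^sub>F t in at_right 0. \<bar>h (z + e * t) * t powr \<beta>\<bar> > \<bar>v\<bar> / 2"
    using \<open>v \<noteq> 0\<close> by (intro order_tendstoD(1)[OF tendsto_rabs[OF lim]]) auto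
  then have "\<forall>\<^sub>F t in at_right 0. z + e * t \<in> A \<and> \<bar>h (z + e * t)\<bar> powr r \<ge> (\<bar>v\<bar> / 2) powr r / t"
    using A eventually_at_right_less[of 0]
  proof eventually_elim
    case (elim t)
    have "(\<bar>v\<bar> / 2) powr r \<le> \<bar>h (z + e * t) * t powr \<beta>\<bar> powr r"
      using elim \<beta> by (intro powr_mono2) auto
    also have "\<dots> = \<bar>h (z + e * t)\<bar> powr r * t"
      using elim \<beta> by (simp add: abs_mult powr_mult powr_powr)
    finally show ?case
      using elim by (simp add: pos_divide_le_eq)
  qed
  then obtain \<delta> where "\<delta> > 0" "\<And>t. t \<in> {0<..<\<delta>} \<Longrightarrow> z + e * t \<in> A \<and> \<bar>h (z + e * t)\<bar> powr r \<ge> (\<bar>v\<bar> / 2) powr r / t"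
    by (auto simp: eventually_at_right_field)
  moreover have "(\<bar>v\<bar> / 2) powr r > 0" using \<open>v \<noteq> 0\<close> by simp
  ultimately show False
    using not_integrable_pole[OF int _ _ _ e] by (metis powr_ge_zero)
qed

lemma frontier_of_zeros:
  fixes k :: "real \<Rightarrow> real"
  assumes k: "continuous_on {0..L} k" and z: "z \<in> top_of_set {0..L} frontier_of {s \<in> {0..L}. k s = 0}"
  shows "z \<in> {0..L}" "k z = 0" "\<And>\<delta>. \<delta> > 0 \<Longrightarrow> \<exists>y\<in>{0..L}. \<bar>y - z\<bar> < \<delta> \<and> k y \<noteq> 0"
proof -
  define Z where "Z = {s \<in> {0..L}. k s = 0}"
  have Z: "closedin (top_of_set {0..L}) Z"
    using continuous_closedin_preimage_constant[OF k, of 0] by (simp add: Z_def)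
  have "z \<in> Z"
    using z closure_of_closedin[OF Z] by (simp add: frontier_of_def Z_def)
  then show z': "z \<in> {0..L}" "k z = 0" by (auto simp: Z_def)
  fix \<delta> :: real assume "\<delta> > 0"
  have op: "openin (top_of_set {0..L}) ({0..L} \<inter> ball z \<delta>)"
    by (rule openin_open_Int) simp
  have "z \<notin> top_of_set {0..L} interior_of Z"
    using z by (simp add: frontier_of_def Z_def)
  then have "\<not> {0..L} \<inter> ball z \<delta> \<subseteq> Z"
    using op z' \<open>\<delta> > 0\<close> by (auto simp: interior_of_def)
  then show "\<exists>y\<in>{0..L}. \<bar>y - z\<bar> < \<delta> \<and> k y \<noteq> 0"
    by (auto simp: Z_def dist_real_def abs_minus_commute)
qed

text \<open>Locally on each side of a point the curvature is either zero or free of zeros; on a side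
  of the second kind, at distance \<open>t\<close> from a zero, its \<open>m\<close>-th derivative is of exact order
  \<open>t powr (- \<beta>)\<close>.\<close>

locale sided_curvature = regular_curvature +
  fixes \<beta> :: real
  assumes m_pos: "m > 0"
    and sides: "\<And>z e. e \<in> {1, - 1} \<Longrightarrow>
      (\<forall>\<^sub>F t in at_right 0. \<kappa> 0 (z + e * t) = 0) \<or>
      (\<forall>\<^sub>F t in at_right 0. \<kappa> 0 (z + e * t) \<noteq> 0) \<and>
        (\<kappa> 0 z = 0 \<longrightarrow> (\<exists>v. v \<noteq> 0 \<and> ((\<lambda>t. \<kappa> m (z + e * t) * t powr \<beta>) \<longlongrightarrow> v) (at_right 0)))"
begin

text \<open>At an end of \<open>{0..L}\<close> one of the sides leaves the interval at once. A
  singularity counts only if its side runs inside, so the two situations have to be told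
  apart.\<close>

lemma side_inside:
  assumes "z \<in> {0..L}" "e \<in> {1, - 1}"
  shows "(\<forall>\<^sub>F t in at_right 0. z + e * t \<in> {0<..<L}) \<or> (\<forall>\<^sub>F t in at_right 0. z + e * t \<notin> {0..L})"
proof -
  define D where "D = (if e = 1 then L - z else z)"
  have D: "D \<ge> 0" using assms by (auto simp: D_def)
  show ?thesis
  proof (cases "D = 0")
    case True
    have "\<forall>\<^sub>F t in at_right 0. z + e * t \<notin> {0..L}"
      using eventually_at_right_less[of 0]
      by eventually_elim (use True assms in \<open>auto simp: D_def split: if_splits\<close>)
    then show ?thesis ..
  next
    case False
    then have "\<forall>\<^sub>F t in at_right 0. t \<in> {0<..<D}"
      using D by (intro eventually_at_right_real) simp
    then have "\<forall>\<^sub>F t in at_right 0. z + e * t \<in> {0<..<L}"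
      by eventually_elim (use assms in \<open>auto simp: D_def split: if_splits\<close>)
    then show ?thesis ..
  qed
qed

lemma both_sides:
  assumes "\<And>e. e \<in> {1, - 1} \<Longrightarrow> \<forall>\<^sub>F t in at_right 0. Q (z + e * t)"
  obtains \<delta> :: real where "\<delta> > 0" "\<And>y. y \<noteq> z \<Longrightarrow> \<bar>y - z\<bar> < \<delta> \<Longrightarrow> Q y"
proof -
  obtain d1 where d1: "d1 > 0" "\<And>t. 0 < t \<Longrightarrow> t < d1 \<Longrightarrow> Q (z + t)"
    using assms[of 1] by (auto simp: eventually_at_right_field)
  obtain d2 where d2: "d2 > 0" "\<And>t. 0 < t \<Longrightarrow> t < d2 \<Longrightarrow> Q (z - t)"
    using assms[of "- 1"] by (auto simp: eventually_at_right_field)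
  show ?thesis
  proof (rule that[of "min d1 d2"])
    fix y assume y: "y \<noteq> z" "\<bar>y - z\<bar> < min d1 d2"
    show "Q y"
    proof (cases "y > z")
      case True then show ?thesis using d1(2)[of "y - z"] y by simp
    next
      case False then show ?thesis using d2(2)[of "z - y"] y by simp
    qed
  qed (use d1 d2 in simp)
qed

lemma cont_\<kappa>0: "continuous_on {0..L} (\<kappa> 0)"
  by (rule cont_\<kappa>[OF m_pos])

text \<open>A frontier zero has points of nonzero curvature arbitrarily close, hence so has one of
  its sides. That side must run inside the interval, and since the curvature does not vanish along
  it, the alternative in \<open>sides\<close> yields the exact order.\<close>

lemma singular_side:
  assumes fr: "top_of_set {0..L} frontier_of {s \<in> {0..L}. \<kappa> 0 s = 0} \<noteq> {}"
  obtains z e v where "e \<in> {1, - 1}" "\<forall>\<^sub>F t in at_right 0. z + e * t \<in> {0<..<L}" "v \<noteq> 0"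
    "((\<lambda>t. \<kappa> m (z + e * t) * t powr \<beta>) \<longlongrightarrow> v) (at_right 0)"
proof -
  obtain z where fr: "z \<in> top_of_set {0..L} frontier_of {s \<in> {0..L}. \<kappa> 0 s = 0}"
    using assms by blast
  note z = frontier_of_zeros[OF cont_\<kappa>0 fr]
  have "\<exists>e\<in>{1, - 1}. \<not> (\<forall>\<^sub>F t in at_right 0. z + e * t \<in> {0..L} \<longrightarrow> \<kappa> 0 (z + e * t) = 0)"
  proof (rule ccontr)
    assume "\<not> ?thesis"
    then obtain \<delta> where "\<delta> > 0" "\<And>y. y \<noteq> z \<Longrightarrow> \<bar>y - z\<bar> < \<delta> \<Longrightarrow> y \<in> {0..L} \<longrightarrow> \<kappa> 0 y = 0"
      using both_sides[of "\<lambda>y. y \<in> {0..L} \<longrightarrow> \<kappa> 0 y = 0" z] by blast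
    moreover obtain y where "y \<in> {0..L}" "\<bar>y - z\<bar> < \<delta>" "\<kappa> 0 y \<noteq> 0"
      using z(3)[OF \<open>\<delta> > 0\<close>] by blast
    ultimately show False using z(2) by metis
  qed
  then obtain e where e: "e \<in> {1, - 1}"
    "\<not> (\<forall>\<^sub>F t in at_right 0. z + e * t \<in> {0..L} \<longrightarrow> \<kappa> 0 (z + e * t) = 0)"
    by blast
  have "\<not> (\<forall>\<^sub>F t in at_right 0. \<kappa> 0 (z + e * t) = 0)"
  proof
    assume "\<forall>\<^sub>F t in at_right 0. \<kappa> 0 (z + e * t) = 0"
    then have "\<forall>\<^sub>F t in at_right 0. z + e * t \<in> {0..L} \<longrightarrow> \<kappa> 0 (z + e * t) = 0"
      by eventually_elim simp
    then show False using e(2) by blast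
  qed
  then obtain v where v: "v \<noteq> 0" "((\<lambda>t. \<kappa> m (z + e * t) * t powr \<beta>) \<longlongrightarrow> v) (at_right 0)"
    using sides[OF e(1), of z] z(2) by blast
  moreover have "\<forall>\<^sub>F t in at_right 0. z + e * t \<in> {0<..<L}"
  proof (rule ccontr)
    assume "\<not> ?thesis"
    then have "\<forall>\<^sub>F t in at_right 0. z + e * t \<notin> {0..L}"
      using side_inside[OF z(1) e(1)] by blast
    then have "\<forall>\<^sub>F t in at_right 0. z + e * t \<in> {0..L} \<longrightarrow> \<kappa> 0 (z + e * t) = 0"
      by eventually_elim blast
    then show False using e(2) by blast
  qed
  ultimately show ?thesis using that e(1) by blast
qed

lemma not_Sobolev_critical:
  assumes fr: "top_of_set {0..L} frontier_of {s \<in> {0..L}. \<kappa> 0 s = 0} \<noteq> {}" and r: "\<beta> * r = 1" "r \<ge> 1"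
  shows "\<not> Sobolev (m + 2) (ereal r) 0 L \<gamma>"
proof -
  obtain z e v where "e \<in> {1, - 1}" "\<forall>\<^sub>F t in at_right 0. z + e * t \<in> {0<..<L}" "v \<noteq> 0"
    "((\<lambda>t. \<kappa> m (z + e * t) * t powr \<beta>) \<longlongrightarrow> v) (at_right 0)"
    by (rule singular_side[OF fr])
  then have "\<not> set_integrable lebesgue {0<..<L} (\<lambda>s. \<bar>\<kappa> m s\<bar> powr r)"
    using r by (intro not_integrable_powr_pole[where \<beta> = \<beta>]) auto
  then show ?thesis
    using Sobolev_finite_imp_integrable[OF r(2)] by blast
qed

text \<open>A zero that is not isolated has a side with zeros arbitrarily close; the alternative in
  \<open>sides\<close> then forces the curvature to vanish all along that side, which gives an
  interval.\<close>

lemma not_discrete_zeros_iff: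
  "\<not> discrete {s \<in> {0..L}. \<kappa> 0 s = 0} \<longleftrightarrow> (\<exists>a b. a < b \<and> {a..b} \<subseteq> {s \<in> {0..L}. \<kappa> 0 s = 0})"
proof
  assume "\<not> discrete {s \<in> {0..L}. \<kappa> 0 s = 0}"
  then obtain z where z: "z \<in> {0..L}" "\<kappa> 0 z = 0" "\<not> z isolated_in {s \<in> {0..L}. \<kappa> 0 s = 0}"
    by (auto simp: discrete_def)
  have "\<exists>e\<in>{1, - 1}. \<not> (\<forall>\<^sub>F t in at_right 0. z + e * t \<notin> {s \<in> {0..L}. \<kappa> 0 s = 0})"
  proof (rule ccontr)
    assume "\<not> ?thesis"
    then obtain \<delta> where "\<delta> > 0" "\<And>y. y \<noteq> z \<Longrightarrow> \<bar>y - z\<bar> < \<delta> \<Longrightarrow> y \<notin> {s \<in> {0..L}. \<kappa> 0 s = 0}"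
      using both_sides[of "\<lambda>y. y \<notin> {s \<in> {0..L}. \<kappa> 0 s = 0}" z] by blast
    then have "z isolated_in {s \<in> {0..L}. \<kappa> 0 s = 0}"
      using z unfolding isolated_in_dist_Ex_iff
      by (auto simp: dist_real_def abs_minus_commute intro!: exI[of _ \<delta>])
    then show False using z by blast
  qed
  then obtain e where e: "e \<in> {1, - 1}" "\<not> (\<forall>\<^sub>F t in at_right 0. z + e * t \<notin> {s \<in> {0..L}. \<kappa> 0 s = 0})"
    by blast
  have in1: "\<forall>\<^sub>F t in at_right 0. z + e * t \<in> {0<..<L}"
  proof (rule ccontr)
    assume "\<not> ?thesis"
    then have "\<forall>\<^sub>F t in at_right 0. z + e * t \<notin> {0..L}"
      using side_inside[OF z(1) e(1)] by blast
    then have "\<forall>\<^sub>F t in at_right 0. z + e * t \<notin> {s \<in> {0..L}. \<kappa> 0 s = 0}"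
      by eventually_elim blast
    then show False using e(2) by blast
  qed
  have "\<forall>\<^sub>F t in at_right 0. \<kappa> 0 (z + e * t) = 0"
  proof (rule ccontr)
    assume "\<not> ?thesis"
    then have "\<forall>\<^sub>F t in at_right 0. \<kappa> 0 (z + e * t) \<noteq> 0"
      using sides[OF e(1), of z] by blast
    then have "\<forall>\<^sub>F t in at_right 0. z + e * t \<notin> {s \<in> {0..L}. \<kappa> 0 s = 0}"
      by eventually_elim simp
    then show False using e(2) by blast
  qed
  then have "\<forall>\<^sub>F t in at_right 0. z + e * t \<in> {s \<in> {0..L}. \<kappa> 0 s = 0}"
    using in1 by eventually_elim auto
  then obtain \<delta> where \<delta>: "\<delta> > 0" "\<And>t. 0 < t \<Longrightarrow> t < \<delta> \<Longrightarrow> z + e * t \<in> {s \<in> {0..L}. \<kappa> 0 s = 0}"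
    by (auto simp: eventually_at_right_field)
  \<comment> \<open>The middle third of the one-sided neighbourhood, so that the closed interval
    avoids both of its ends.\<close>
  define a where "a = (if e = 1 then z + \<delta> / 3 else z - \<delta> * 2 / 3)"
  have "{a..a + \<delta> / 3} \<subseteq> {s \<in> {0..L}. \<kappa> 0 s = 0}"
  proof
    fix x assume x: "x \<in> {a..a + \<delta> / 3}"
    have "z + e * (e * (x - z)) = x" using e by auto
    moreover have "0 < e * (x - z)" "e * (x - z) < \<delta>"
      using x e \<delta>(1) by (auto simp: a_def split: if_splits)
    ultimately show "x \<in> {s \<in> {0..L}. \<kappa> 0 s = 0}" using \<delta>(2) by metis
  qed
  then show "\<exists>a b. a < b \<and> {a..b} \<subseteq> {s \<in> {0..L}. \<kappa> 0 s = 0}"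
    using \<delta>(1) by (intro exI[of _ a] exI[of _ "a + \<delta> / 3"]) auto
next
  assume "\<exists>a b. a < b \<and> {a..b} \<subseteq> {s \<in> {0..L}. \<kappa> 0 s = 0}"
  then obtain a b where ab: "a < b" "{a..b} \<subseteq> {s \<in> {0..L}. \<kappa> 0 s = 0}" by blast
  have "\<not> a isolated_in {s \<in> {0..L}. \<kappa> 0 s = 0}"
  proof
    assume "a isolated_in {s \<in> {0..L}. \<kappa> 0 s = 0}"
    then obtain \<epsilon> where \<epsilon>: "\<epsilon> > 0" "\<And>y. y \<in> {s \<in> {0..L}. \<kappa> 0 s = 0} \<Longrightarrow> dist a y < \<epsilon> \<Longrightarrow> a = y"
      unfolding isolated_in_dist_Ex_iff by blast
    obtain y where y: "a < y" "y < min b (a + \<epsilon>)"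
      using dense[of a "min b (a + \<epsilon>)"] ab \<epsilon>(1) by auto
    then have "y \<in> {a..b}" "dist a y < \<epsilon>" by (auto simp: dist_real_def)
    then have "a = y" using ab(2) by (intro \<epsilon>(2)) blast+
    then show False using y by simp
  qed
  moreover have "a \<in> {s \<in> {0..L}. \<kappa> 0 s = 0}" using subsetD[OF ab(2), of a] ab(1) by simp
  ultimately show "\<not> discrete {s \<in> {0..L}. \<kappa> 0 s = 0}"
    unfolding discrete_def by blast
qed

text \<open>Follow the flat interval up to the first point \<open>z\<close> beyond which the curvature is not zero;
  there the highest derivative jumps from \<open>0\<close> to a nonzero value.\<close>

lemma not_Sobolev_flat:
  assumes "\<beta> = 0"
    and zero_all: "\<And>i s. \<kappa> 0 s = 0 \<Longrightarrow> \<kappa> i s = 0"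
    and fr: "top_of_set {0..L} frontier_of {s \<in> {0..L}. \<kappa> 0 s = 0} \<noteq> {}"
    and ab: "a < b" "{a..b} \<subseteq> {s \<in> {0..L}. \<kappa> 0 s = 0}"
  shows "\<not> Sobolev (m + 3) 1 0 L \<gamma>"
proof -
  obtain z0 where z0: "z0 \<in> top_of_set {0..L} frontier_of {s \<in> {0..L}. \<kappa> 0 s = 0}"
    using fr by blast
  obtain y where y: "y \<in> {0..L}" "\<kappa> 0 y \<noteq> 0"
    using frontier_of_zeros(3)[OF cont_\<kappa>0 z0, of 1] by auto
  \<comment> \<open>The direction from the flat interval towards the point \<open>y\<close> of
    nonzero curvature; \<open>s1\<close> is the end of the interval facing \<open>y\<close> and
    \<tau> the distance from there.\<close>
  define e where "e = (if y > b then 1 else - 1 :: real)"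
  define s1 where "s1 = (if y > b then b else a)"
  define \<tau> where "\<tau> = e * (y - s1)"
  have "y \<notin> {a..b}" using y ab by auto
  then have \<tau>: "\<tau> > 0" "y = s1 + e * \<tau>" by (auto simp: \<tau>_def e_def s1_def)
  have e: "e \<in> {1, - 1}" by (auto simp: e_def)
  have behind: "\<kappa> 0 (s1 - e * t) = 0 \<and> s1 - e * t \<in> {0..L}" if "0 \<le> t" "t \<le> b - a" for t
    using subsetD[OF ab(2), of "s1 - e * t"] that by (auto simp: s1_def e_def)
  have s1: "s1 \<in> {0..L}" using behind[of 0] ab by simp
  define C where "C = {t \<in> {0..\<tau>}. \<kappa> 0 (s1 + e * t) \<noteq> 0}"
  have C: "C \<noteq> {}" "bdd_below C" using \<tau> y by (auto simp: C_def)
  define t0 where "t0 = Inf C"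
  have "\<tau> \<in> C" using \<tau> y by (auto simp: C_def)
  then have t0: "0 \<le> t0" "t0 \<le> \<tau>"
    unfolding t0_def using C by (auto intro!: cInf_greatest cInf_lower simp: C_def)
  define z where "z = s1 + e * t0"
  have zL: "z \<in> {0..L}"
    using s1 y(1) t0 e \<tau> by (auto simp: z_def)
  \<comment> \<open>A point behind \<open>z\<close> lies either between \<open>s1\<close> and
    \<open>z\<close>, before the first nonzero value, or beyond \<open>s1\<close>, in the given
    interval. So a flat stretch of length \<open>b - a\<close> is always available.\<close>
  have flat: "\<kappa> 0 (z - e * t) = 0 \<and> z - e * t \<in> {0..L}" if t: "0 < t" "t \<le> b - a" for t
  proof (cases "t \<le> t0")
    case True
    have "t0 - t \<notin> C"
      using cInf_lower[OF _ C(2), of "t0 - t"] t(1) unfolding t0_def[symmetric] by auto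
    then have "\<kappa> 0 (s1 + e * (t0 - t)) = 0" using True t0 t by (auto simp: C_def)
    moreover have "s1 + e * (t0 - t) \<in> {0..L}"
      using s1 zL True t e by (auto simp: z_def)
    moreover have "z - e * t = s1 + e * (t0 - t)" by (simp add: z_def algebra_simps)
    ultimately show ?thesis by simp
  next
    case False
    have "z - e * t = s1 - e * (t - t0)" by (simp add: z_def algebra_simps)
    then show ?thesis using behind[of "t - t0"] False t t0 by simp
  qed
  have \<kappa>z: "\<kappa> 0 z = 0"
  proof -
    have "continuous_on {0..L} (\<kappa> 0)" by (rule cont_\<kappa>0)
    then have "((\<lambda>x. \<kappa> 0 x) \<longlongrightarrow> \<kappa> 0 z) (at z within {0..L})"
      using zL by (simp add: continuous_on_def)
    moreover have "filterlim (\<lambda>t. z - e * t) (at z within {0..L}) (at_right 0)"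
      unfolding filterlim_at
    proof
      have "\<forall>\<^sub>F t in at_right 0. t \<in> {0<..<b - a}"
        using ab by (intro eventually_at_right_real) simp
      then show "\<forall>\<^sub>F t in at_right 0. z - e * t \<in> {0..L} \<and> z - e * t \<noteq> z"
        by eventually_elim (use flat e in auto)
      show "((\<lambda>t. z - e * t) \<longlongrightarrow> z) (at_right 0)"
        by (auto intro!: tendsto_eq_intros)
    qed
    ultimately have "((\<lambda>t. \<kappa> 0 (z - e * t)) \<longlongrightarrow> \<kappa> 0 z) (at_right 0)"
      by (rule filterlim_compose)
    moreover have "\<forall>\<^sub>F t in at_right 0. t \<in> {0<..<b - a}"
      using ab by (intro eventually_at_right_real) simp
    then have "\<forall>\<^sub>F t in at_right 0. \<kappa> 0 (z - e * t) = 0"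
      by eventually_elim (use flat in auto)
    then have "((\<lambda>t. \<kappa> 0 (z - e * t)) \<longlongrightarrow> 0) (at_right 0)"
      by (rule tendsto_eventually)
    ultimately show ?thesis
      using tendsto_unique trivial_limit_at_right_real by blast
  qed
  have "t0 \<notin> C" using \<kappa>z by (simp add: C_def z_def)
  have "\<not> (\<forall>\<^sub>F t in at_right 0. \<kappa> 0 (z + e * t) = 0)"
  proof
    assume "\<forall>\<^sub>F t in at_right 0. \<kappa> 0 (z + e * t) = 0"
    then obtain \<delta> where \<delta>: "\<delta> > 0" "\<And>t. 0 < t \<Longrightarrow> t < \<delta> \<Longrightarrow> \<kappa> 0 (z + e * t) = 0"
      by (auto simp: eventually_at_right_field)
    have "t0 + \<delta> \<le> t" if "t \<in> C" for t
    proof (rule ccontr)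
      assume "\<not> t0 + \<delta> \<le> t"
      moreover have "t0 \<le> t" "t \<noteq> t0"
        using cInf_lower[OF that C(2)] that \<open>t0 \<notin> C\<close> by (auto simp: t0_def)
      ultimately have "\<kappa> 0 (z + e * (t - t0)) = 0" by (intro \<delta>(2)) auto
      moreover have "z + e * (t - t0) = s1 + e * t" by (simp add: z_def algebra_simps)
      ultimately show False using that by (simp add: C_def)
    qed
    then have "t0 + \<delta> \<le> t0" unfolding t0_def by (intro cInf_greatest C) (auto simp: t0_def)
    then show False using \<delta>(1) by simp
  qed
  then obtain v where v: "v \<noteq> 0" "((\<lambda>t. \<kappa> m (z + e * t) * t powr \<beta>) \<longlongrightarrow> v) (at_right 0)"
    using sides[OF e, of z] \<kappa>z by blast
  have "((\<lambda>t. \<kappa> m (z + e * t)) \<longlongrightarrow> v) (at_right 0)"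
  proof (rule Lim_transform_eventually[OF v(2)])
    show "\<forall>\<^sub>F t in at_right 0. \<kappa> m (z + e * t) * t powr \<beta> = \<kappa> m (z + e * t)"
      using eventually_at_right_less[of 0] by eventually_elim (simp add: \<open>\<beta> = 0\<close>)
  qed
  moreover have "z \<in> {0<..<L}"
  \<comment> \<open>\<open>z\<close> is interior because \<open>y\<close> lies ahead of it and the
    flat stretch behind it, both within \<open>{0..L}\<close>.\<close>
  proof -
    have "z \<noteq> y" using \<kappa>z y by blast
    then have "t0 < \<tau>" using t0 \<tau> by (auto simp: z_def)
    then show ?thesis
      using s1 y \<tau> t0 e flat[of "b - a"] ab by (auto simp: z_def)
  qed
  ultimately show ?thesis
    using e v(1) ab flat
    by (intro not_Sobolev_jump[where e = e and \<delta> = "b - a" and v = v and z = z]) (auto intro: zero_all)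
qed

end

section \<open>Affine substitutions and the normal form\<close>

lemma filterlim_affine_at:
  fixes c d z :: real
  assumes "c \<noteq> 0"
  shows "filterlim (\<lambda>s. c * s + d) (at (c * z + d)) (at z)"
  unfolding filterlim_at
proof
  show "\<forall>\<^sub>F s in at z. c * s + d \<in> UNIV \<and> c * s + d \<noteq> c * z + d"
    using assms by (simp add: eventually_at_filter)
qed (auto intro!: tendsto_eq_intros)

lemma filterlim_side:
  fixes e z :: real
  assumes "e \<in> {1, - 1}"
  shows "filterlim (\<lambda>t. z + e * t) (at z) (at_right 0)"
  unfolding filterlim_at
proof
  show "\<forall>\<^sub>F t in at_right 0. z + e * t \<in> UNIV \<and> z + e * t \<noteq> z"
    using assms eventually_at_right_less[of 0] by (auto elim!: eventually_mono)
qed (auto intro!: tendsto_eq_intros)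

lemma filterlim_scale_at_right:
  fixes c :: real
  assumes "c > 0"
  shows "filterlim (\<lambda>t. c * t) (at_right 0) (at_right 0)"
  unfolding filterlim_at
proof
  show "\<forall>\<^sub>F t in at_right 0. c * t \<in> {0<..} \<and> c * t \<noteq> 0"
    using assms eventually_at_right_less[of 0] by (auto elim!: eventually_mono)
qed (auto intro!: tendsto_eq_intros)

lemma bigo_powr_of_tendsto:
  fixes h :: "real \<Rightarrow> real"
  assumes "((\<lambda>x. h x * \<bar>x - z\<bar> powr \<beta>) \<longlongrightarrow> l) (at z)"
  shows "h \<in> O[at z](\<lambda>x. \<bar>x - z\<bar> powr (- \<beta>))"
proof (rule bigoI_tendsto)
  have "h x / \<bar>x - z\<bar> powr - \<beta> = h x * \<bar>x - z\<bar> powr \<beta>" for x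
    by (simp add: powr_minus divide_inverse)
  then show "((\<lambda>x. h x / \<bar>x - z\<bar> powr - \<beta>) \<longlongrightarrow> l) (at z)"
    using assms by simp
qed (simp add: eventually_at_filter)

lemma bigo_powr_affine:
  fixes h :: "real \<Rightarrow> real"
  assumes "h \<in> O[at (c * z + d)](\<lambda>x. \<bar>x - (c * z + d)\<bar> powr (- \<beta>))" "c \<noteq> 0"
  shows "(\<lambda>s. h (c * s + d)) \<in> O[at z](\<lambda>s. \<bar>s - z\<bar> powr (- \<beta>))"
proof -
  have "(\<lambda>s. h (c * s + d)) \<in> O[at z](\<lambda>s. \<bar>(c * s + d) - (c * z + d)\<bar> powr (- \<beta>))"
    by (rule landau_o.big.compose[OF assms(1) filterlim_affine_at[OF assms(2)]])
  also have "(\<lambda>s. \<bar>(c * s + d) - (c * z + d)\<bar> powr (- \<beta>)) = (\<lambda>s. \<bar>c\<bar> powr (- \<beta>) * \<bar>s - z\<bar> powr (- \<beta>))"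
    by (simp add: fun_eq_iff powr_mult abs_mult flip: right_diff_distrib)
  finally show ?thesis
    using assms(2) by simp
qed

locale normal_form =
  fixes L :: real and \<gamma> T :: "real \<Rightarrow> real^2" and \<kappa>s :: "real \<Rightarrow> real" and c e \<sigma> d :: real
  assumes L_pos: "L > 0" and c_pos: "c > 0" and e: "e \<in> {1, - 1}" and \<sigma>: "\<sigma> \<in> {1, - 1}"
    and d\<gamma>: "\<And>s. s \<in> {0..L} \<Longrightarrow> (\<gamma> has_vector_derivative T s) (at s within {0..L})"
    and dT: "\<And>s. s \<in> {0..L} \<Longrightarrow>
      (T has_vector_derivative (\<sigma> * c * \<kappa>s (e * c * s + d)) *\<^sub>R perp (T s)) (at s within {0..L})"
    and nT: "\<And>s. s \<in> {0..L} \<Longrightarrow> norm (T s) = 1"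
begin

lemma ec_neq_0: "e * c \<noteq> 0" and \<sigma>c_neq_0: "\<sigma> * c \<noteq> 0"
  using e \<sigma> c_pos by auto

text \<open>The instance with \<open>m = 0\<close> suffices: identifying \<open>k\<close> takes only
  two weak derivatives of the curve, and integrability of the model curvature follows from its
  continuity.\<close>

lemma curvature_eq:
  assumes k: "is_continuous_curvature L \<gamma> k" and \<kappa>s: "continuous_on UNIV \<kappa>s" and s: "s \<in> {0..L}"
  shows "k s = \<sigma> * c * \<kappa>s (e * c * s + d)"
proof -
  define h where "h s = \<sigma> * c * \<kappa>s (e * c * s + d)" for s
  have h: "continuous_on A h" for A
    unfolding h_def by (intro continuous_intros continuous_on_compose2[OF \<kappa>s]) auto
  interpret regular_curvature L \<gamma> T "\<lambda>_. h" 0 "{}"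
  proof
    show "set_integrable lebesgue {0<..<L} h"
      by (rule set_integrable_subset[OF absolutely_integrable_continuous_real[OF h[of "{0..L}"]]]) auto
  qed (use L_pos d\<gamma> dT nT in \<open>auto simp: h_def\<close>)
  show ?thesis
    using continuous_curvature_eq[OF k h s] by (simp add: h_def)
qed

end

section \<open>Regularity of wavelike curves and nonvanishing of \<open>dn_p\<close>\<close>

context wave
begin

lemma wave_bigo:
  assumes "c \<noteq> 0"
  shows "(\<lambda>s. b * cn' (c * s + d)) \<in> O[at z](\<lambda>s. \<bar>s - z\<bar> powr (- ((p - 2) / (p - 1))))"
proof -
  have "cn' \<in> O[at x](\<lambda>y. \<bar>y - x\<bar> powr (- ((p - 2) / (p - 1))))" for x
  proof (cases "cos (am x) = 0")
    case True
    then show ?thesis using cn'_tendsto[OF True] bigo_powr_of_tendsto by metis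
  next
    case False
    then show ?thesis using p by (intro isCont_bigo_powr isCont_cn') auto
  qed
  then have "(\<lambda>s. cn' (c * s + d)) \<in> O[at z](\<lambda>s. \<bar>s - z\<bar> powr (- ((p - 2) / (p - 1))))"
    by (rule bigo_powr_affine) (rule assms)
  then show ?thesis by simp
qed

text \<open>The critical order is 1, so only the indices 0 and 1 matter; the first derivative fills
  all higher ones. The factor \<open>e * c\<close> comes from the chain rule.\<close>

definition wave_curvature :: "real \<Rightarrow> real \<Rightarrow> real \<Rightarrow> real \<Rightarrow> nat \<Rightarrow> real \<Rightarrow> real" where
  "wave_curvature c e \<sigma> d i s = (if i = 0 then \<sigma> * c * (2 * q * cn_p p (e * c * s + d) q)
     else \<sigma> * c * (2 * q * cn' (e * c * s + d)) * (e * c))"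

lemma wave_sided:
  assumes nf: "normal_form L \<gamma> T (\<lambda>s. 2 * q * cn_p p s q) c e \<sigma> d"
  defines "S \<equiv> {s \<in> {0..L}. cos (am (e * c * s + d)) = 0}"
  shows "finite S" "continuous_on ({0..L} - S) (wave_curvature c e \<sigma> d 1)"
    "sided_curvature L \<gamma> T (wave_curvature c e \<sigma> d) 1 S ((p - 2) / (p - 1))"
proof -
  interpret normal_form L \<gamma> T "\<lambda>s. 2 * q * cn_p p s q" c e \<sigma> d by (rule nf)
  define u where "u s = e * c * s + d" for s
  let ?\<kappa> = "wave_curvature c e \<sigma> d" and ?\<beta> = "(p - 2) / (p - 1)"
  show fin: "finite S"
  proof -
    have "u ` S \<subseteq> {x. cos (am x) = 0 \<and> min d (u L) \<le> x \<and> x \<le> max d (u L)}"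
    proof
      fix x assume "x \<in> u ` S"
      then obtain s where s: "x = u s" "s \<in> {0..L}" "cos (am x) = 0" by (auto simp: S_def u_def)
      have "c * s \<ge> 0" "c * s \<le> c * L" using s c_pos by auto
      then have "min d (u L) \<le> x" "x \<le> max d (u L)" using e s(1) by (auto simp: u_def)
      then show "x \<in> {x. cos (am x) = 0 \<and> min d (u L) \<le> x \<and> x \<le> max d (u L)}" using s by simp
    qed
    then have "finite (u ` S)"
      by (rule finite_subset[OF _ finite_cos_am_zeros])
    then show ?thesis
      by (rule finite_imageD) (use ec_neq_0 in \<open>auto simp: inj_on_def u_def\<close>)
  qed
  have cu: "isCont u s" for s unfolding u_def by (intro continuous_intros)
  show cont1: "continuous_on ({0..L} - S) (?\<kappa> 1)"
  proof (intro continuous_at_imp_continuous_on ballI)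
    fix s assume "s \<in> {0..L} - S"
    then have "isCont (\<lambda>s. \<sigma> * c * (2 * q * cn' (u s)) * (e * c)) s"
      by (intro continuous_intros isCont_o2[OF cu] isCont_cn') (auto simp: S_def u_def)
    then show "isCont (?\<kappa> 1) s" by (simp add: wave_curvature_def[abs_def] u_def)
  qed
  have \<kappa>1: "?\<kappa> 1 = (\<lambda>s. \<sigma> * c * 2 * q * (e * c) * cn' (e * c * s + d))"
    by (simp add: wave_curvature_def fun_eq_iff)
  have int: "set_integrable lebesgue {0..L} (?\<kappa> 1)"
    unfolding \<kappa>1
  proof (rule set_integrable_of_bigo[OF fin _ _ wave_bigo[OF ec_neq_0]])
    show "continuous_on ({0..L} - S) (\<lambda>s. \<sigma> * c * 2 * q * (e * c) * cn' (e * c * s + d))"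
      using cont1 unfolding \<kappa>1 .
    show "?\<beta> < 1" using p by simp
  qed
  show "sided_curvature L \<gamma> T ?\<kappa> 1 S ?\<beta>"
  proof
    show "0 < L" by (rule L_pos)
    show "finite S" by (rule fin)
    show "(\<gamma> has_vector_derivative T s) (at s within {0..L})" if "s \<in> {0..L}" for s
      by (rule d\<gamma>[OF that])
    show "(T has_vector_derivative ?\<kappa> 0 s *\<^sub>R perp (T s)) (at s within {0..L})" if "s \<in> {0..L}" for s
      using dT[OF that] by (simp add: wave_curvature_def)
    show "norm (T s) = 1" if "s \<in> {0..L}" for s by (rule nT[OF that])
    show "continuous_on {0..L} (?\<kappa> j)" if "j < 1" for j
    proof -
      have "continuous_on {0..L} (\<lambda>s. \<sigma> * c * (2 * q * cn_p p (e * c * s + d) q))"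
        by (intro continuous_intros continuous_on_compose2[OF continuous_on_cn[of UNIV]]) auto
      then show ?thesis using that by (simp add: wave_curvature_def[abs_def])
    qed
    show "(?\<kappa> j has_real_derivative ?\<kappa> (Suc j) s) (at s)" if "j < 1" "s \<in> {0<..<L} - S" for j s
    proof -
      have "cos (am (e * c * s + d)) \<noteq> 0" using that by (auto simp: S_def)
      then have "((\<lambda>s. cn_p p (e * c * s + d) q) has_real_derivative cn' (e * c * s + d) * (e * c)) (at s)"
        by (intro DERIV_chain2[where f = "\<lambda>x. cn_p p x q"] cn_has_derivative)
          (auto intro!: derivative_eq_intros)
      from DERIV_cmult[OF this, of "\<sigma> * c * (2 * q)"] show ?thesis
        using that by (simp add: wave_curvature_def[abs_def] mult_ac)
    qed
    show "set_integrable lebesgue {0<..<L} (?\<kappa> 1)"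
      by (rule set_integrable_subset[OF int]) auto
    show "(\<forall>\<^sub>F t in at_right 0. ?\<kappa> 0 (z + e' * t) = 0) \<or>
      (\<forall>\<^sub>F t in at_right 0. ?\<kappa> 0 (z + e' * t) \<noteq> 0) \<and>
        (?\<kappa> 0 z = 0 \<longrightarrow> (\<exists>v. v \<noteq> 0 \<and> ((\<lambda>t. ?\<kappa> 1 (z + e' * t) * t powr ?\<beta>) \<longlongrightarrow> v) (at_right 0)))"
      if e': "e' \<in> {1, - 1}" for z e'
    \<comment> \<open>Zeros of \<open>cn_p\<close> are isolated, so the curvature is nonzero on both
      sides of every point and the second alternative always holds.\<close>
    proof (intro disjI2)
      have \<kappa>0: "?\<kappa> 0 s = 0 \<longleftrightarrow> cos (am (e * c * s + d)) = 0" for s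
        using \<sigma>c_neq_0 q by (simp add: wave_curvature_def cn_eq_0_iff)
      have to_z: "filterlim (\<lambda>t. z + e' * t) (at z) (at_right 0)"
        by (rule filterlim_side[OF e'])
      show "(\<forall>\<^sub>F t in at_right 0. ?\<kappa> 0 (z + e' * t) \<noteq> 0) \<and>
        (?\<kappa> 0 z = 0 \<longrightarrow> (\<exists>v. v \<noteq> 0 \<and> ((\<lambda>t. ?\<kappa> 1 (z + e' * t) * t powr ?\<beta>) \<longlongrightarrow> v) (at_right 0)))"
      proof (cases "?\<kappa> 0 z = 0")
        case False
        have "isCont (\<lambda>s. cos (am (u s))) z"
          by (intro continuous_intros isCont_o2[OF cu isCont_am])
        then have "((\<lambda>s. cos (am (u s))) \<longlongrightarrow> cos (am (u z))) (at z)"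
          by (simp add: isCont_def)
        then have "((\<lambda>t. cos (am (u (z + e' * t)))) \<longlongrightarrow> cos (am (u z))) (at_right 0)"
          by (rule filterlim_compose[OF _ to_z])
        then have "\<forall>\<^sub>F t in at_right 0. cos (am (u (z + e' * t))) \<noteq> 0"
          using False by (intro tendsto_imp_eventually_ne) (auto simp: \<kappa>0 u_def)
        then show ?thesis using False by (simp add: \<kappa>0 u_def)
      next
        case True
        then obtain l where l: "l \<noteq> 0" "((\<lambda>x. cn' x * \<bar>x - (e * c * z + d)\<bar> powr ?\<beta>) \<longlongrightarrow> l) (at (e * c * z + d))"
          using cn'_tendsto[of "e * c * z + d"] by (auto simp: \<kappa>0)
        have "((\<lambda>t. cn' (e * c * (z + e' * t) + d) * \<bar>e * c * (z + e' * t) + d - (e * c * z + d)\<bar> powr ?\<beta>) \<longlongrightarrow> l) (at_right 0)"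
          by (rule filterlim_compose[OF filterlim_compose[OF l(2) filterlim_affine_at[OF ec_neq_0]] to_z])
        moreover have "\<forall>\<^sub>F t in at_right 0.
            cn' (e * c * (z + e' * t) + d) * \<bar>e * c * (z + e' * t) + d - (e * c * z + d)\<bar> powr ?\<beta> =
            cn' (e * c * (z + e' * t) + d) * (c powr ?\<beta> * t powr ?\<beta>)"
          using eventually_at_right_less[of 0]
        proof eventually_elim
          case (elim t)
          have "\<bar>e * c * (z + e' * t) + d - (e * c * z + d)\<bar> = c * t"
            using e e' elim c_pos by (auto simp: algebra_simps)
          then show ?case using elim c_pos by (simp add: powr_mult)
        qed
        ultimately have lim: "((\<lambda>t. cn' (e * c * (z + e' * t) + d) * (c powr ?\<beta> * t powr ?\<beta>)) \<longlongrightarrow> l) (at_right 0)"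
          by (rule Lim_transform_eventually)
        have "\<forall>\<^sub>F t in at_right 0. cn' (e * c * (z + e' * t) + d) * (c powr ?\<beta> * t powr ?\<beta>) \<noteq> 0"
          by (rule tendsto_imp_eventually_ne[OF lim l(1)])
        \<comment> \<open>\<open>cn'\<close> is 0 by convention wherever the cosine is, so a nonzero
          limit keeps further zeros of the curvature away from \<open>z\<close>.\<close>
        then have ne: "\<forall>\<^sub>F t in at_right 0. ?\<kappa> 0 (z + e' * t) \<noteq> 0"
          by eventually_elim (auto simp: \<kappa>0 cn'_def)
        have lim': "((\<lambda>t. \<sigma> * c * 2 * q * (e * c) * c powr (- ?\<beta>) *
            (cn' (e * c * (z + e' * t) + d) * (c powr ?\<beta> * t powr ?\<beta>))) \<longlongrightarrow>
            \<sigma> * c * 2 * q * (e * c) * c powr (- ?\<beta>) * l) (at_right 0)"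
          by (intro tendsto_mult_left lim)
        have eq: "\<sigma> * c * 2 * q * (e * c) * c powr (- ?\<beta>) *
            (cn' (e * c * (z + e' * t) + d) * (c powr ?\<beta> * t powr ?\<beta>)) = ?\<kappa> 1 (z + e' * t) * t powr ?\<beta>" for t
        proof -
          have "c powr (- ?\<beta>) * c powr ?\<beta> = 1"
            using c_pos by (simp flip: powr_add)
          then have "\<sigma> * c * 2 * q * (e * c) * cn' (e * c * (z + e' * t) + d) * t powr ?\<beta> * (c powr (- ?\<beta>) * c powr ?\<beta>) = ?\<kappa> 1 (z + e' * t) * t powr ?\<beta>"
            by (simp add: wave_curvature_def mult_ac)
          then show ?thesis by (simp only: mult_ac)
        qed
        have nz: "\<sigma> * c * 2 * q * (e * c) * c powr (- ?\<beta>) * l \<noteq> 0"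
          using \<sigma>c_neq_0 ec_neq_0 l(1) q c_pos by simp
        show ?thesis
          by (intro conjI impI exI) (rule ne nz lim'[unfolded eq])+
      qed
    qed
  qed simp
qed

lemma wave_regularity:
  assumes nf: "normal_form L \<gamma> T (\<lambda>s. 2 * q * cn_p p s q) c e \<sigma> d"
    and k: "is_continuous_curvature L \<gamma> k"
    and fr: "top_of_set {0..L} frontier_of {s \<in> {0..L}. k s = 0} \<noteq> {}"
  shows "1 \<le> r \<Longrightarrow> r < (p - 1) / (p - 2) \<Longrightarrow> Sobolev 3 (ereal r) 0 L \<gamma>"
    and "\<not> Sobolev 3 (ereal ((p - 1) / (p - 2))) 0 L \<gamma>"
proof -
  interpret normal_form L \<gamma> T "\<lambda>s. 2 * q * cn_p p s q" c e \<sigma> d by (rule nf)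
  let ?\<kappa> = "wave_curvature c e \<sigma> d" and ?\<beta> = "(p - 2) / (p - 1)"
  define S where "S = {s \<in> {0..L}. cos (am (e * c * s + d)) = 0}"
  note S = wave_sided[OF nf, folded S_def]
  interpret sided_curvature L \<gamma> T ?\<kappa> 1 S ?\<beta> by (rule S)
  have \<kappa>1: "?\<kappa> 1 = (\<lambda>s. \<sigma> * c * 2 * q * (e * c) * cn' (e * c * s + d))"
    by (simp add: wave_curvature_def fun_eq_iff)
  have "{s \<in> {0..L}. k s = 0} = {s \<in> {0..L}. ?\<kappa> 0 s = 0}"
    using continuous_curvature_eq[OF k cont_\<kappa>0] by auto
  with fr have fr': "top_of_set {0..L} frontier_of {s \<in> {0..L}. ?\<kappa> 0 s = 0} \<noteq> {}" by simp
  show "Sobolev 3 (ereal r) 0 L \<gamma>" if r: "1 \<le> r" "r < (p - 1) / (p - 2)"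
  proof -
    have "set_integrable lebesgue {0..L} (\<lambda>s. \<bar>?\<kappa> 1 s\<bar> powr r)"
    proof (rule set_integrable_powr_of_bigo[OF S(1,2)])
      show "?\<beta> * r < 1" using r p by (simp add: field_simps)
      show "?\<kappa> 1 \<in> O[at s](\<lambda>x. \<bar>x - s\<bar> powr - ?\<beta>)" for s
        unfolding \<kappa>1 by (rule wave_bigo[OF ec_neq_0])
    qed (use r in simp)
    then have "set_integrable lebesgue {0<..<L} (\<lambda>s. \<bar>?\<kappa> 1 s\<bar> powr r)"
      by (rule set_integrable_subset) auto
    from Sobolev_finite[OF r(1) this] show ?thesis by (simp add: numeral_3_eq_3)
  qed
  have "\<not> Sobolev (1 + 2) (ereal ((p - 1) / (p - 2))) 0 L \<gamma>"
    using p by (intro not_Sobolev_critical[OF fr']) (auto simp: divide_simps mult.commute)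
  then show "\<not> Sobolev 3 (ereal ((p - 1) / (p - 2))) 0 L \<gamma>" by (simp add: numeral_3_eq_3)
qed

text \<open>Positivity comes from a radicand that never vanishes for q < 1. Continuity uses
  \<open>amplitude\<close> for the second incomplete integral, whose integrand is at least
  1.\<close>

lemma dn_continuous_pos: "continuous_on UNIV (\<lambda>x. dn_p p x q)" "dn_p p x q > 0"
proof -
  define h where "h \<theta> = 1 / (1 - q\<^sup>2 * (sin \<theta>)\<^sup>2) powr (1 / p)" for \<theta>
  have cont: "continuous_on A (\<lambda>\<theta>. (1 - q\<^sup>2 * (sin \<theta>)\<^sup>2) powr (1 / p))" for A
    by (intro continuous_intros continuous_on_powr) (use radicand_pos in \<open>auto simp: less_imp_neq[symmetric]\<close>)
  have conth: "continuous_on A h" for A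
    unfolding h_def using cont radicand_pos by (intro continuous_on_divide continuous_on_const) (auto simp: less_imp_neq[symmetric])
  interpret dn: amplitude h "F2_p p q"
  proof
    show "h \<in> borel_measurable borel"
      by (rule borel_measurable_continuous_onI[OF conth])
    show "set_integrable lebesgue {a..b} h" for a b
      by (rule absolutely_integrable_continuous_real[OF conth])
    show "(cos \<theta>)\<^sup>2 \<le> h \<theta>" for \<theta>
    proof -
      have "(1 - q\<^sup>2 * (sin \<theta>)\<^sup>2) powr (1 / p) \<le> 1"
        using radicand_pos[of \<theta>] p by (intro powr_le1) auto
      then have "1 \<le> h \<theta>"
        using radicand_pos[of \<theta>] by (simp add: h_def)
      moreover have "(cos \<theta>)\<^sup>2 \<le> 1" by (simp add: abs_square_le_1)
      ultimately show ?thesis by linarith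
    qed
  qed (use q in \<open>simp add: F2_p_def h_def\<close>)
  have "am2_p p q = dn.am" by (simp add: am2_p_def dn.am_def)
  then show "continuous_on UNIV (\<lambda>x. dn_p p x q)"
    unfolding dn_p_def by (simp add: continuous_on_compose2[OF cont[of UNIV] dn.continuous_on_am])
  show "dn_p p x q > 0"
    using radicand_pos by (simp add: dn_p_def less_imp_neq[symmetric])
qed

end

section \<open>Chains of loops and segments in flat-core curves\<close>

lemma loop_centre_gap:
  assumes "1 \<le> i" "i < j" "j \<le> N" "\<And>k. k \<in> {1..N} \<Longrightarrow> Ls k \<ge> 0" "K_p1 p > 0"
  shows "loop_centre p Ls j - loop_centre p Ls i \<ge> 2 * K_p1 p"
proof -
  have "(\<Sum>k=1..i. Ls k) \<le> (\<Sum>k=1..j. Ls k)"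
    using assms by (intro sum_mono2) auto
  moreover have "2 * real i + 2 \<le> 2 * real j" using assms(2) by simp
  then have "(2 * real i + 2 - 1) * K_p1 p \<le> (2 * real j - 1) * K_p1 p"
    using assms(5) by (intro mult_right_mono) auto
  ultimately show ?thesis
    by (simp add: loop_centre_def algebra_simps)
qed

context flat
begin

text \<open>\<open>v\<close> is the position relative to the centre of a loop, and \<epsilon> the
  direction of motion. Multiplying by \<epsilon> turns the motion to the right: left of - K one
  stays outside, from [- K, K) one is inside immediately afterwards, and from K on one is outside.
  Entering from outside is possible only at the end - K, that is at v = - \<epsilon> K.\<close>

lemma inside_or_outside:
  assumes \<epsilon>: "\<epsilon> \<in> {1, - 1}" and "c > 0"
  shows "(\<forall>\<^sub>F t in at_right 0. \<bar>v + \<epsilon> * (c * t)\<bar> < K) \<and> (K \<le> \<bar>v\<bar> \<longrightarrow> v = - \<epsilon> * K) \<or>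
    (\<forall>\<^sub>F t in at_right 0. K \<le> \<bar>v + \<epsilon> * (c * t)\<bar>)"
proof -
  define x where "x = \<epsilon> * v"
  have v: "v = \<epsilon> * x" using \<epsilon> by (auto simp: x_def)
  have abs: "\<bar>v + \<epsilon> * (c * t)\<bar> = \<bar>x + c * t\<bar>" for t
  proof -
    have "v + \<epsilon> * (c * t) = \<epsilon> * (x + c * t)" by (simp add: v algebra_simps)
    then show ?thesis using \<epsilon> by (auto simp: abs_mult)
  qed
  consider "x < - K" | "- K \<le> x" "x < K" | "K \<le> x" by linarith
  then show ?thesis
  proof cases
    case 1
    then have "\<forall>\<^sub>F t in at_right 0. t \<in> {0<..<(- K - x) / c}"
      using \<open>c > 0\<close> by (intro eventually_at_right_real) simp
    then have "\<forall>\<^sub>F t in at_right 0. K \<le> \<bar>v + \<epsilon> * (c * t)\<bar>"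
    proof eventually_elim
      case (elim t)
      then have "c * t < - K - x" using \<open>c > 0\<close> by (auto simp: field_simps)
      then show ?case unfolding abs by simp
    qed
    then show ?thesis by blast
  next
    case 2
    then have "\<forall>\<^sub>F t in at_right 0. t \<in> {0<..<(K - x) / c}"
      using \<open>c > 0\<close> by (intro eventually_at_right_real) simp
    then have "\<forall>\<^sub>F t in at_right 0. \<bar>v + \<epsilon> * (c * t)\<bar> < K"
    proof eventually_elim
      case (elim t)
      then have "c * t < K - x" "c * t > 0" using \<open>c > 0\<close> by (auto simp: field_simps)
      then show ?case unfolding abs using 2 by (simp add: abs_less_iff)
    qed
    moreover have "v = - \<epsilon> * K" if "K \<le> \<bar>v\<bar>"
    proof -
      have "\<bar>v\<bar> = \<bar>x\<bar>" using \<epsilon> by (auto simp: v abs_mult)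
      then have "x = - K" using that 2 by auto
      then show ?thesis by (simp add: v)
    qed
    ultimately show ?thesis by blast
  next
    case 3
    have "\<forall>\<^sub>F t in at_right 0. K \<le> \<bar>v + \<epsilon> * (c * t)\<bar>"
      using eventually_at_right_less[of 0]
    proof eventually_elim
      case (elim t)
      then have "c * t > 0" using \<open>c > 0\<close> by simp
      then show ?case unfolding abs using 3 by simp
    qed
    then show ?thesis by blast
  qed
qed

definition M :: nat where "M = M_p p"

text \<open>The orders below \<open>M\<close> are exactly those with positive exponent \<alpha> - i.
  This is used twice: \<open>f i\<close> is continuous for them, and no factor of the endpoint value
  of \<open>P M\<close> vanishes.\<close>

lemma less_M_iff: "i < M \<longleftrightarrow> real i < \<alpha>"
proof -
  have "i < M \<longleftrightarrow> int i < \<lceil>\<alpha>\<rceil>" by (auto simp: M_def M_p_def \<alpha>_def)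
  also have "\<dots> \<longleftrightarrow> real i < \<alpha>" by (simp add: less_ceiling_iff)
  finally show ?thesis .
qed

lemma M_bounds: "\<alpha> \<le> real M" "real M < \<alpha> + 1" "M > 0"
proof -
  have "M = nat \<lceil>\<alpha>\<rceil>" by (simp add: M_def M_p_def \<alpha>_def)
  moreover have "\<lceil>\<alpha>\<rceil> > 0" using \<alpha>_pos by (simp only: zero_less_ceiling)
  ultimately have M: "int M = \<lceil>\<alpha>\<rceil>" by simp
  then have "real M = of_int \<lceil>\<alpha>\<rceil>" by (metis of_int_of_nat_eq)
  then show "\<alpha> \<le> real M" "real M < \<alpha> + 1" by (auto simp: ceiling_less_iff) linarith
  show "M > 0" using less_M_iff[of 0] \<alpha>_pos by simp
qed

lemma M_eq_iff: "real M = \<alpha> \<longleftrightarrow> \<alpha> \<in> \<int>"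
proof
  assume "real M = \<alpha>"
  then show "\<alpha> \<in> \<int>" by (metis Ints_of_nat)
next
  assume "\<alpha> \<in> \<int>"
  then obtain i where i: "\<alpha> = of_int i" by (auto elim: Ints_cases)
  have "M = nat \<lceil>\<alpha>\<rceil>" by (simp add: M_def M_p_def \<alpha>_def)
  then have "int M = i" using \<alpha>_pos i by simp
  then show "real M = \<alpha>" using i by (metis of_int_of_nat_eq)
qed

lemma f_M_bounded:
  assumes "\<alpha> = real M"
  obtains B where "\<And>x. \<bar>f M x\<bar> \<le> B" "B \<ge> 0"
proof -
  have "bounded (poly (P M) ` {- 1..1})"
    by (intro compact_imp_bounded compact_continuous_image continuous_on_poly continuous_on_id) simp
  then obtain B where B: "\<forall>y\<in>poly (P M) ` {- 1..1}. norm y \<le> B"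
    unfolding bounded_iff by blast
  have "\<bar>f M x\<bar> \<le> B" for x
  proof -
    have "\<bar>poly (P M) (sin (A x))\<bar> \<le> B" using B by simp
    \<comment> \<open>The factor is 1 inside the loop and 0 outside, as \<open>0 powr 0 = 0\<close>;
      it carries the jump at the ends.\<close>
    moreover have "g x powr 0 \<le> 1" by simp
    ultimately have "g x powr 0 * \<bar>poly (P M) (sin (A x))\<bar> \<le> 1 * B"
      by (intro mult_mono) auto
    then show ?thesis by (simp add: f_def assms abs_mult)
  qed
  moreover from this[of 0] have "B \<ge> 0" by simp
  ultimately show ?thesis using that by blast
qed

end

locale flat_chain = flat +
  fixes N :: nat and sg Ls :: "nat \<Rightarrow> real"
  assumes sg: "\<And>j. j \<in> {1..N} \<Longrightarrow> sg j \<in> {1, - 1}" and Ls: "\<And>j. j \<in> {1..N} \<Longrightarrow> Ls j \<ge> 0"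
begin

abbreviation "ctr j \<equiv> loop_centre p Ls j"

definition H :: "nat \<Rightarrow> real \<Rightarrow> real" where
  "H i u = (\<Sum>j=1..N. sg j * 2 * f i (u - ctr j))"

lemma H_0: "H 0 = flat_core_curvature p N sg Ls"
  by (simp add: H_def flat_core_curvature_def f_0 fun_eq_iff)

lemma loops_disjoint:
  assumes "i \<in> {1..N}" "j \<in> {1..N}" "i \<noteq> j" "\<bar>u - ctr i\<bar> < K"
  shows "K \<le> \<bar>u - ctr j\<bar>"
proof -
  have "2 * K \<le> \<bar>ctr j - ctr i\<bar>"
  proof (cases "i < j")
    case True
    then show ?thesis using loop_centre_gap[of i j N Ls p] assms Ls K_pos by auto
  next
    case False
    then show ?thesis using loop_centre_gap[of j i N Ls p] assms Ls K_pos by auto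
  qed
  then show ?thesis using assms(4) by auto
qed

lemma H_inside:
  assumes j: "j \<in> {1..N}" and "\<bar>u - ctr j\<bar> < K"
  shows "H i u = sg j * 2 * f i (u - ctr j)"
proof -
  have "f i (u - ctr k) = 0" if "k \<in> {1..N} - {j}" for k
    using loops_disjoint[OF j, of k u] that assms(2) by (intro f_outside) auto
  then show ?thesis
    unfolding H_def by (subst sum.remove[OF _ j]) auto
qed

lemma H_outside: "(\<And>j. j \<in> {1..N} \<Longrightarrow> K \<le> \<bar>u - ctr j\<bar>) \<Longrightarrow> H i u = 0"
  by (auto simp: H_def f_outside intro!: sum.neutral)

lemma H_0_neq_0: "j \<in> {1..N} \<Longrightarrow> \<bar>u - ctr j\<bar> < K \<Longrightarrow> H 0 u \<noteq> 0"
  using f_0_pos[of "u - ctr j"] sg[of j] by (auto simp: H_inside)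

text \<open>Inside a loop \<open>sech_p\<close> is positive, and open loops are disjoint, so
  contributions of opposite sign cannot cancel. A zero therefore lies outside all open loops, where
  every summand of every order is 0.\<close>

lemma H_zero_all: "H 0 u = 0 \<Longrightarrow> H i u = 0"
  by (rule H_outside) (use H_0_neq_0 in force)

lemma continuous_on_H: "i < M \<Longrightarrow> continuous_on S (H i)"
  unfolding H_def
  by (intro continuous_intros continuous_on_compose2[OF continuous_on_f[of i UNIV]]) (auto simp: less_M_iff)

lemma H_has_derivative:
  assumes "\<And>j. j \<in> {1..N} \<Longrightarrow> \<bar>u - ctr j\<bar> \<noteq> K"
  shows "(H i has_real_derivative H (Suc i) u) (at u)"
proof -
  have "((\<lambda>u. sg j * 2 * f i (u - ctr j)) has_real_derivative sg j * 2 * f (Suc i) (u - ctr j)) (at u)"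
    if "j \<in> {1..N}" for j
  proof -
    have "((\<lambda>u. f i (u - ctr j)) has_real_derivative f (Suc i) (u - ctr j) * 1) (at u)"
      by (rule DERIV_chain2[where f = "f i" and g = "\<lambda>u. u - ctr j"])
        (auto intro!: derivative_eq_intros f_has_derivative assms that)
    from DERIV_cmult[OF this, of "sg j * 2"] show ?thesis by simp
  qed
  then show ?thesis
    unfolding H_def[abs_def] by (intro DERIV_sum) auto
qed

lemma H_bigo: "H M \<in> O[at x](\<lambda>y. \<bar>y - x\<bar> powr (- (real M - \<alpha>)))"
  unfolding H_def
proof (rule big_sum_in_bigo)
  fix j
  have "(\<lambda>u. f M (1 * u + (- ctr j))) \<in> O[at x](\<lambda>y. \<bar>y - x\<bar> powr (- (real M - \<alpha>)))"
    using f_bigo[OF M_bounds(1), of "1 * x + - ctr j"] by (intro bigo_powr_affine) simp_all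
  then show "(\<lambda>u. sg j * 2 * f M (u - ctr j)) \<in> O[at x](\<lambda>y. \<bar>y - x\<bar> powr (- (real M - \<alpha>)))"
    by simp
qed

definition flat_curvature :: "real \<Rightarrow> real \<Rightarrow> real \<Rightarrow> real \<Rightarrow> nat \<Rightarrow> real \<Rightarrow> real" where
  "flat_curvature c e \<sigma> d i s = \<sigma> * c * (e * c) ^ i * H i (e * c * s + d)"

text \<open>On each side of a point the curve either runs outside all loops or within a single one.
  If the curvature is zero at the point itself, that loop is being entered at one of its ends, where
  the endpoint limit gives the exact order of the derivative of order \<open>M\<close>.\<close>

lemma flat_sided:
  assumes nf: "normal_form L \<gamma> T (flat_core_curvature p N sg Ls) c e \<sigma> d"
  defines "S \<equiv> (\<Union>j\<in>{1..N}. {s. \<bar>e * c * s + d - ctr j\<bar> = K})"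
  shows "finite S" "continuous_on (C - S) (flat_curvature c e \<sigma> d M)"
    "flat_curvature c e \<sigma> d M \<in> O[at z](\<lambda>s. \<bar>s - z\<bar> powr (- (real M - \<alpha>)))"
    "sided_curvature L \<gamma> T (flat_curvature c e \<sigma> d) M S (real M - \<alpha>)"
proof -
  interpret normal_form L \<gamma> T "flat_core_curvature p N sg Ls" c e \<sigma> d by (rule nf)
  let ?\<kappa> = "flat_curvature c e \<sigma> d" and ?\<beta> = "real M - \<alpha>"
  have e0: "e \<noteq> 0" using e by auto
  show fin: "finite S"
    unfolding S_def
  proof (rule finite_UN_I)
    fix j
    have "{s. \<bar>e * c * s + d - ctr j\<bar> = K} \<subseteq> {(K + ctr j - d) / (e * c), (- K + ctr j - d) / (e * c)}"
      using e0 c_pos by (auto simp: abs_if field_simps split: if_splits)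
    then show "finite {s. \<bar>e * c * s + d - ctr j\<bar> = K}"
      by (rule finite_subset) simp
  qed simp
  have deriv: "(?\<kappa> i has_real_derivative ?\<kappa> (Suc i) s) (at s)" if "s \<notin> S" for i s
  proof -
    have "(H i has_real_derivative H (Suc i) (e * c * s + d)) (at (e * c * s + d))"
      using that by (intro H_has_derivative) (auto simp: S_def)
    then have "((\<lambda>s. H i (e * c * s + d)) has_real_derivative H (Suc i) (e * c * s + d) * (e * c)) (at s)"
      by (rule DERIV_chain2) (auto intro!: derivative_eq_intros)
    from DERIV_cmult[OF this, of "\<sigma> * c * (e * c) ^ i"] show ?thesis
      by (simp add: flat_curvature_def[abs_def] mult_ac)
  qed
  show cont: "continuous_on (C - S) (?\<kappa> M)" for C
    using deriv by (auto intro!: continuous_at_imp_continuous_on DERIV_isCont)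
  show bigo: "?\<kappa> M \<in> O[at z](\<lambda>s. \<bar>s - z\<bar> powr (- ?\<beta>))" for z
  proof -
    have "(\<lambda>s. H M (e * c * s + d)) \<in> O[at z](\<lambda>s. \<bar>s - z\<bar> powr (- ?\<beta>))"
      by (rule bigo_powr_affine[OF H_bigo ec_neq_0])
    then show ?thesis by (simp add: flat_curvature_def[abs_def])
  qed
  have int: "set_integrable lebesgue {0..L} (?\<kappa> M)"
    by (rule set_integrable_of_bigo[OF fin cont _ bigo]) (use M_bounds in auto)
  show "sided_curvature L \<gamma> T ?\<kappa> M S ?\<beta>"
  proof
    show "0 < L" by (rule L_pos)
    show "finite S" by (rule fin)
    show "(\<gamma> has_vector_derivative T s) (at s within {0..L})" if "s \<in> {0..L}" for s
      by (rule d\<gamma>[OF that])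
    show "(T has_vector_derivative ?\<kappa> 0 s *\<^sub>R perp (T s)) (at s within {0..L})" if "s \<in> {0..L}" for s
      using dT[OF that] by (simp add: flat_curvature_def H_0)
    show "norm (T s) = 1" if "s \<in> {0..L}" for s by (rule nT[OF that])
    show "continuous_on {0..L} (?\<kappa> j)" if "j < M" for j
      unfolding flat_curvature_def
      by (intro continuous_intros continuous_on_compose2[OF continuous_on_H[OF that, of UNIV]]) auto
    show "(?\<kappa> j has_real_derivative ?\<kappa> (Suc j) s) (at s)" if "j < M" "s \<in> {0<..<L} - S" for j s
      using that by (intro deriv) auto
    show "set_integrable lebesgue {0<..<L} (?\<kappa> M)"
      by (rule set_integrable_subset[OF int]) auto
    show "M > 0" by (rule M_bounds)
    show "(\<forall>\<^sub>F t in at_right 0. ?\<kappa> 0 (z + e' * t) = 0) \<or>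
      (\<forall>\<^sub>F t in at_right 0. ?\<kappa> 0 (z + e' * t) \<noteq> 0) \<and>
        (?\<kappa> 0 z = 0 \<longrightarrow> (\<exists>v. v \<noteq> 0 \<and> ((\<lambda>t. ?\<kappa> M (z + e' * t) * t powr ?\<beta>) \<longlongrightarrow> v) (at_right 0)))"
      if e': "e' \<in> {1, - 1}" for z e'
    proof -
      \<comment> \<open>The direction in the model parameter: it combines the side \<open>e'\<close>
        with the orientation \<open>e\<close> of the reparametrization.\<close>
      define \<epsilon> where "\<epsilon> = e * e'"
      have \<epsilon>: "\<epsilon> \<in> {1, - 1}" using e e' by (auto simp: \<epsilon>_def)
      define v where "v j = e * c * z + d - ctr j" for j
      have u: "e * c * (z + e' * t) + d - ctr j = v j + \<epsilon> * (c * t)" for t j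
        by (simp add: v_def \<epsilon>_def algebra_simps)
      show ?thesis
      proof (cases "\<exists>j\<in>{1..N}. (\<forall>\<^sub>F t in at_right 0. \<bar>v j + \<epsilon> * (c * t)\<bar> < K) \<and> (K \<le> \<bar>v j\<bar> \<longrightarrow> v j = - \<epsilon> * K)")
        case False
        then have "\<forall>j\<in>{1..N}. \<forall>\<^sub>F t in at_right 0. K \<le> \<bar>v j + \<epsilon> * (c * t)\<bar>"
          using inside_or_outside[OF \<epsilon> c_pos] by blast
        then have "\<forall>\<^sub>F t in at_right 0. \<forall>j\<in>{1..N}. K \<le> \<bar>v j + \<epsilon> * (c * t)\<bar>"
          by (intro eventually_ball_finite) auto
        then have "\<forall>\<^sub>F t in at_right 0. ?\<kappa> 0 (z + e' * t) = 0"
        proof eventually_elim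
          case (elim t)
          then have "H 0 (e * c * (z + e' * t) + d) = 0"
            by (intro H_outside) (simp only: u)
          then show ?case by (simp add: flat_curvature_def)
        qed
        then show ?thesis by blast
      next
        case True
        then obtain j where j: "j \<in> {1..N}" and inside: "\<forall>\<^sub>F t in at_right 0. \<bar>v j + \<epsilon> * (c * t)\<bar> < K"
          and vj: "K \<le> \<bar>v j\<bar> \<Longrightarrow> v j = - \<epsilon> * K" by blast
        have ne: "\<forall>\<^sub>F t in at_right 0. ?\<kappa> 0 (z + e' * t) \<noteq> 0"
          using inside
        proof eventually_elim
          case (elim t)
          then have "H 0 (e * c * (z + e' * t) + d) \<noteq> 0"
            by (intro H_0_neq_0[OF j]) (simp only: u)
          then show ?case using \<sigma>c_neq_0 by (simp add: flat_curvature_def)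
        qed
        have "\<exists>v. v \<noteq> 0 \<and> ((\<lambda>t. ?\<kappa> M (z + e' * t) * t powr ?\<beta>) \<longlongrightarrow> v) (at_right 0)" if "?\<kappa> 0 z = 0"
        proof -
          have "H 0 (e * c * z + d) = 0" using that \<sigma>c_neq_0 by (simp add: flat_curvature_def)
          then have "K \<le> \<bar>v j\<bar>" using H_0_neq_0[OF j] by (force simp: v_def)
          then have vj': "v j = - \<epsilon> * K" by (rule vj)
          define l where "l = b powr (\<alpha> - real M) * poly (P M) (- \<epsilon>)"
          have "poly (P M) (- \<epsilon>) \<noteq> 0"
            using \<epsilon> by (intro poly_P_endpoint_neq_0) (auto simp: less_M_iff)
          then have l: "l \<noteq> 0" using b_pos by (simp add: l_def)
          have "- \<epsilon> \<in> {1, - 1}" using \<epsilon> by auto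
          from filterlim_compose[OF f_endpoint_tendsto[OF this, of M] filterlim_scale_at_right[OF c_pos]]
          have "((\<lambda>t. f M (- \<epsilon> * (K - c * t)) * (c * t) powr ?\<beta>) \<longlongrightarrow> l) (at_right 0)"
            by (simp add: l_def)
          \<comment> \<open>The power of \<open>c\<close> compensates for measuring the distance as
            \<open>c * t\<close> in the model instead of \<open>t\<close> on the curve.\<close>
          from tendsto_mult_left[OF this, of "\<sigma> * c * (e * c) ^ M * (sg j * 2) * c powr (- ?\<beta>)"]
          have lim: "((\<lambda>t. \<sigma> * c * (e * c) ^ M * (sg j * 2) * c powr (- ?\<beta>) * (f M (- \<epsilon> * (K - c * t)) * (c * t) powr ?\<beta>))
              \<longlongrightarrow> \<sigma> * c * (e * c) ^ M * (sg j * 2) * c powr (- ?\<beta>) * l) (at_right 0)" .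
          have "\<forall>\<^sub>F t in at_right 0. \<sigma> * c * (e * c) ^ M * (sg j * 2) * c powr (- ?\<beta>) *
              (f M (- \<epsilon> * (K - c * t)) * (c * t) powr ?\<beta>) = ?\<kappa> M (z + e' * t) * t powr ?\<beta>"
            using inside eventually_at_right_less[of 0]
          proof eventually_elim
            case (elim t)
            have arg: "- \<epsilon> * (K - c * t) = e * c * (z + e' * t) + d - ctr j"
              unfolding u vj' by (simp add: algebra_simps)
            have HM: "H M (e * c * (z + e' * t) + d) = sg j * 2 * f M (e * c * (z + e' * t) + d - ctr j)"
              using elim by (intro H_inside[OF j]) (simp only: u)
            have "c powr (- ?\<beta>) * (c * t) powr ?\<beta> = (c powr (- ?\<beta>) * c powr ?\<beta>) * t powr ?\<beta>"
              using elim c_pos by (simp add: powr_mult)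
            also have "c powr (- ?\<beta>) * c powr ?\<beta> = 1"
              using c_pos by (simp flip: powr_add)
            finally have pw: "c powr (- ?\<beta>) * (c * t) powr ?\<beta> = t powr ?\<beta>" by simp
            have "\<sigma> * c * (e * c) ^ M * (sg j * 2) * c powr (- ?\<beta>) * (f M (- \<epsilon> * (K - c * t)) * (c * t) powr ?\<beta>) =
                \<sigma> * c * (e * c) ^ M * (sg j * 2 * f M (- \<epsilon> * (K - c * t))) * (c powr (- ?\<beta>) * (c * t) powr ?\<beta>)"
              by (simp only: mult_ac)
            also have "\<dots> = ?\<kappa> M (z + e' * t) * t powr ?\<beta>"
              unfolding pw arg flat_curvature_def HM ..
            finally show ?case .
          qed
          from Lim_transform_eventually[OF lim this]
          have "((\<lambda>t. ?\<kappa> M (z + e' * t) * t powr ?\<beta>) \<longlongrightarrow>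
              \<sigma> * c * (e * c) ^ M * (sg j * 2) * c powr (- ?\<beta>) * l) (at_right 0)" .
          moreover have "\<sigma> * c * (e * c) ^ M * (sg j * 2) * c powr (- ?\<beta>) * l \<noteq> 0"
            using \<sigma>c_neq_0 ec_neq_0 sg[OF j] l c_pos by auto
          ultimately show ?thesis by blast
        qed
        with ne show ?thesis by blast
      qed
    qed
  qed
qed

lemma flat_regularity:
  assumes nf: "normal_form L \<gamma> T (flat_core_curvature p N sg Ls) c e \<sigma> d"
    and k: "is_continuous_curvature L \<gamma> k"
    and fr: "top_of_set {0..L} frontier_of {s \<in> {0..L}. k s = 0} \<noteq> {}"
  shows "\<alpha> \<notin> \<int> \<Longrightarrow> 1 \<le> r \<Longrightarrow> r < 1 / (real M - \<alpha>) \<Longrightarrow> Sobolev (M + 2) (ereal r) 0 L \<gamma>"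
    and "\<alpha> \<notin> \<int> \<Longrightarrow> \<not> Sobolev (M + 2) (ereal (1 / (real M - \<alpha>))) 0 L \<gamma>"
    and "\<alpha> \<in> \<int> \<Longrightarrow> Sobolev (M + 2) \<infinity> 0 L \<gamma>"
    and "\<not> discrete {s \<in> {0..L}. k s = 0} \<longleftrightarrow> (\<exists>a b. a < b \<and> {a..b} \<subseteq> {s \<in> {0..L}. k s = 0})"
    and "\<alpha> \<in> \<int> \<Longrightarrow> \<not> discrete {s \<in> {0..L}. k s = 0} \<Longrightarrow> \<not> Sobolev (M + 3) 1 0 L \<gamma>"
proof -
  interpret normal_form L \<gamma> T "flat_core_curvature p N sg Ls" c e \<sigma> d by (rule nf)
  let ?\<kappa> = "flat_curvature c e \<sigma> d" and ?\<beta> = "real M - \<alpha>"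
  define S where "S = (\<Union>j\<in>{1..N}. {s. \<bar>e * c * s + d - ctr j\<bar> = K})"
  note S = flat_sided[OF nf, folded S_def]
  interpret sided_curvature L \<gamma> T ?\<kappa> M S ?\<beta> by (rule S)
  have Z: "{s \<in> {0..L}. k s = 0} = {s \<in> {0..L}. ?\<kappa> 0 s = 0}"
    using continuous_curvature_eq[OF k cont_\<kappa>0] by auto
  note fr' = fr[unfolded Z]
  show "Sobolev (M + 2) (ereal r) 0 L \<gamma>" if "\<alpha> \<notin> \<int>" and r: "1 \<le> r" "r < 1 / ?\<beta>"
  proof -
    have \<beta>: "?\<beta> > 0" using M_bounds M_eq_iff that(1) by force
    have "set_integrable lebesgue {0..L} (\<lambda>s. \<bar>?\<kappa> M s\<bar> powr r)"
    proof (rule set_integrable_powr_of_bigo[OF S(1,2) _ _ S(3)])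
      show "?\<beta> * r < 1" using r(2) \<beta> by (simp add: pos_less_divide_eq mult.commute)
    qed (use r in simp)
    then have "set_integrable lebesgue {0<..<L} (\<lambda>s. \<bar>?\<kappa> M s\<bar> powr r)"
      by (rule set_integrable_subset) auto
    then show ?thesis by (rule Sobolev_finite[OF r(1)])
  qed
  show "\<not> Sobolev (M + 2) (ereal (1 / ?\<beta>)) 0 L \<gamma>" if "\<alpha> \<notin> \<int>"
  proof -
    have "?\<beta> > 0" using M_bounds M_eq_iff that by force
    then show ?thesis
      using M_bounds(2) by (intro not_Sobolev_critical[OF fr']) (auto simp: pos_le_divide_eq)
  qed
  show "Sobolev (M + 2) \<infinity> 0 L \<gamma>" if int: "\<alpha> \<in> \<int>"
  proof -
    obtain B where B: "\<And>x. \<bar>f M x\<bar> \<le> B" "B \<ge> 0"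
      using f_M_bounded[OF M_eq_iff[THEN iffD2, OF int, symmetric]] by blast
    have "\<bar>?\<kappa> M s\<bar> \<le> \<bar>\<sigma> * c * (e * c) ^ M\<bar> * (\<Sum>j=1..N. \<bar>sg j * 2\<bar> * B)" for s
    proof -
      have "\<bar>H M (e * c * s + d)\<bar> \<le> (\<Sum>j=1..N. \<bar>sg j * 2 * f M (e * c * s + d - ctr j)\<bar>)"
        unfolding H_def by (rule sum_abs)
      also have "\<dots> \<le> (\<Sum>j=1..N. \<bar>sg j * 2\<bar> * B)"
        unfolding abs_mult[of "sg _ * 2"] by (intro sum_mono mult_left_mono B) simp
      finally show ?thesis
        unfolding flat_curvature_def abs_mult[of "\<sigma> * c * (e * c) ^ M"] by (rule mult_left_mono) simp
    qed
    then show ?thesis by (rule Sobolev_infinity)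
  qed
  show disc: "\<not> discrete {s \<in> {0..L}. k s = 0} \<longleftrightarrow> (\<exists>a b. a < b \<and> {a..b} \<subseteq> {s \<in> {0..L}. k s = 0})"
    unfolding Z by (rule not_discrete_zeros_iff)
  show "\<not> Sobolev (M + 3) 1 0 L \<gamma>" if int: "\<alpha> \<in> \<int>" and nd: "\<not> discrete {s \<in> {0..L}. k s = 0}"
  proof -
    obtain a b where "a < b" "{a..b} \<subseteq> {s \<in> {0..L}. ?\<kappa> 0 s = 0}"
      using disc nd unfolding Z by blast
    moreover have "?\<beta> = 0" using M_eq_iff int by simp
    moreover have "?\<kappa> i s = 0" if "?\<kappa> 0 s = 0" for i s
      using that \<sigma>c_neq_0 H_zero_all[of "e * c * s + d" i] by (simp add: flat_curvature_def)
    ultimately show ?thesis using not_Sobolev_flat[OF _ _ fr'] by blast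
  qed
qed

end

theorem theorem1p9:
  fixes p L :: real and \<gamma> :: "real \<Rightarrow> real^2" and k :: "real \<Rightarrow> real" and Z :: "real set"
  assumes "p > 2" and "L > 0"
    and "arclength_p_elastica p L \<gamma>"
    and "is_continuous_curvature L \<gamma> k"
    and "Z = {s \<in> {0..L}. k s = 0}"
    and "top_of_set {0..L} frontier_of Z \<noteq> {}"
  shows
    "(linear_type L \<gamma> \<or> orbitlike p L \<gamma> \<or> circular L \<gamma> \<longrightarrow> real_analytic_on \<gamma> {0..L}) \<and>
     (wavelike p L \<gamma> \<longrightarrow>
        (\<forall>r::real. 1 \<le> r \<and> r < (p - 1) / (p - 2) \<longrightarrow> Sobolev 3 (ereal r) 0 L \<gamma>) \<and>
        \<not> Sobolev 3 (ereal ((p - 1) / (p - 2))) 0 L \<gamma>) \<and>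
     1 \<le> M_p p \<and> 1 < R_p p \<and>
     (flat_core p L \<gamma> \<longrightarrow>
        (2 / (p - 2) \<notin> \<int> \<longrightarrow>
           (\<forall>r::real. 1 \<le> r \<and> ereal r < R_p p \<longrightarrow> Sobolev (M_p p + 2) (ereal r) 0 L \<gamma>) \<and>
           \<not> Sobolev (M_p p + 2) (R_p p) 0 L \<gamma>) \<and>
        (2 / (p - 2) \<in> \<int> \<longrightarrow>
           Sobolev (M_p p + 2) \<infinity> 0 L \<gamma> \<and>
           (\<not> discrete Z \<longleftrightarrow> (\<exists>a b. a < b \<and> {a..b} \<subseteq> Z)) \<and>
           (\<not> discrete Z \<longrightarrow> \<not> Sobolev (M_p p + 3) 1 0 L \<gamma>)))"
proof -
  have fl: "flat p" by unfold_locales (rule assms(1))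
  interpret flat p by (rule fl)
  have unit: "norm (vector_derivative \<gamma> (at s within {0..L})) = 1" if "s \<in> {0..L}" for s
    using assms(3) that by (simp add: arclength_p_elastica_def)
  have normal: "\<exists>T c e \<sigma> d. normal_form L \<gamma> T \<kappa> c e \<sigma> d" if rep: "represented_by_curvature D \<kappa> L \<gamma>" for D \<kappa>
    using represented_normal_form[OF rep assms(2) unit] assms(2)
    unfolding normal_form_def by metis
  have fr: "top_of_set {0..L} frontier_of {s \<in> {0..L}. k s = 0} \<noteq> {}"
    using assms(5,6) by simp
  \<comment> \<open>The zero set would be all of \<open>{0..L}\<close> or empty, and either has
    empty relative frontier, against the assumption on \<open>Z\<close>.\<close>
  have trivial: False if rep: "represented_by_curvature UNIV \<kappa> L \<gamma>" and \<kappa>: "continuous_on UNIV \<kappa>"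
    and sgn: "(\<forall>x. \<kappa> x = 0) \<or> (\<forall>x. \<kappa> x \<noteq> 0)" for \<kappa>
  proof -
    obtain T c e \<sigma> d where nf: "normal_form L \<gamma> T \<kappa> c e \<sigma> d"
      using normal[OF rep] by blast
    note k = normal_form.curvature_eq[OF nf assms(4) \<kappa>]
    from sgn show False
    proof
      assume "\<forall>x. \<kappa> x = 0"
      then have "{s \<in> {0..L}. k s = 0} = topspace (top_of_set {0..L})" using k by auto
      then show False using fr frontier_of_topspace[of "top_of_set {0..L}"] by simp
    next
      assume "\<forall>x. \<kappa> x \<noteq> 0"
      then have empty: "{s \<in> {0..L}. k s = 0} = {}"
        using k normal_form.\<sigma>c_neq_0[OF nf] by auto
      show False using fr unfolding empty by simp
    qed
  qed
  have "\<not> (linear_type L \<gamma> \<or> orbitlike p L \<gamma> \<or> circular L \<gamma>)"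
  proof
    assume "linear_type L \<gamma> \<or> orbitlike p L \<gamma> \<or> circular L \<gamma>"
    then consider "linear_type L \<gamma>" | "orbitlike p L \<gamma>" | "circular L \<gamma>" by blast
    then show False
    proof cases
      case 1
      then show False unfolding linear_type_def by (rule trivial) auto
    next
      case 2
      then obtain q where q: "0 < q" "q < 1" and rep: "represented_by_curvature UNIV (\<lambda>s. 2 * dn_p p s q) L \<gamma>"
        by (auto simp: orbitlike_def)
      have "wave p q" by unfold_locales (use assms(1) q in auto)
      note dn = wave.dn_continuous_pos[OF this]
      show False
        using dn by (intro trivial[OF rep]) (auto intro!: continuous_intros simp: less_imp_neq[symmetric])
    next
      case 3
      then show False unfolding circular_def by (rule trivial) auto
    qed
  qed
  moreover have "(\<forall>r::real. 1 \<le> r \<and> r < (p - 1) / (p - 2) \<longrightarrow> Sobolev 3 (ereal r) 0 L \<gamma>) \<and>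
        \<not> Sobolev 3 (ereal ((p - 1) / (p - 2))) 0 L \<gamma>" if wv: "wavelike p L \<gamma>"
  proof -
    obtain q where q: "0 < q" "q < 1" and rep: "represented_by_curvature UNIV (\<lambda>s. 2 * q * cn_p p s q) L \<gamma>"
      using wv by (auto simp: wavelike_def)
    have w: "wave p q" by unfold_locales (use assms(1) q in auto)
    obtain T c e \<sigma> d where "normal_form L \<gamma> T (\<lambda>s. 2 * q * cn_p p s q) c e \<sigma> d"
      using normal[OF rep] by blast
    from wave.wave_regularity[OF w this assms(4) fr] show ?thesis by blast
  qed
  moreover have M: "1 \<le> M_p p" using M_bounds(3) by (simp add: M_def)
  moreover have R: "R_p p = (if \<alpha> \<in> \<int> then \<infinity> else ereal (1 / (real M - \<alpha>)))"
    by (simp add: R_p_def \<alpha>_def M_def)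
  have "1 < R_p p"
  proof (cases "\<alpha> \<in> \<int>")
    case False
    then have "real M - \<alpha> > 0" using M_bounds M_eq_iff by force
    then have "1 < 1 / (real M - \<alpha>)" using M_bounds(2) by (simp add: pos_less_divide_eq)
    then show ?thesis using False by (simp add: R)
  qed (simp add: R)
  moreover have "(\<alpha> \<notin> \<int> \<longrightarrow>
           (\<forall>r::real. 1 \<le> r \<and> ereal r < R_p p \<longrightarrow> Sobolev (M + 2) (ereal r) 0 L \<gamma>) \<and>
           \<not> Sobolev (M + 2) (R_p p) 0 L \<gamma>) \<and>
        (\<alpha> \<in> \<int> \<longrightarrow>
           Sobolev (M + 2) \<infinity> 0 L \<gamma> \<and>
           (\<not> discrete Z \<longleftrightarrow> (\<exists>a b. a < b \<and> {a..b} \<subseteq> Z)) \<and>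
           (\<not> discrete Z \<longrightarrow> \<not> Sobolev (M + 3) 1 0 L \<gamma>))" if fc: "flat_core p L \<gamma>"
  proof -
    obtain N sg Ls where sg: "\<forall>j\<in>{1..N}. sg j \<in> {1, - 1} \<and> Ls j \<ge> 0"
      and rep: "represented_by_curvature {0..flat_core_length p N Ls} (flat_core_curvature p N sg Ls) L \<gamma>"
      using fc unfolding flat_core_def by blast
    interpret flat_chain p N sg Ls by unfold_locales (use sg in auto)
    obtain T c e \<sigma> d where "normal_form L \<gamma> T (flat_core_curvature p N sg Ls) c e \<sigma> d"
      using normal[OF rep] by blast
    note reg = flat_regularity[OF this assms(4) fr]
    show ?thesis
      unfolding assms(5) R using reg(1-3,5) reg(4) by auto
  qed
  ultimately show ?thesis
    unfolding M_def \<alpha>_def by blast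
qed

end
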